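(* The decision problem "Given a positive regular expression $E$ (over some finite alphabet), does an $(E,E)$-crossword exist?" is undecidable; in fact, it is m-equivalent to the Halting Problem.
   Context: Regular expressions are built from letters, $\varepsilon$, union, concatenation and Kleene star; a string matches $E$ if it lies in $L(E)$. For an alphabet $\Sigma$, a $\Sigma$-crossword is a nonempty $m\times n$ array ($m,n\ge1$) of symbols of $\Sigma$; an $(R,C)$-crossword is a $\Sigma$-crossword whose every row (read left to right) matches $R$ and every column (read top to bottom) matches $C$. A regular expression is positive if the empty string does not match it. Two decision problems are m-equivalent if each is many-one reducible to the other via a total computable function. The Halting Problem is the set of (encodings of) pairs $(M,w)$ of a Turing machine $M$ and an input $w$ such that $M$ halts on $w$. *)

theory Defs
  imports Main "HOL-Library.Nat_Bijection"
begin

section \<open>Regular expressions and crosswords\<close>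

datatype (letters: 'a) rexp =
    Eps
  | Letter 'a
  | Union "'a rexp" "'a rexp"
  | Concat "'a rexp" "'a rexp"
  | Star "'a rexp"

primrec lang :: "'a rexp \<Rightarrow> 'a list set" where
  "lang Eps = {[]}"
| "lang (Letter a) = {[a]}"
| "lang (Union r s) = lang r \<union> lang s"
| "lang (Concat r s) = {u @ v | u v. u \<in> lang r \<and> v \<in> lang s}"
| "lang (Star r) = {concat us | us. set us \<subseteq> lang r}"

definition positive :: "'a rexp \<Rightarrow> bool" where
  "positive r \<longleftrightarrow> [] \<notin> lang r"

text \<open>
  An $m \times n$ array is a function \<open>X\<close> of which only the entries \<open>X i j\<close> with
  \<open>i < m\<close> and \<open>j < n\<close> are relevant.
\<close>

definition crossword :: "'a set \<Rightarrow> nat \<Rightarrow> nat \<Rightarrow> (nat \<Rightarrow> nat \<Rightarrow> 'a) \<Rightarrow> bool" where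
  "crossword \<Sigma> m n X \<longleftrightarrow> 1 \<le> m \<and> 1 \<le> n \<and> (\<forall>i<m. \<forall>j<n. X i j \<in> \<Sigma>)"

definition row :: "nat \<Rightarrow> (nat \<Rightarrow> nat \<Rightarrow> 'a) \<Rightarrow> nat \<Rightarrow> 'a list" where
  "row n X i = map (\<lambda>j. X i j) [0..<n]"

definition column :: "nat \<Rightarrow> (nat \<Rightarrow> nat \<Rightarrow> 'a) \<Rightarrow> nat \<Rightarrow> 'a list" where
  "column m X j = map (\<lambda>i. X i j) [0..<m]"

definition RC_crossword ::
  "'a set \<Rightarrow> 'a rexp \<Rightarrow> 'a rexp \<Rightarrow> nat \<Rightarrow> nat \<Rightarrow> (nat \<Rightarrow> nat \<Rightarrow> 'a) \<Rightarrow> bool" where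
  "RC_crossword \<Sigma> R C m n X \<longleftrightarrow>
     crossword \<Sigma> m n X \<and> (\<forall>i<m. row n X i \<in> lang R) \<and> (\<forall>j<n. column m X j \<in> lang C)"

text \<open>
  Problem instances are regular expressions over finite sets of natural numbers. The numbering
  below is an explicit bijection between these expressions and the natural numbers.
\<close>

primrec rexp_encode :: "nat rexp \<Rightarrow> nat" where
  "rexp_encode Eps = 0"
| "rexp_encode (Letter a) = Suc (4 * a)"
| "rexp_encode (Union r s) = Suc (4 * prod_encode (rexp_encode r, rexp_encode s) + 1)"
| "rexp_encode (Concat r s) = Suc (4 * prod_encode (rexp_encode r, rexp_encode s) + 2)"
| "rexp_encode (Star r) = Suc (4 * rexp_encode r + 3)"

text \<open>
  The alphabet \<open>\<Sigma>\<close> is not part of the encoded input: every symbol of an \<open>(E, E)\<close>-crossword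
  is a letter of \<open>E\<close>, so the choice of \<open>\<Sigma> \<supseteq> letters E\<close> does not influence the answer.
\<close>

definition crossword_problem :: "nat set" where
  "crossword_problem =
     {rexp_encode E | E \<Sigma>. finite \<Sigma> \<and> letters E \<subseteq> \<Sigma> \<and> positive E \<and>
        (\<exists>m n X. RC_crossword \<Sigma> E E m n X)}"


section \<open>Computable functions, decidability and many-one equivalence\<close>

text \<open>
  Partial recursive functions on tuples of natural numbers: \<open>computes f xs y\<close> means that
  \<open>f\<close> is defined at \<open>xs\<close> with value \<open>y\<close>. Recursion and minimization act on the first
  component of the tuple.
\<close>

datatype recf =
    Zero
  | Succ
  | Proj nat
  | Comp recf "recf list"
  | Prim_Rec recf recf
  | Mu recf

inductive computes :: "recf \<Rightarrow> nat list \<Rightarrow> nat \<Rightarrow> bool" where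
  zero: "computes Zero xs 0"
| succ: "computes Succ [x] (Suc x)"
| proj: "i < length xs \<Longrightarrow> computes (Proj i) xs (xs ! i)"
| comp: "list_all2 (\<lambda>g y. computes g xs y) gs ys \<Longrightarrow> computes f ys z \<Longrightarrow>
           computes (Comp f gs) xs z"
| prim_rec_0: "computes f xs y \<Longrightarrow> computes (Prim_Rec f g) (0 # xs) y"
| prim_rec_Suc: "computes (Prim_Rec f g) (n # xs) y \<Longrightarrow> computes g (n # y # xs) z \<Longrightarrow>
           computes (Prim_Rec f g) (Suc n # xs) z"
| mu: "computes f (n # xs) 0 \<Longrightarrow> (\<forall>k<n. \<exists>y. computes f (k # xs) (Suc y)) \<Longrightarrow>
           computes (Mu f) xs n"

definition total_computable :: "(nat \<Rightarrow> nat) \<Rightarrow> bool" where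
  "total_computable f \<longleftrightarrow> (\<exists>r. \<forall>x. computes r [x] (f x))"

definition decidable :: "nat set \<Rightarrow> bool" where
  "decidable A \<longleftrightarrow> total_computable (\<lambda>x. if x \<in> A then 1 else 0)"

definition many_one_reducible :: "nat set \<Rightarrow> nat set \<Rightarrow> bool" where
  "many_one_reducible A B \<longleftrightarrow> (\<exists>f. total_computable f \<and> (\<forall>x. x \<in> A \<longleftrightarrow> f x \<in> B))"

definition m_equivalent :: "nat set \<Rightarrow> nat set \<Rightarrow> bool" where
  "m_equivalent A B \<longleftrightarrow> many_one_reducible A B \<and> many_one_reducible B A"


section \<open>Turing machines and the Halting Problem\<close>

text \<open>
  A machine is a finite list of instructions \<open>((q, a), (q', b, d))\<close>: in state \<open>q\<close> reading
  \<open>a\<close>, write \<open>b\<close>, move in direction \<open>d\<close> and enter state \<open>q'\<close>. If several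
  instructions share the same \<open>(q, a)\<close>, only the first one counts (\<open>map_of\<close>), so every such
  list is a deterministic machine; it halts when no instruction applies. The initial state and
  the blank symbol are both \<open>0\<close>; the tape is infinite in both directions.
\<close>

datatype direction = Left | Right

type_synonym tm = "((nat \<times> nat) \<times> (nat \<times> nat \<times> direction)) list"

text \<open>Configurations consist of the state, the head position and the tape contents.\<close>

type_synonym tm_config = "nat \<times> int \<times> (int \<Rightarrow> nat)"

fun move :: "direction \<Rightarrow> int \<Rightarrow> int" where
  "move Left p = p - 1"
| "move Right p = p + 1"

fun tm_step :: "tm \<Rightarrow> tm_config \<Rightarrow> tm_config option" where
  "tm_step M (q, p, t) =
     (case map_of M (q, t p) of
        None \<Rightarrow> None
      | Some (q', b, d) \<Rightarrow> Some (q', move d p, t(p := b)))"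

text \<open>
  The input letter \<open>a\<close> is written on the tape as the symbol \<open>Suc a\<close>, so that inputs never
  contain the blank.
\<close>

definition tm_init :: "nat list \<Rightarrow> tm_config" where
  "tm_init w = (0, 0, \<lambda>i. if 0 \<le> i \<and> i < int (length w) then Suc (w ! nat i) else 0)"

definition tm_halts :: "tm \<Rightarrow> nat list \<Rightarrow> bool" where
  "tm_halts M w \<longleftrightarrow>
     (\<exists>c. (tm_init w, c) \<in> {(c, c'). tm_step M c = Some c'}\<^sup>* \<and> tm_step M c = None)"

fun instr_encode :: "(nat \<times> nat) \<times> (nat \<times> nat \<times> direction) \<Rightarrow> nat" where
  "instr_encode ((q, a), (q', b, d)) =
     prod_encode (prod_encode (q, a),
       prod_encode (q', 2 * b + (case d of Left \<Rightarrow> 0 | Right \<Rightarrow> 1)))"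

definition tm_encode :: "tm \<Rightarrow> nat" where
  "tm_encode M = list_encode (map instr_encode M)"

definition halting_problem :: "nat set" where
  "halting_problem = {prod_encode (tm_encode M, list_encode w) | M w. tm_halts M w}"

end

theory Submission
  imports Defs
begin

text \<open>
  Both problems are recursively enumerable: a halting computation can be simulated, and an
  \<open>(E, E)\<close>-crossword can be certified by finite tables. Conversely, every recursively enumerable
  set \<open>A\<close> reduces to both. A search for a witness of \<open>x \<in> A\<close> is a program with finitely many
  registers, hence a Turing machine \<open>M\<close> that halts on the word of \<open>x\<close> zeros if and only if
  \<open>x \<in> A\<close>. The halting computations of \<open>M\<close> are the crosswords whose rows describe single moves
  and whose columns force successive moves to fit together. Corner and edge symbols merge the
  languages of the rows and of the columns into one. Only one factor of the resulting expression,
  the input word, depends on \<open>x\<close>, so the reduction is easily computed.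
\<close>

section \<open>Computable functions and recursively enumerable predicates\<close>

text \<open>The array guesses its own size: its height is the length of the computation, its width
  the amount of tape, and stars in the first row guess the blank padding. Too little padding leaves
  the state without an applicable move but never yields a false halt, so no rule has to extend the
  tape. The chains of old and new symbols in the columns begin and end with \<open>None\<close>;
  this tells the initial row and the final row apart from the moves between them. The machine is
  fixed and its input is unary for one reason: the code of the expression is then a primitive
  recursion over constants, and no syntax of machines has to be manipulated by a computable
  function. The price is that recursive functions must be brought to Turing machines that start on a
  unary word. With 0 as the only input letter, the initial tape already is the tape of a counter
  machine whose register 0 holds the input, except for a marker on its left. Transposition is an
  unavoidable symmetry of arrays over one language, so the frame can recover an array only up to
  transposition.\<close>

definition computable :: "nat \<Rightarrow> (nat list \<Rightarrow> nat) \<Rightarrow> bool" where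
  "computable k f \<longleftrightarrow> (\<exists>r. \<forall>xs. length xs = k \<longrightarrow> computes r xs (f xs))"

definition computable_pred :: "nat \<Rightarrow> (nat list \<Rightarrow> bool) \<Rightarrow> bool" where
  "computable_pred k P \<longleftrightarrow> computable k (\<lambda>xs. of_bool (P xs))"

text \<open>Normal form: the projection of a decidable relation. A single number has to witness
  everything, so the closure lemmas fold several witnesses into one.\<close>

definition re_pred :: "nat \<Rightarrow> (nat list \<Rightarrow> bool) \<Rightarrow> bool" where
  "re_pred k P \<longleftrightarrow>
     (\<exists>Q. computable_pred (Suc k) Q \<and> (\<forall>xs. length xs = k \<longrightarrow> P xs \<longleftrightarrow> (\<exists>n. Q (n # xs))))"

lemma computable_cong:
  assumes "computable k f" and "\<And>xs. length xs = k \<Longrightarrow> f xs = g xs"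
  shows "computable k g"
  using assms by (auto simp: computable_def)

lemma computable_pred_cong:
  assumes "computable_pred k P" and "\<And>xs. length xs = k \<Longrightarrow> P xs \<longleftrightarrow> Q xs"
  shows "computable_pred k Q"
  using assms unfolding computable_pred_def by (auto elim: computable_cong)

lemma total_computable_iff: "total_computable f \<longleftrightarrow> computable 1 (\<lambda>xs. f (hd xs))"
proof
  assume "total_computable f"
  then obtain r where r: "\<And>x. computes r [x] (f x)"
    by (auto simp: total_computable_def)
  have "computes r xs (f (hd xs))" if "length xs = 1" for xs
    using that r by (cases xs) auto
  then show "computable 1 (\<lambda>xs. f (hd xs))"
    by (auto simp: computable_def)
next
  assume "computable 1 (\<lambda>xs. f (hd xs))"
  then obtain r where "\<And>xs. length xs = 1 \<Longrightarrow> computes r xs (f (hd xs))"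
    by (auto simp: computable_def)
  from this[of "[x]" for x] show "total_computable f"
    by (auto simp: total_computable_def)
qed

lemma computable_comp:
  assumes "computable n f" "length gs = n" "\<And>g. g \<in> set gs \<Longrightarrow> computable k g"
  shows "computable k (\<lambda>xs. f (map (\<lambda>g. g xs) gs))"
proof -
  obtain r where r: "\<And>xs. length xs = n \<Longrightarrow> computes r xs (f xs)"
    using assms(1) by (auto simp: computable_def)
  obtain R where R: "\<And>g xs. g \<in> set gs \<Longrightarrow> length xs = k \<Longrightarrow> computes (R g) xs (g xs)"
    using assms(3) unfolding computable_def by metis
  have "computes (Comp r (map R gs)) xs (f (map (\<lambda>g. g xs) gs))" if "length xs = k" for xs
    using that assms(2) R r
    by (intro computes.comp[where ys = "map (\<lambda>g. g xs) gs"]) (auto simp: list_all2_conv_all_nth)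
  then show ?thesis
    by (auto simp: computable_def)
qed

lemma computable_nth: "i < k \<Longrightarrow> computable k (\<lambda>xs. xs ! i)"
  unfolding computable_def by (intro exI[of _ "Proj i"]) (auto intro: computes.proj)

text \<open>Arguments are dropped, permuted and repeated by composition with projections; the
  treatment of quantifiers relies on this to move bound variables.\<close>

lemma computable_reindex:
  assumes "computable m f" "length is = m" "\<forall>i\<in>set is. i < k"
  shows "computable k (\<lambda>xs. f (map ((!) xs) is))"
proof -
  have "computable k (\<lambda>xs. f (map (\<lambda>g. g xs) (map (\<lambda>i xs. xs ! i) is)))"
    using assms by (intro computable_comp[of m]) (auto intro: computable_nth)
  then show ?thesis
    by (simp add: comp_def)
qed

lemma map_nth_tl: "length xs = Suc k \<Longrightarrow> map ((!) xs) [Suc 0..<Suc k] = tl xs"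
  by (intro nth_equalityI) (auto simp: nth_tl simp del: upt_Suc)

lemma computable_tl: "computable k f \<Longrightarrow> computable (Suc k) (\<lambda>xs. f (tl xs))"
  by (rule computable_cong[OF computable_reindex[of k _ "[Suc 0..<Suc k]"]])
    (auto simp del: upt_Suc simp: map_nth_tl)

lemma computable_hd: "computable (Suc k) hd"
  by (rule computable_cong[OF computable_nth[of 0]]) (auto simp: length_Suc_conv)

text \<open>Arguments are addressed like de Bruijn indices: each recursion, minimization or bounded
  quantifier puts its variable in front, so outer variables lie one tail deeper.\<close>

lemmas computable_var =
  computable_hd computable_hd[THEN computable_tl]
  computable_hd[THEN computable_tl, THEN computable_tl]
  computable_hd[THEN computable_tl, THEN computable_tl, THEN computable_tl]
  computable_hd[THEN computable_tl, THEN computable_tl, THEN computable_tl, THEN computable_tl]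
  computable_hd[THEN computable_tl, THEN computable_tl, THEN computable_tl, THEN computable_tl,
    THEN computable_tl]
  computable_hd[THEN computable_tl, THEN computable_tl, THEN computable_tl, THEN computable_tl,
    THEN computable_tl, THEN computable_tl]
  computable_hd[THEN computable_tl, THEN computable_tl, THEN computable_tl, THEN computable_tl,
    THEN computable_tl, THEN computable_tl, THEN computable_tl]
  computable_hd[THEN computable_tl, THEN computable_tl, THEN computable_tl, THEN computable_tl,
    THEN computable_tl, THEN computable_tl, THEN computable_tl, THEN computable_tl]
  computable_hd[THEN computable_tl, THEN computable_tl, THEN computable_tl, THEN computable_tl,
    THEN computable_tl, THEN computable_tl, THEN computable_tl, THEN computable_tl,
    THEN computable_tl]
  computable_hd[THEN computable_tl, THEN computable_tl, THEN computable_tl, THEN computable_tl,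
    THEN computable_tl, THEN computable_tl, THEN computable_tl, THEN computable_tl,
    THEN computable_tl, THEN computable_tl]

lemma computable_Suc: "computable k g \<Longrightarrow> computable k (\<lambda>xs. Suc (g xs))"
proof -
  assume g: "computable k g"
  have "computable 1 (\<lambda>xs. Suc (hd xs))"
    unfolding computable_def
    by (intro exI[of _ Succ]) (auto simp: length_Suc_conv intro: computes.succ)
  from computable_comp[OF this, of "[g]" k] g show ?thesis
    by simp
qed

lemma computable_const: "computable k (\<lambda>_. c)"
proof (induction c)
  case 0
  show ?case
    unfolding computable_def by (intro exI[of _ Zero]) (auto intro: computes.zero)
next
  case (Suc c)
  then show ?case
    by (rule computable_Suc)
qed

lemma computable_fun1:
  assumes "computable 1 (\<lambda>ys. F (hd ys))" "computable k g"
  shows "computable k (\<lambda>xs. F (g xs))"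
  using computable_comp[OF assms(1), of "[g]" k] assms(2) by simp

lemma computable_fun2:
  assumes "computable 2 (\<lambda>ys. F (hd ys) (hd (tl ys)))" "computable k g" "computable k h"
  shows "computable k (\<lambda>xs. F (g xs) (h xs))"
  using computable_comp[OF assms(1), of "[g, h]" k] assms(2,3) by auto

lemma computable_subst:
  assumes "computable (Suc k) f" "computable k g"
  shows "computable k (\<lambda>xs. f (g xs # xs))"
proof -
  have *: "computable k (\<lambda>xs. f (map (\<lambda>h. h xs) (g # map (\<lambda>i xs. xs ! i) [0..<k])))"
    using assms by (intro computable_comp[of "Suc k"]) (auto intro: computable_nth)
  show ?thesis
    by (rule computable_cong[OF *]) (auto simp: comp_def map_nth)
qed

text \<open>The step may use the counter, the previous value and all parameters, and the recursion
  argument is an arbitrary computable \<open>g\<close>. In this form any term built with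
  \<open>rec_nat\<close> can be recognized syntactically.\<close>

lemma computable_rec:
  assumes a: "computable k a"
    and s: "computable (Suc (Suc k)) (\<lambda>ys. s (hd ys) (hd (tl ys)) (tl (tl ys)))"
    and g: "computable k g"
  shows "computable k (\<lambda>xs. rec_nat (a xs) (\<lambda>n y. s n y xs) (g xs))"
proof -
  obtain ra where ra: "\<And>xs. length xs = k \<Longrightarrow> computes ra xs (a xs)"
    using a by (auto simp: computable_def)
  obtain rs where rs: "\<And>ys. length ys = Suc (Suc k) \<Longrightarrow>
      computes rs ys (s (hd ys) (hd (tl ys)) (tl (tl ys)))"
    using s by (auto simp: computable_def)
  have "computes (Prim_Rec ra rs) (n # xs) (rec_nat (a xs) (\<lambda>n y. s n y xs) n)"
    if "length xs = k" for n xs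
  proof (induction n)
    case 0
    then show ?case
      using ra that by (auto intro: computes.prim_rec_0)
  next
    case (Suc n)
    show ?case
      using computes.prim_rec_Suc[OF Suc.IH rs] that by simp
  qed
  then have "computable (Suc k) (\<lambda>ys. rec_nat (a (tl ys)) (\<lambda>n y. s n y (tl ys)) (hd ys))"
    unfolding computable_def by (intro exI[of _ "Prim_Rec ra rs"]) (auto simp: length_Suc_conv)
  from computable_subst[OF this g] show ?thesis
    by simp
qed

section \<open>Arithmetic, minimization and decidable predicates\<close>

lemma computable_pred_nat: "computable k g \<Longrightarrow> computable k (\<lambda>xs. g xs - 1)"
proof (rule computable_fun1[where F = "\<lambda>m. m - 1"])
  have "rec_nat 0 (\<lambda>n _. n) m = m - 1" for m :: nat
    by (cases m) auto
  moreover have "computable 1 (\<lambda>ys. rec_nat 0 (\<lambda>n _. n) (hd ys))"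
    unfolding One_nat_def by (intro computable_rec computable_const computable_var)
  ultimately show "computable 1 (\<lambda>ys. hd ys - 1)"
    by simp
qed

lemma computable_diff:
  "computable k g \<Longrightarrow> computable k h \<Longrightarrow> computable k (\<lambda>xs. g xs - h xs)"
proof (rule computable_fun2[where F = "(-)"])
  have "rec_nat m (\<lambda>_ y. y - 1) n = m - n" for m n :: nat
    by (induction n) auto
  moreover have "computable 2 (\<lambda>ys. rec_nat (hd ys) (\<lambda>_ y. y - 1) (hd (tl ys)))"
    unfolding numeral_2_eq_2
    by (intro computable_rec computable_pred_nat computable_var)
  ultimately show "computable 2 (\<lambda>ys. hd ys - hd (tl ys))"
    by simp
qed

lemma computable_Least:
  assumes P: "computable_pred (Suc k) (\<lambda>ys. P (hd ys) (tl ys))"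
    and ex: "\<And>xs. length xs = k \<Longrightarrow> \<exists>z. P z xs"
  shows "computable k (\<lambda>xs. LEAST z. P z xs)"
proof -
  \<comment> \<open>Minimization stops at the value 0, whereas truth is coded by 1.\<close>
  have "computable (Suc k) (\<lambda>ys. 1 - of_bool (P (hd ys) (tl ys)))"
    using P unfolding computable_pred_def by (intro computable_diff computable_const)
  then obtain r where r: "\<And>ys. length ys = Suc k \<Longrightarrow> computes r ys (1 - of_bool (P (hd ys) (tl ys)))"
    by (auto simp: computable_def)
  have "computes (Mu r) xs (LEAST z. P z xs)" if l: "length xs = k" for xs
  proof (rule computes.mu)
    have "P (LEAST z. P z xs) xs"
      using ex[OF l] by (auto intro: LeastI)
    then show "computes r ((LEAST z. P z xs) # xs) 0"
      using r[of "(LEAST z. P z xs) # xs"] l by simp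
    have "computes r (z # xs) (Suc 0)" if "z < (LEAST z. P z xs)" for z
      using r[of "z # xs"] l not_less_Least[OF that] by simp
    then show "\<forall>z<LEAST z. P z xs. \<exists>y. computes r (z # xs) (Suc y)"
      by blast
  qed
  then show ?thesis
    by (auto simp: computable_def)
qed

lemma computable_add:
  "computable k g \<Longrightarrow> computable k h \<Longrightarrow> computable k (\<lambda>xs. g xs + h xs)"
proof (rule computable_fun2[where F = "(+)"])
  have "rec_nat m (\<lambda>_ y. Suc y) n = m + n" for m n :: nat
    by (induction n) auto
  moreover have "computable 2 (\<lambda>ys. rec_nat (hd ys) (\<lambda>_ y. Suc y) (hd (tl ys)))"
    unfolding numeral_2_eq_2
    by (intro computable_rec computable_Suc computable_var)
  ultimately show "computable 2 (\<lambda>ys. hd ys + hd (tl ys))"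
    by simp
qed

lemma computable_mult:
  "computable k g \<Longrightarrow> computable k h \<Longrightarrow> computable k (\<lambda>xs. g xs * h xs)"
proof (rule computable_fun2[where F = "(*)"])
  have "rec_nat 0 (\<lambda>_ y. y + m) n = m * n" for m n :: nat
    by (induction n) auto
  moreover have "computable 2 (\<lambda>ys. rec_nat 0 (\<lambda>_ y. y + hd ys) (hd (tl ys)))"
    unfolding numeral_2_eq_2
    by (intro computable_rec computable_const computable_add computable_var)
  ultimately show "computable 2 (\<lambda>ys. hd ys * hd (tl ys))"
    by simp
qed

lemmas computable_arith =
  computable_const computable_var computable_Suc computable_add computable_mult
  computable_pred_nat computable_diff

lemma computable_pred_le:
  assumes "computable k g" "computable k h"
  shows "computable_pred k (\<lambda>xs. g xs \<le> h xs)"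
proof -
  have "of_bool (a \<le> b) = 1 - (a - b)" for a b :: nat
    by auto
  with assms show ?thesis
    by (auto simp: computable_pred_def intro!: computable_diff computable_const)
qed

lemma computable_pred_not: "computable_pred k P \<Longrightarrow> computable_pred k (\<lambda>xs. \<not> P xs)"
proof -
  have "of_bool (\<not> p) = 1 - (of_bool p :: nat)" for p
    by simp
  then show "computable_pred k P \<Longrightarrow> ?thesis"
    unfolding computable_pred_def by (simp only:, intro computable_diff computable_const)
qed

lemma computable_pred_conj:
  "computable_pred k P \<Longrightarrow> computable_pred k Q \<Longrightarrow> computable_pred k (\<lambda>xs. P xs \<and> Q xs)"
  unfolding computable_pred_def of_bool_conj by (intro computable_mult)

lemma computable_pred_disj:
  "computable_pred k P \<Longrightarrow> computable_pred k Q \<Longrightarrow> computable_pred k (\<lambda>xs. P xs \<or> Q xs)"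
  using computable_pred_not[OF computable_pred_conj[OF computable_pred_not computable_pred_not]]
  by simp

lemma computable_pred_imp:
  "computable_pred k P \<Longrightarrow> computable_pred k Q \<Longrightarrow> computable_pred k (\<lambda>xs. P xs \<longrightarrow> Q xs)"
  unfolding imp_conv_disj by (intro computable_pred_disj computable_pred_not)

lemma computable_pred_less:
  "computable k g \<Longrightarrow> computable k h \<Longrightarrow> computable_pred k (\<lambda>xs. g xs < h xs)"
  unfolding less_eq_Suc_le by (intro computable_pred_le computable_Suc)

lemma computable_pred_eq:
  assumes "computable k g" "computable k h"
  shows "computable_pred k (\<lambda>xs. g xs = h xs)"
  using computable_pred_conj[OF computable_pred_le[OF assms] computable_pred_le[OF assms(2,1)]]
  by (simp add: order_eq_iff)

lemma computable_LEAST: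
  assumes "computable_pred (Suc k) (\<lambda>ys. P (hd ys) (tl ys))" "\<And>xs. \<exists>z. P z xs"
  shows "computable k (\<lambda>xs. LEAST z. P z xs)"
  using assms by (intro computable_Least)

lemma computable_if:
  assumes "computable_pred k P" "computable k f" "computable k g"
  shows "computable k (\<lambda>xs. if P xs then f xs else g xs)"
proof -
  have "computable k (\<lambda>xs. of_bool (P xs) * f xs + (1 - of_bool (P xs)) * g xs)"
    using assms unfolding computable_pred_def
    by (intro computable_arith)
  then show ?thesis
    by (rule computable_cong) auto
qed

lemma computable_pred_tl: "computable_pred k P \<Longrightarrow> computable_pred (Suc k) (\<lambda>xs. P (tl xs))"
  unfolding computable_pred_def by (rule computable_tl)

text \<open>The search for a \<open>z\<close> that satisfies the predicate or reaches the bound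
  always ends, and it ends below the bound exactly if there is a witness. Minimization thus decides
  a bounded quantifier.\<close>

lemma computable_pred_bex:
  assumes P: "computable_pred (Suc k) (\<lambda>ys. P (hd ys) (tl ys))" and g: "computable k g"
  shows "computable_pred k (\<lambda>xs. \<exists>z<g xs. P z xs)"
proof -
  have eq: "(\<exists>z<b. Q z) \<longleftrightarrow> (LEAST z. Q z \<or> b \<le> z) < b" for b :: nat and Q
  proof
    assume "\<exists>z<b. Q z"
    then obtain z where "z < b" "Q z"
      by blast
    then show "(LEAST z. Q z \<or> b \<le> z) < b"
      using Least_le[of "\<lambda>z. Q z \<or> b \<le> z" z] by simp
  next
    assume "(LEAST z. Q z \<or> b \<le> z) < b"
    moreover have "Q (LEAST z. Q z \<or> b \<le> z) \<or> b \<le> (LEAST z. Q z \<or> b \<le> z)"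
      by (rule LeastI[of _ b]) simp
    ultimately show "\<exists>z<b. Q z"
      by (metis leD)
  qed
  have "computable k (\<lambda>xs. LEAST z. P z xs \<or> g xs \<le> z)"
    by (rule computable_LEAST)
      (use g in \<open>auto intro!: computable_pred_disj P computable_pred_le computable_hd computable_tl\<close>)
  then show ?thesis
    unfolding eq using g by (rule computable_pred_less)
qed

lemma computable_pred_ball:
  assumes P: "computable_pred (Suc k) (\<lambda>ys. P (hd ys) (tl ys))" and g: "computable k g"
  shows "computable_pred k (\<lambda>xs. \<forall>z<g xs. P z xs)"
proof -
  have "computable_pred k (\<lambda>xs. \<not> (\<exists>z<g xs. \<not> P z xs))"
    using P g by (intro computable_pred_not computable_pred_bex)
  then show ?thesis
    by simp
qed

section \<open>Pairing, coded lists and coded finite maps\<close>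

lemma computable_prod_encode:
  "computable k g \<Longrightarrow> computable k h \<Longrightarrow> computable k (\<lambda>xs. prod_encode (g xs, h xs))"
proof -
  have tri: "rec_nat 0 (\<lambda>n y. y + Suc n) n = triangle n" for n
    by (induction n) auto
  have "computable k (\<lambda>xs. rec_nat 0 (\<lambda>n y. y + Suc n) (g xs + h xs) + g xs)"
    if "computable k g" "computable k h"
    using that by (intro computable_arith computable_rec)
  then show "computable k g \<Longrightarrow> computable k h \<Longrightarrow> ?thesis"
    by (simp only: tri prod_encode_def prod.case)
qed

definition pfst :: "nat \<Rightarrow> nat" where "pfst c = fst (prod_decode c)"
definition psnd :: "nat \<Rightarrow> nat" where "psnd c = snd (prod_decode c)"

lemma pfst_prod_encode [simp]: "pfst (prod_encode (a, b)) = a"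
  and psnd_prod_encode [simp]: "psnd (prod_encode (a, b)) = b"
  by (simp_all add: pfst_def psnd_def)

lemma prod_encode_pfst_psnd [simp]: "prod_encode (pfst c, psnd c) = c"
  by (simp add: pfst_def psnd_def)

text \<open>Decoding is a search: the first component is the least number that completes to the
  code, and the missing second component is bounded by the code. Once the first component is known,
  minimization finds the second.\<close>

lemma computable_pfst: "computable k g \<Longrightarrow> computable k (\<lambda>xs. pfst (g xs))"
proof (rule computable_fun1[where F = pfst])
  have "pfst c = (LEAST a. \<exists>b<Suc c. prod_encode (a, b) = c)" for c
  proof (rule Least_equality[symmetric])
    have "psnd c < Suc c"
      using le_prod_encode_2[of "psnd c" "pfst c"] by simp
    then show "\<exists>b<Suc c. prod_encode (pfst c, b) = c"
      by (metis prod_encode_pfst_psnd)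
  qed auto
  moreover have ex: "\<exists>a. \<exists>b<Suc c. prod_encode (a, b) = c" for c
    by (metis le_prod_encode_2 less_Suc_eq_le prod_encode_pfst_psnd)
  then have "computable 1 (\<lambda>ys. LEAST a. \<exists>b<Suc (hd ys). prod_encode (a, b) = hd ys)"
    unfolding One_nat_def
    by (intro computable_LEAST computable_pred_bex computable_pred_eq computable_prod_encode
        computable_arith)
  ultimately show "computable 1 (\<lambda>ys. pfst (hd ys))"
    by simp
qed

lemma computable_psnd: "computable k g \<Longrightarrow> computable k (\<lambda>xs. psnd (g xs))"
proof (rule computable_fun1[where F = psnd])
  have "psnd c = (LEAST b. prod_encode (pfst c, b) = c)" for c
  proof (rule Least_equality[symmetric])
    show "psnd c \<le> b" if "prod_encode (pfst c, b) = c" for b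
      using arg_cong[OF that, of psnd] by simp
  qed simp
  moreover have ex: "\<exists>b. prod_encode (pfst c, b) = c" for c
    by (metis prod_encode_pfst_psnd)
  then have "computable 1 (\<lambda>ys. LEAST b. prod_encode (pfst (hd ys), b) = hd ys)"
    unfolding One_nat_def
    by (intro computable_LEAST computable_pred_eq computable_prod_encode computable_pfst
        computable_arith)
  ultimately show "computable 1 (\<lambda>ys. psnd (hd ys))"
    by simp
qed

lemmas computable_intros =
  computable_const computable_var computable_Suc computable_add computable_mult
  computable_pred_nat computable_diff computable_if computable_prod_encode computable_pfst
  computable_psnd
  computable_pred_bex computable_pred_ball computable_pred_le computable_pred_less
  computable_pred_eq computable_pred_not computable_pred_conj computable_pred_disj
  computable_pred_imp

lemma computable_div2: "computable k g \<Longrightarrow> computable k (\<lambda>xs. g xs div 2)"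
proof (rule computable_fun1[where F = "\<lambda>m. m div 2"])
  have "c div 2 = (LEAST q. c < 2 * q + 2)" for c :: nat
    by (rule Least_equality[symmetric]) auto
  moreover have "\<exists>q. c < 2 * q + 2" for c :: nat
    by presburger
  then have "computable 1 (\<lambda>ys. LEAST q. hd ys < 2 * q + 2)"
    unfolding One_nat_def by (intro computable_LEAST computable_intros)
  ultimately show "computable 1 (\<lambda>ys. hd ys div 2)"
    by simp
qed

lemma computable_pred_even: "computable k g \<Longrightarrow> computable_pred k (\<lambda>xs. even (g xs))"
proof -
  have "even n \<longleftrightarrow> n = 2 * (n div 2)" for n :: nat
    by presburger
  then show "computable k g \<Longrightarrow> ?thesis"
    by (simp only:, intro computable_intros computable_div2)
qed

lemma psnd_0: "psnd 0 = 0"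
  using psnd_prod_encode[of 0 0] by (simp add: prod_encode_def)

text \<open>List codes nest as \<open>Suc (prod_encode (head, tail))\<close>, with 0 for the empty
  list. Dropping elements iterates the second projection, which maps 0 to 0, so positions past the
  end stay empty. Results are shifted by one to reserve 0 for this case.\<close>

definition code_nth :: "nat \<Rightarrow> nat \<Rightarrow> nat" where
  "code_nth c i = (let d = rec_nat c (\<lambda>_ d. psnd (d - 1)) i in if d = 0 then 0 else Suc (pfst (d - 1)))"

lemma code_nth_list_encode:
  "code_nth (list_encode xs) i = (if i < length xs then Suc (xs ! i) else 0)"
proof -
  have "rec_nat (list_encode xs) (\<lambda>_ d. psnd (d - 1)) i = list_encode (drop i xs)"
  proof (induction i)
    case (Suc i)
    show ?case
    proof (cases "i < length xs")
      case True
      then show ?thesis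
        using Suc by (simp add: Cons_nth_drop_Suc[symmetric])
    next
      case False
      then show ?thesis
        using Suc psnd_0 by simp
    qed
  qed simp
  then show ?thesis
    by (auto simp: code_nth_def Cons_nth_drop_Suc[symmetric])
qed

lemma computable_code_nth:
  "computable k g \<Longrightarrow> computable k h \<Longrightarrow> computable k (\<lambda>xs. code_nth (g xs) (h xs))"
  unfolding code_nth_def Let_def by (intro computable_intros computable_rec)

text \<open>
  A list of codes of pairs serves as a finite map, read as with \<^const>\<open>map_of\<close>; the value
  \<open>v\<close> is returned as \<open>Suc v\<close>, and \<open>0\<close> means that the key does not occur.
\<close>

definition lookup :: "nat \<Rightarrow> nat \<Rightarrow> nat" where
  "lookup c a =
     (let v = code_nth c (LEAST i. code_nth c i = 0 \<or> pfst (code_nth c i - 1) = a)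
      in if v = 0 then 0 else Suc (psnd (v - 1)))"

definition map_encode :: "(nat \<times> nat) list \<Rightarrow> nat" where
  "map_encode ps = list_encode (map prod_encode ps)"

lemma lookup_map_encode:
  "lookup (map_encode ps) a = (case map_of ps a of None \<Rightarrow> 0 | Some v \<Rightarrow> Suc v)"
proof -
  define c where "c = map_encode ps"
  have nth: "code_nth c i = (if i < length ps then Suc (prod_encode (ps ! i)) else 0)" for i
    by (simp add: c_def map_encode_def code_nth_list_encode)
  define P where "P i \<longleftrightarrow> code_nth c i = 0 \<or> pfst (code_nth c i - 1) = a" for i
  have P: "P i \<longleftrightarrow> i \<ge> length ps \<or> fst (ps ! i) = a" for i
    by (cases "ps ! i") (auto simp: P_def nth)
  define j where "j = (LEAST i. P i)"
  have Pj: "P j" unfolding j_def by (rule LeastI[of _ "length ps"]) (simp add: P)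
  have less: "\<not> P i" if "i < j" for i using that not_less_Least by (auto simp: j_def)
  have "lookup c a = (let v = code_nth c j in if v = 0 then 0 else Suc (psnd (v - 1)))"
    by (simp add: lookup_def P_def j_def)
  then have lk: "lookup c a = (if j < length ps then Suc (snd (ps ! j)) else 0)"
    by (cases "ps ! j") (simp add: nth)
  have mo: "map_of ps a = map_of (drop i ps) a" if "i \<le> j" for i
    using that
  proof (induction i)
    case (Suc i)
    then have "\<not> P i" using less by auto
    then have "i < length ps" "fst (ps ! i) \<noteq> a" by (auto simp: P)
    then show ?case using Suc by (cases "ps ! i") (auto simp: Cons_nth_drop_Suc[symmetric])
  qed simp
  show ?thesis
  proof (cases "j < length ps")
    case True
    then have "fst (ps ! j) = a" using Pj by (simp add: P)
    then have "map_of ps a = Some (snd (ps ! j))"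
      using mo[of j] True by (cases "ps ! j") (auto simp: Cons_nth_drop_Suc[symmetric])
    then show ?thesis using lk True by (simp add: c_def)
  next
    case False
    then show ?thesis using mo[of j] lk by (simp add: c_def)
  qed
qed

lemma computable_lookup:
  "computable k g \<Longrightarrow> computable k h \<Longrightarrow> computable k (\<lambda>xs. lookup (g xs) (h xs))"
proof (rule computable_fun2[where F = lookup])
  have ex: "\<exists>i. code_nth c i = 0 \<or> Q i" for c Q
    by (rule exI[of _ "length (list_decode c)"])
      (metis code_nth_list_encode less_irrefl list_decode_inverse)
  show "computable 2 (\<lambda>ys. lookup (hd ys) (hd (tl ys)))"
    unfolding lookup_def Let_def numeral_2_eq_2
    by (intro computable_intros computable_code_nth computable_LEAST ex)
qed

section \<open>Closure properties of enumerable predicates\<close>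

lemma re_predI: "computable_pred k P \<Longrightarrow> re_pred k P"
  unfolding re_pred_def by (intro exI[of _ "\<lambda>ys. P (tl ys)"]) (auto intro: computable_pred_tl)

lemma computable_pred_bound_arg:
  assumes "computable_pred (Suc k) Q"
  shows "computable_pred (Suc k) (\<lambda>ys. \<exists>n<hd ys. Q (n # tl ys))"
proof (rule computable_pred_bex)
  \<comment> \<open>Position 1 holds the bound on the witness, which \<open>Q\<close> does not
    see.\<close>
  have "computable (Suc (Suc k)) (\<lambda>ys. of_bool (Q (map ((!) ys) (0 # [2..<Suc (Suc k)]))))"
    using assms unfolding computable_pred_def by (rule computable_reindex) auto
  then have "computable_pred (Suc (Suc k)) (\<lambda>ys. Q (map ((!) ys) (0 # [2..<Suc (Suc k)])))"
    by (simp add: computable_pred_def)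
  moreover have eq: "map ((!) ys) (0 # [2..<Suc (Suc k)]) = hd ys # tl (tl ys)"
    if "length ys = Suc (Suc k)" for ys
    using that by (auto intro!: nth_equalityI simp: length_Suc_conv nth_Cons' numeral_2_eq_2 simp del: upt_Suc)
  ultimately show "computable_pred (Suc (Suc k)) (\<lambda>ys. Q (hd ys # tl (tl ys)))"
    by (elim computable_pred_cong) (simp only: eq)
qed (rule computable_hd)

text \<open>Reading the first argument as a strict bound on the witness makes the relation monotone:
  once true, it stays true at every later stage. Finitely many searches can then be synchronized by
  a maximum.\<close>

lemma re_predE_mono:
  assumes "re_pred k P"
  obtains Q where "computable_pred (Suc k) Q"
    "\<And>xs. length xs = k \<Longrightarrow> P xs \<longleftrightarrow> (\<exists>n. Q (n # xs))"
    "\<And>n n' xs. n \<le> n' \<Longrightarrow> Q (n # xs) \<Longrightarrow> Q (n' # xs)"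
proof -
  obtain Q where Q: "computable_pred (Suc k) Q" "\<And>xs. length xs = k \<Longrightarrow> P xs \<longleftrightarrow> (\<exists>n. Q (n # xs))"
    using assms by (auto simp: re_pred_def)
  show thesis
  proof (rule that[OF computable_pred_bound_arg[OF Q(1)]])
    show "P xs \<longleftrightarrow> (\<exists>n. \<exists>m<hd (n # xs). Q (m # tl (n # xs)))" if "length xs = k" for xs
      using Q(2)[OF that] by auto
  qed (use order_less_le_trans in auto)
qed

lemma re_pred_conj:
  assumes "re_pred k P" "re_pred k P'"
  shows "re_pred k (\<lambda>xs. P xs \<and> P' xs)"
proof -
  obtain Q where Q: "computable_pred (Suc k) Q" "\<And>xs. length xs = k \<Longrightarrow> P xs \<longleftrightarrow> (\<exists>n. Q (n # xs))"
    "\<And>n n' xs. n \<le> n' \<Longrightarrow> Q (n # xs) \<Longrightarrow> Q (n' # xs)"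
    using re_predE_mono[OF assms(1)] by blast
  obtain Q' where Q': "computable_pred (Suc k) Q'"
    "\<And>xs. length xs = k \<Longrightarrow> P' xs \<longleftrightarrow> (\<exists>n. Q' (n # xs))"
    "\<And>n n' xs. n \<le> n' \<Longrightarrow> Q' (n # xs) \<Longrightarrow> Q' (n' # xs)"
    using re_predE_mono[OF assms(2)] by blast
  have "P xs \<and> P' xs \<longleftrightarrow> (\<exists>n. Q (n # xs) \<and> Q' (n # xs))" if l: "length xs = k" for xs
  proof
    assume "P xs \<and> P' xs"
    then obtain n n' where "Q (n # xs)" "Q' (n' # xs)"
      using Q(2)[OF l] Q'(2)[OF l] by blast
    then have "Q (max n n' # xs)" "Q' (max n n' # xs)"
      using Q(3)[of n "max n n'"] Q'(3)[of n' "max n n'"] by auto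
    then show "\<exists>n. Q (n # xs) \<and> Q' (n # xs)"
      by blast
  qed (use Q(2)[OF l] Q'(2)[OF l] in blast)
  then show ?thesis
    unfolding re_pred_def
    by (intro exI[of _ "\<lambda>ys. Q ys \<and> Q' ys"]) (simp add: computable_pred_conj Q(1) Q'(1))
qed

lemma computable_pred_swap:
  assumes "computable_pred (Suc (Suc k)) Q"
  shows "computable_pred (Suc (Suc k)) (\<lambda>ys. Q (hd (tl ys) # hd ys # tl (tl ys)))"
proof -
  have "computable (Suc (Suc k)) (\<lambda>ys. of_bool (Q (map ((!) ys) (1 # 0 # [2..<Suc (Suc k)]))))"
    using assms unfolding computable_pred_def by (rule computable_reindex) auto
  then have "computable_pred (Suc (Suc k)) (\<lambda>ys. Q (map ((!) ys) (1 # 0 # [2..<Suc (Suc k)])))"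
    by (simp add: computable_pred_def)
  moreover have eq: "map ((!) ys) (1 # 0 # [2..<Suc (Suc k)]) = hd (tl ys) # hd ys # tl (tl ys)"
    if "length ys = Suc (Suc k)" for ys
    using that
    by (auto intro!: nth_equalityI simp: length_Suc_conv nth_Cons' numeral_2_eq_2 simp del: upt_Suc)
  ultimately show ?thesis
    by (elim computable_pred_cong) (simp only: eq)
qed

text \<open>One stage \<open>n\<close> bounds both the number \<open>z\<close> and the search that
  confirms \<open>P z\<close>.\<close>

lemma re_pred_ex:
  assumes "re_pred (Suc k) (\<lambda>ys. P (hd ys) (tl ys))"
  shows "re_pred k (\<lambda>xs. \<exists>z. P z xs)"
proof -
  obtain Q where Q: "computable_pred (Suc (Suc k)) Q"
    "\<And>ys. length ys = Suc k \<Longrightarrow> P (hd ys) (tl ys) \<longleftrightarrow> (\<exists>n. Q (n # ys))"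
    "\<And>n n' xs. n \<le> n' \<Longrightarrow> Q (n # xs) \<Longrightarrow> Q (n' # xs)"
    using re_predE_mono[OF assms] by blast
  have "(\<exists>z. P z xs) \<longleftrightarrow> (\<exists>n. \<exists>z<n. Q (n # z # xs))" if "length xs = k" for xs
  proof
    assume "\<exists>z. P z xs"
    then obtain z n where "Q (n # z # xs)"
      using Q(2)[of "z # xs" for z] \<open>length xs = k\<close> by auto
    then have "Q (max n (Suc z) # z # xs)"
      using Q(3) by (meson max.cobounded1)
    then show "\<exists>n. \<exists>z<n. Q (n # z # xs)"
      by (intro exI[of _ "max n (Suc z)"] exI[of _ z]) auto
  next
    assume "\<exists>n. \<exists>z<n. Q (n # z # xs)"
    then show "\<exists>z. P z xs"
      using Q(2)[of "z # xs" for z] \<open>length xs = k\<close> by auto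
  qed
  moreover have "computable_pred (Suc k) (\<lambda>ys. \<exists>z<hd ys. Q (hd ys # z # tl ys))"
    using computable_pred_swap[OF Q(1)]
    by (intro computable_pred_bex computable_var)
      (auto elim!: computable_pred_cong simp: length_Suc_conv)
  ultimately show ?thesis
    unfolding re_pred_def by (intro exI[of _ "\<lambda>ys. \<exists>z<hd ys. Q (hd ys # z # tl ys)"]) auto
qed

lemma re_pred_ball:
  assumes P: "re_pred (Suc k) (\<lambda>ys. P (hd ys) (tl ys))" and g: "computable k g"
  shows "re_pred k (\<lambda>xs. \<forall>z<g xs. P z xs)"
proof -
  obtain Q where Q: "computable_pred (Suc (Suc k)) Q"
    "\<And>ys. length ys = Suc k \<Longrightarrow> P (hd ys) (tl ys) \<longleftrightarrow> (\<exists>n. Q (n # ys))"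
    "\<And>n n' xs. n \<le> n' \<Longrightarrow> Q (n # xs) \<Longrightarrow> Q (n' # xs)"
    using re_predE_mono[OF P] by blast
  have "(\<forall>z<g xs. P z xs) \<longleftrightarrow> (\<exists>n. \<forall>z<g xs. Q (n # z # xs))" if l: "length xs = k" for xs
  proof
    assume "\<forall>z<g xs. P z xs"
    then have "\<forall>z<g xs. \<exists>n. Q (n # z # xs)"
      using Q(2)[of "z # xs" for z] l by auto
    then obtain N where N: "\<And>z. z < g xs \<Longrightarrow> Q (N z # z # xs)"
      by metis
    \<comment> \<open>Collection: the finitely many stages, one for each \<open>z\<close> below
      \<open>g xs\<close>, have a common bound.\<close>
    have "Q (Max (N ` {..<g xs}) # z # xs)" if "z < g xs" for z
      using that by (intro Q(3)[OF _ N]) auto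
    then show "\<exists>n. \<forall>z<g xs. Q (n # z # xs)"
      by blast
  next
    assume "\<exists>n. \<forall>z<g xs. Q (n # z # xs)"
    then show "\<forall>z<g xs. P z xs"
      using Q(2)[of "z # xs" for z] l by auto
  qed
  moreover have "computable_pred (Suc k) (\<lambda>ys. \<forall>z<g (tl ys). Q (hd ys # z # tl ys))"
    using computable_pred_swap[OF Q(1)] g
    by (intro computable_pred_ball computable_tl)
      (auto elim!: computable_pred_cong simp: length_Suc_conv)
  ultimately show ?thesis
    unfolding re_pred_def by (intro exI[of _ "\<lambda>ys. \<forall>z<g (tl ys). Q (hd ys # z # tl ys)"]) auto
qed

section \<open>Recursive functions as register programs\<close>

datatype cmd = Inc nat | Dec nat | Seq cmd cmd (infixr \<open>;;\<close> 60) | While nat cmd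

inductive exec :: "cmd \<Rightarrow> (nat \<Rightarrow> nat) \<Rightarrow> (nat \<Rightarrow> nat) \<Rightarrow> bool" where
  exec_Inc: "exec (Inc r) s (s(r := Suc (s r)))"
| exec_Dec: "exec (Dec r) s (s(r := s r - 1))"
| exec_Seq: "exec c s t \<Longrightarrow> exec d t u \<Longrightarrow> exec (c ;; d) s u"
| exec_While_0: "s r = 0 \<Longrightarrow> exec (While r c) s s"
| exec_While: "s r \<noteq> 0 \<Longrightarrow> exec c s t \<Longrightarrow> exec (While r c) t u \<Longrightarrow> exec (While r c) s u"

text \<open>Total correctness: termination is part of the statement. Sequencing becomes composition
  of predicate transformers, so programs are verified by rules read backwards.\<close>

definition wp :: "cmd \<Rightarrow> ((nat \<Rightarrow> nat) \<Rightarrow> bool) \<Rightarrow> (nat \<Rightarrow> nat) \<Rightarrow> bool" where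
  "wp c Q s \<longleftrightarrow> (\<exists>t. exec c s t \<and> Q t)"

lemma wp_mono: "wp c Q s \<Longrightarrow> (\<And>t. Q t \<Longrightarrow> R t) \<Longrightarrow> wp c R s"
  by (auto simp: wp_def)

lemma wp_Inc: "Q (s(r := Suc (s r))) \<Longrightarrow> wp (Inc r) Q s"
  by (auto simp: wp_def intro: exec.intros)

lemma wp_Dec: "Q (s(r := s r - 1)) \<Longrightarrow> wp (Dec r) Q s"
  by (auto simp: wp_def intro!: exec.intros)

inductive_cases exec_SeqE: "exec (c ;; d) s u"

lemma wp_Seq_eq: "wp (c ;; d) Q = wp c (wp d Q)"
  by (auto simp: wp_def fun_eq_iff intro: exec.intros elim!: exec_SeqE)

lemma wp_Seq: "wp c (wp d Q) s \<Longrightarrow> wp (c ;; d) Q s"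
  by (simp add: wp_Seq_eq)

lemma wp_While_0: "s r = 0 \<Longrightarrow> Q s \<Longrightarrow> wp (While r c) Q s"
  by (auto simp: wp_def intro: exec.intros)

lemma wp_While_step: "s r \<noteq> 0 \<Longrightarrow> wp c (wp (While r c) Q) s \<Longrightarrow> wp (While r c) Q s"
  by (auto simp: wp_def intro: exec.intros)

text \<open>The number \<open>n\<close> of rounds is known beforehand and the invariant is indexed
  by the rounds completed, which yields termination and the final state at once.\<close>

lemma wp_While:
  assumes "I 0 s" and "\<And>k t. I k t \<Longrightarrow> k < n \<Longrightarrow> t r \<noteq> 0 \<and> wp c (I (Suc k)) t"
    and "\<And>t. I n t \<Longrightarrow> t r = 0"
  shows "wp (While r c) (I n) s"
proof -
  have "wp (While r c) (I n) t" if "I (n - j) t" "j \<le> n" for j t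
    using that
  proof (induction j arbitrary: t)
    case 0
    then show ?case
      using assms(3) by (auto intro: wp_While_0)
  next
    case (Suc j)
    then have "t r \<noteq> 0" "wp c (I (n - j)) t"
      using assms(2)[of "n - Suc j" t] by (auto simp: Suc_diff_Suc)
    moreover from this(2) have "wp c (wp (While r c) (I n)) t"
      by (rule wp_mono) (use Suc in auto)
    ultimately show ?case
      by - (rule wp_While_step)
  qed
  from this[of n] show ?thesis
    using assms(1) by simp
qed

section \<open>Register macros and compilation\<close>

abbreviation clear :: "nat \<Rightarrow> cmd" where
  "clear r \<equiv> While r (Dec r)"

text \<open>Reading a counter destroys it: the value is moved into \<open>b\<close> and
  \<open>t\<close> together and then restored from \<open>t\<close>.\<close>

definition copy :: "nat \<Rightarrow> nat \<Rightarrow> nat \<Rightarrow> cmd" where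
  "copy a b t =
     clear b ;; clear t ;; While a (Dec a ;; Inc b ;; Inc t) ;; While t (Dec t ;; Inc a)"

lemma wp_clear: "Q (s(r := 0)) \<Longrightarrow> wp (clear r) Q s"
proof (induction "s r" arbitrary: s)
  case 0
  then show ?case
    by (intro wp_While_0) (auto simp: fun_upd_idem)
next
  case (Suc n)
  then show ?case
    using Suc.hyps(2)
    by (intro wp_While_step[OF _ wp_Dec[OF Suc.hyps(1)]])
      (auto elim!: back_subst[of Q] simp: fun_eq_iff)
qed

lemma wp_transfer2:
  assumes "a \<noteq> b" "a \<noteq> t" "b \<noteq> t"
  shows "Q (s(a := 0, b := s b + s a, t := s t + s a)) \<Longrightarrow>
    wp (While a (Dec a ;; Inc b ;; Inc t)) Q s"
proof (induction "s a" arbitrary: s)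
  case 0
  then show ?case
    by (intro wp_While_0) (auto simp: fun_upd_idem)
next
  case (Suc n)
  show ?case
  proof (rule wp_While_step[OF _ wp_Seq[OF wp_Dec[OF wp_Seq[OF wp_Inc[OF wp_Inc[OF Suc.hyps(1)]]]]]],
      goal_cases)
    case 3
    from Suc.hyps(2) Suc.prems assms show ?case
      by (elim back_subst[of Q]) (auto simp: fun_eq_iff)
  qed (use Suc.hyps(2) assms in auto)
qed

lemma wp_transfer:
  assumes "a \<noteq> b"
  shows "Q (s(a := 0, b := s b + s a)) \<Longrightarrow> wp (While a (Dec a ;; Inc b)) Q s"
proof (induction "s a" arbitrary: s)
  case 0
  then show ?case
    by (intro wp_While_0) (auto simp: fun_upd_idem)
next
  case (Suc n)
  show ?case
  proof (rule wp_While_step[OF _ wp_Seq[OF wp_Dec[OF wp_Inc[OF Suc.hyps(1)]]]], goal_cases)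
    case 3
    from Suc.hyps(2) Suc.prems assms show ?case
      by (elim back_subst[of Q]) (auto simp: fun_eq_iff)
  qed (use Suc.hyps(2) assms in auto)
qed

lemma wp_copy:
  assumes "a \<noteq> b" "a \<noteq> t" "b \<noteq> t" "Q (s(b := s a, t := 0))"
  shows "wp (copy a b t) Q s"
  unfolding copy_def
proof (intro wp_Seq wp_clear wp_transfer2 wp_transfer, goal_cases)
  case 5
  from assms show ?case
    by (elim back_subst[of Q]) (auto simp: fun_eq_iff)
qed (use assms in auto)

primrec run_list :: "(nat list \<Rightarrow> nat \<Rightarrow> cmd) list \<Rightarrow> nat list \<Rightarrow> nat \<Rightarrow> cmd" where
  "run_list [] as b = clear b"
| "run_list (p # ps) as b = p as b ;; run_list ps as (Suc b)"

text \<open>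
  The arguments are read from the registers \<open>as\<close>, all below \<open>b\<close>. The result is left in
  register \<open>b\<close>; registers above \<open>b\<close> are scratch space with arbitrary initial contents.
\<close>

primrec compile :: "recf \<Rightarrow> nat list \<Rightarrow> nat \<Rightarrow> cmd" where
  "compile Zero as b = clear b"
| "compile Succ as b = copy (hd as) b (Suc b) ;; Inc b"
| "compile (Proj i) as b = copy (as ! i) b (Suc b)"
| "compile (Comp f gs) as b =
     run_list (map compile gs) as (Suc b) ;;
     compile f [Suc b..<Suc b + length gs] (Suc b + length gs) ;;
     copy (Suc b + length gs) b (Suc (Suc b) + length gs)"
| "compile (Prim_Rec f g) as b =
     compile f (tl as) b ;; clear (b + 1) ;; copy (hd as) (b + 2) (b + 3) ;;
     While (b + 2)
       (Dec (b + 2) ;; compile g ((b + 1) # b # tl as) (b + 3) ;; copy (b + 3) b (b + 4) ;;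
        Inc (b + 1))"
| "compile (Mu f) as b =
     clear b ;; compile f (b # as) (Suc b) ;;
     While (Suc b) (Inc b ;; compile f (b # as) (Suc b))"

text \<open>Quantifying over the argument registers and the base \<open>b\<close> allows a compiled
  subprogram to be placed anywhere. Preserving everything below \<open>b\<close> protects the
  arguments and the intermediate results stored there.\<close>

definition implements :: "(nat list \<Rightarrow> nat \<Rightarrow> cmd) \<Rightarrow> nat list \<Rightarrow> nat \<Rightarrow> bool" where
  "implements p xs y \<longleftrightarrow>
     (\<forall>as b s. map s as = xs \<longrightarrow> (\<forall>a\<in>set as. a < b) \<longrightarrow>
        wp (p as b) (\<lambda>t. t b = y \<and> (\<forall>i<b. t i = s i)) s)"

lemma implementsD:
  assumes "implements p xs y" "map s as = xs" "\<forall>a\<in>set as. a < b"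
    "\<And>t. t b = y \<Longrightarrow> \<forall>i<b. t i = s i \<Longrightarrow> Q t"
  shows "wp (p as b) Q s"
proof -
  have "wp (p as b) (\<lambda>t. t b = y \<and> (\<forall>i<b. t i = s i)) s"
    using assms(1-3) by (auto simp: implements_def)
  then show ?thesis
    using assms(4) by (auto elim: wp_mono)
qed

lemma wp_run_list:
  assumes "list_all2 (\<lambda>p y. implements p xs y) ps ys" "map s as = xs" "\<forall>a\<in>set as. a < b"
  shows "wp (run_list ps as b)
    (\<lambda>t. map t [b..<b + length ps] = ys \<and> (\<forall>i<b. t i = s i)) s"
  using assms
proof (induction arbitrary: b s rule: list_all2_induct)
  case Nil
  then show ?case
    by (auto intro: wp_clear)
next
  case (Cons p ps y ys)
  have "wp (run_list ps as (Suc b))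
      (\<lambda>t. map t [b..<b + length (p # ps)] = y # ys \<and> (\<forall>i<b. t i = s i)) t"
    if t: "t b = y" "\<forall>i<b. t i = s i" for t
  proof -
    have "map t as = xs" "\<forall>a\<in>set as. a < Suc b"
      using Cons.prems t(2) by (auto simp: less_SucI)
    from Cons.IH[OF this] show ?thesis
      by (rule wp_mono) (use t in \<open>auto simp: upt_conv_Cons simp del: upt_Suc\<close>)
  qed
  then show ?case
    by (auto intro!: wp_Seq implementsD[OF Cons.hyps(1) Cons.prems])
qed

inductive_cases computes_ZeroE: "computes Zero xs y"
inductive_cases computes_SuccE: "computes Succ xs y"
inductive_cases computes_ProjE: "computes (Proj i) xs y"
inductive_cases computes_CompE: "computes (Comp f gs) xs y"
inductive_cases computes_Prim_RecE: "computes (Prim_Rec f g) xs y"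
inductive_cases computes_Prim_Rec_0E: "computes (Prim_Rec f g) (0 # xs) y"
inductive_cases computes_Prim_Rec_SucE: "computes (Prim_Rec f g) (Suc n # xs) y"
inductive_cases computes_MuE: "computes (Mu f) xs y"

text \<open>Unrolls the recursion into its intermediate values, of which the loop invariant of the
  compiled program speaks.\<close>

lemma computes_Prim_Rec_seq:
  assumes "computes (Prim_Rec f g) (n # xs) y"
  shows "\<exists>ys. computes f xs (ys 0) \<and> (\<forall>k<n. computes g (k # ys k # xs) (ys (Suc k))) \<and> ys n = y"
  using assms
proof (induction n arbitrary: y)
  case 0
  then show ?case
    by (auto elim!: computes_Prim_Rec_0E intro: exI[of _ "\<lambda>_. y"])
next
  case (Suc n)
  then obtain z where z: "computes (Prim_Rec f g) (n # xs) z" "computes g (n # z # xs) y"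
    by (auto elim: computes_Prim_Rec_SucE)
  then obtain ys where "computes f xs (ys 0)" "\<forall>k<n. computes g (k # ys k # xs) (ys (Suc k))"
    "ys n = z"
    using Suc.IH by blast
  with z(2) show ?case
    by (intro exI[of _ "ys(Suc n := y)"]) (auto simp: less_Suc_eq)
qed

lemma implements_Comp:
  assumes ps: "list_all2 (\<lambda>p y. implements p xs y) ps ys" and p: "implements p ys y"
  shows "implements (\<lambda>as b. run_list ps as (Suc b) ;;
     p [Suc b..<Suc b + length ps] (Suc b + length ps) ;;
     copy (Suc b + length ps) b (Suc (Suc b) + length ps)) xs y"
  unfolding implements_def wp_Seq_eq
proof (intro allI impI)
  fix as :: "nat list" and b :: nat and s :: "nat \<Rightarrow> nat"
  assume as: "map s as = xs" "\<forall>a\<in>set as. a < b"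
  have "\<forall>a\<in>set as. a < Suc b"
    using as by auto
  from wp_run_list[OF ps as(1) this]
  show "wp (run_list ps as (Suc b)) (wp (p [Suc b..<Suc b + length ps] (Suc b + length ps))
      (wp (copy (Suc b + length ps) b (Suc (Suc b) + length ps))
        (\<lambda>t. t b = y \<and> (\<forall>i<b. t i = s i)))) s"
  proof (rule wp_mono)
    fix t
    assume t: "map t [Suc b..<Suc b + length ps] = ys \<and> (\<forall>i<Suc b. t i = s i)"
    show "wp (p [Suc b..<Suc b + length ps] (Suc b + length ps))
      (wp (copy (Suc b + length ps) b (Suc (Suc b) + length ps))
        (\<lambda>t. t b = y \<and> (\<forall>i<b. t i = s i))) t"
    proof (rule implementsD[OF p])
      fix u
      assume u: "u (Suc b + length ps) = y" "\<forall>i<Suc b + length ps. u i = t i"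
      show "wp (copy (Suc b + length ps) b (Suc (Suc b) + length ps))
        (\<lambda>t. t b = y \<and> (\<forall>i<b. t i = s i)) u"
        by (rule wp_copy) (use t u in auto)
    qed (use t in auto)
  qed
qed

lemma implements_Prim_Rec:
  assumes f: "implements f xs (v 0)"
    and g: "\<And>k. k < n \<Longrightarrow> implements g (k # v k # xs) (v (Suc k))"
  shows "implements (\<lambda>as b. f (tl as) b ;; clear (b + 1) ;; copy (hd as) (b + 2) (b + 3) ;;
     While (b + 2)
       (Dec (b + 2) ;; g ((b + 1) # b # tl as) (b + 3) ;; copy (b + 3) b (b + 4) ;;
        Inc (b + 1))) (n # xs) (v n)"
  unfolding implements_def
proof (intro allI impI)
  fix as :: "nat list" and b :: nat and s :: "nat \<Rightarrow> nat"
  assume "map s as = n # xs" "\<forall>a\<in>set as. a < b"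
  then obtain a as' where as: "as = a # as'" "s a = n" "map s as' = xs" "a < b"
    "\<forall>a\<in>set as'. a < b"
    by (cases as) auto
  \<comment> \<open>Register \<open>b\<close> holds the value after \<open>k\<close> rounds,
    \<open>b + 1\<close> counts up as an argument of the step function, and \<open>b + 2\<close>
    counts down to end the loop.\<close>
  define I where "I k t \<longleftrightarrow> t b = v k \<and> t (b + 1) = k \<and> t (b + 2) = n - k \<and> (\<forall>i<b. t i = s i)"
    for k and t :: "nat \<Rightarrow> nat"
  have loop: "wp (While (b + 2) (Dec (b + 2) ;; g ((b + 1) # b # as') (b + 3) ;;
      copy (b + 3) b (b + 4) ;; Inc (b + 1))) (I n) t" if "I 0 t" for t
  proof (rule wp_While[where I = I])
    fix k t
    assume I: "I k t" and k: "k < n"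
    have "wp (g ((b + 1) # b # as') (b + 3)) (wp (copy (b + 3) b (b + 4)) (wp (Inc (b + 1)) (I (Suc k))))
      (t(b + 2 := t (b + 2) - 1))"
    proof (rule implementsD[OF g[OF k]])
      show "map (t(b + 2 := t (b + 2) - 1)) ((b + 1) # b # as') = k # v k # xs"
      proof -
        have "map (t(b + 2 := t (b + 2) - 1)) as' = map s as'"
          using I as(5) by (intro map_cong) (auto simp: I_def)
        then show ?thesis
          using I as(3) by (simp add: I_def)
      qed
      fix u
      assume u: "u (b + 3) = v (Suc k)" "\<forall>i<b + 3. u i = (t(b + 2 := t (b + 2) - 1)) i"
      show "wp (copy (b + 3) b (b + 4)) (wp (Inc (b + 1)) (I (Suc k))) u"
        by (rule wp_copy, simp_all, rule wp_Inc) (use u I k in \<open>auto simp: I_def\<close>)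
    qed (use as in auto)
    then show "t (b + 2) \<noteq> 0 \<and> wp (Dec (b + 2) ;; g ((b + 1) # b # as') (b + 3) ;;
        copy (b + 3) b (b + 4) ;; Inc (b + 1)) (I (Suc k)) t"
      using I k unfolding wp_Seq_eq by (auto simp: I_def intro!: wp_Dec)
  qed (use that in \<open>auto simp: I_def\<close>)
  have rest: "wp (clear (b + 1)) (wp (copy a (b + 2) (b + 3)) (wp (While (b + 2)
      (Dec (b + 2) ;; g ((b + 1) # b # as') (b + 3) ;; copy (b + 3) b (b + 4) ;; Inc (b + 1)))
      (\<lambda>t. t b = v n \<and> (\<forall>i<b. t i = s i)))) t" if "t b = v 0" "\<forall>i<b. t i = s i" for t
  proof (rule wp_clear, rule wp_copy)
    show "wp (While (b + 2)
      (Dec (b + 2) ;; g ((b + 1) # b # as') (b + 3) ;; copy (b + 3) b (b + 4) ;; Inc (b + 1)))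
      (\<lambda>t. t b = v n \<and> (\<forall>i<b. t i = s i)) (t(b + 1 := 0, b + 2 := (t(b + 1 := 0)) a, b + 3 := 0))"
      by (rule wp_mono[OF loop]) (use that as in \<open>auto simp: I_def\<close>)
  qed (use as in auto)
  show "wp (f (tl as) b ;; clear (b + 1) ;; copy (hd as) (b + 2) (b + 3) ;;
     While (b + 2)
       (Dec (b + 2) ;; g ((b + 1) # b # tl as) (b + 3) ;; copy (b + 3) b (b + 4) ;;
        Inc (b + 1))) (\<lambda>t. t b = v n \<and> (\<forall>i<b. t i = s i)) s"
    unfolding as(1) list.sel wp_Seq_eq by (rule implementsD[OF f as(3,5)], rule rest) auto
qed

lemma implements_Mu:
  assumes f: "\<And>k. k \<le> n \<Longrightarrow> implements f (k # xs) (v k)"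
    and v: "\<And>k. k < n \<Longrightarrow> v k \<noteq> 0" "v n = 0"
  shows "implements (\<lambda>as b. clear b ;; f (b # as) (Suc b) ;;
     While (Suc b) (Inc b ;; f (b # as) (Suc b))) xs n"
  unfolding implements_def
proof (intro allI impI)
  fix as :: "nat list" and b :: nat and s :: "nat \<Rightarrow> nat"
  assume as: "map s as = xs" "\<forall>a\<in>set as. a < b"
  \<comment> \<open>Register \<open>b\<close> is the candidate itself and \<open>Suc b\<close> the
    value of \<open>f\<close> on it, so the loop stops with the result already in place.\<close>
  define I where "I k t \<longleftrightarrow> t b = k \<and> t (Suc b) = v k \<and> (\<forall>i<b. t i = s i)"
    for k and t :: "nat \<Rightarrow> nat"
  have step: "wp (f (b # as) (Suc b)) (I k) t"
    if "t b = k" "\<forall>i<b. t i = s i" "k \<le> n" for k t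
    by (rule implementsD[OF f[OF that(3)]]) (use that as in \<open>auto simp: I_def\<close>)
  have loop: "wp (While (Suc b) (Inc b ;; f (b # as) (Suc b))) (I n) t" if "I 0 t" for t
  proof (rule wp_While[where I = I])
    fix k t
    assume "I k t" "k < n"
    then show "t (Suc b) \<noteq> 0 \<and> wp (Inc b ;; f (b # as) (Suc b)) (I (Suc k)) t"
      using v(1) by (auto simp: I_def intro!: wp_Seq wp_Inc step)
  qed (use that v(2) in \<open>auto simp: I_def\<close>)
  have "wp (f (b # as) (Suc b)) (wp (While (Suc b) (Inc b ;; f (b # as) (Suc b)))
        (\<lambda>t. t b = n \<and> (\<forall>i<b. t i = s i))) (s(b := 0))"
  proof (rule wp_mono[OF step])
    show "wp (While (Suc b) (Inc b ;; f (b # as) (Suc b))) (\<lambda>t. t b = n \<and> (\<forall>i<b. t i = s i)) t"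
      if "I 0 t" for t
      using loop[OF that] by (rule wp_mono) (auto simp: I_def)
  qed auto
  then show "wp (clear b ;; f (b # as) (Suc b) ;; While (Suc b) (Inc b ;; f (b # as) (Suc b)))
      (\<lambda>t. t b = n \<and> (\<forall>i<b. t i = s i)) s"
    unfolding wp_Seq_eq by (rule wp_clear)
qed

text \<open>A derivation of \<open>computes\<close> makes exactly those subcomputations defined that
  the program runs; for \<open>Mu\<close> these are the arguments up to the least zero.\<close>

lemma implements_compile: "computes r xs y \<Longrightarrow> implements (compile r) xs y"
proof (induction r arbitrary: xs y)
  case Zero
  then show ?case
    by (auto simp: implements_def elim!: computes_ZeroE intro!: wp_clear)
next
  case Succ
  then obtain x where x: "xs = [x]" "y = Suc x"
    by (auto elim: computes_SuccE)
  have "wp (copy a b (Suc b) ;; Inc b) (\<lambda>t. t b = Suc (s a) \<and> (\<forall>i<b. t i = s i)) s"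
    if "a < b" for a b s
    using that by (intro wp_Seq wp_copy wp_Inc) auto
  then show ?case
    unfolding implements_def x by auto
next
  case (Proj i)
  then have i: "i < length xs" "y = xs ! i"
    by (auto elim: computes_ProjE)
  show ?case
    unfolding implements_def compile.simps
  proof (intro allI impI)
    fix as :: "nat list" and b :: nat and s :: "nat \<Rightarrow> nat"
    assume as: "map s as = xs" "\<forall>a\<in>set as. a < b"
    then have "as ! i < b"
      using i(1) by auto
    with as show "wp (copy (as ! i) b (Suc b)) (\<lambda>t. t b = y \<and> (\<forall>i<b. t i = s i)) s"
      using i by (intro wp_copy) auto
  qed
next
  case (Comp f gs)
  obtain ys where ys: "list_all2 (\<lambda>g y. computes g xs y) gs ys" "computes f ys y"
    using Comp.prems by (auto elim: computes_CompE)
  have gs: "list_all2 (\<lambda>p y. implements p xs y) (map compile gs) ys"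
    using ys(1) Comp.IH(2) by (auto simp: list_all2_conv_all_nth)
  from implements_Comp[OF gs Comp.IH(1)[OF ys(2)]] show ?case
    by (simp add: implements_def del: upt_Suc)
next
  case (Prim_Rec f g)
  obtain n xs' where xs: "xs = n # xs'"
    using Prim_Rec.prems by (auto elim: computes_Prim_RecE)
  obtain v where v: "computes f xs' (v 0)"
      "\<And>k. k < n \<Longrightarrow> computes g (k # v k # xs') (v (Suc k))" "v n = y"
    using computes_Prim_Rec_seq[of f g n xs' y] Prim_Rec.prems xs by auto
  have "implements (compile f) xs' (v 0)"
    by (rule Prim_Rec.IH(1)[OF v(1)])
  moreover have "implements (compile g) (k # v k # xs') (v (Suc k))" if "k < n" for k
    by (rule Prim_Rec.IH(2)[OF v(2)[OF that]])
  ultimately have "implements (compile (Prim_Rec f g)) (n # xs') (v n)"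
    unfolding compile.simps by (rule implements_Prim_Rec)
  then show ?case
    by (simp only: xs v(3))
next
  case (Mu f)
  from Mu.prems have "computes f (y # xs) 0" "\<forall>k<y. \<exists>z. computes f (k # xs) (Suc z)"
    by (auto elim: computes_MuE)
  then obtain z where z: "computes f (y # xs) 0" "\<And>k. k < y \<Longrightarrow> computes f (k # xs) (Suc (z k))"
    by metis
  have "implements (compile f) (k # xs) (if k < y then Suc (z k) else 0)" if "k \<le> y" for k
    using z Mu.IH that by (cases "k < y") auto
  from implements_Mu[of y "compile f" xs, OF this] show ?case
    by (simp add: implements_def)
qed

section \<open>Register programs on Turing machines\<close>

datatype instr = INC nat nat | DEC nat nat | JZ nat nat nat

primrec clen :: "cmd \<Rightarrow> nat" where
  "clen (Inc r) = 1"
| "clen (Dec r) = 1"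
| "clen (c ;; d) = clen c + clen d"
| "clen (While r c) = clen c + 2"

text \<open>The code of \<open>c\<close> from label \<open>l\<close> occupies the labels below
  \<open>l + clen c\<close>, and control leaves it at exactly that label. The jump back in a loop is
  a \<open>JZ\<close> with two equal targets.\<close>

primrec code :: "cmd \<Rightarrow> nat \<Rightarrow> (nat \<times> instr) list" where
  "code (Inc r) l = [(l, INC r (l + 1))]"
| "code (Dec r) l = [(l, DEC r (l + 1))]"
| "code (c ;; d) l = code c l @ code d (l + clen c)"
| "code (While r c) l =
     (l, JZ r (l + clen c + 2) (l + 1)) # code c (l + 1) @
     [(l + 1 + clen c, JZ r l l)]"

primrec regs :: "cmd \<Rightarrow> nat set" where
  "regs (Inc r) = {r}"
| "regs (Dec r) = {r}"
| "regs (c ;; d) = regs c \<union> regs d"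
| "regs (While r c) = insert r (regs c)"

lemma finite_regs: "finite (regs c)"
  by (induction c) auto

lemma map_fst_code: "map fst (code c l) = [l..<l + clen c]"
proof (induction c arbitrary: l)
  case (Seq c d)
  then show ?case
    using upt_add_eq_append[of l "l + clen c" "clen d"] by (simp add: add.assoc)
next
  case (While r c)
  then show ?case
    by (simp add: upt_conv_Cons)
qed auto

primrec reg :: "instr \<Rightarrow> nat" where
  "reg (INC r l) = r" | "reg (DEC r l) = r" | "reg (JZ r l l') = r"

primrec targets :: "instr \<Rightarrow> nat set" where
  "targets (INC r l) = {l}" | "targets (DEC r l) = {l}" | "targets (JZ r l l') = {l, l'}"

lemma finite_targets: "finite (targets i)"
  by (cases i) auto

lemma reg_code: "(l, i) \<in> set (code c k) \<Longrightarrow> reg i \<in> regs c"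
  by (induction c arbitrary: k) auto

text \<open>
  The machine keeps register \<open>r\<close> in unary as the set of cells \<open>j \<ge> 0\<close> whose symbol has bit
  \<open>r\<close> set. Cell \<open>-1\<close> holds a marker, the bit \<open>K\<close>, by which the head finds its way back
  to cell \<open>0\<close>.
\<close>

datatype tstate = Start | Mark | At nat | Return nat | Erase nat

text \<open>The start state has to be 0; the three families of labelled states are told apart by
  their residue modulo 3.\<close>

primrec state_code :: "tstate \<Rightarrow> nat" where
  "state_code Start = 0"
| "state_code Mark = 1"
| "state_code (At l) = 3 * l + 2"
| "state_code (Return l) = 3 * l + 3"
| "state_code (Erase l) = 3 * l + 4"

declare state_code.simps [simp del]

lemma inj_state_code: "inj state_code"
proof (rule injI)
  fix p q
  assume "state_code p = state_code q"
  then show "p = q"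
    by (cases p; cases q) (simp add: state_code.simps; presburger)+
qed

definition set_bit :: "nat \<Rightarrow> nat \<Rightarrow> nat" where
  "set_bit r a = set_encode (insert r (set_decode a))"

definition clear_bit :: "nat \<Rightarrow> nat \<Rightarrow> nat" where
  "clear_bit r a = set_encode (set_decode a - {r})"

definition marker :: "nat \<Rightarrow> nat" where
  "marker K = set_encode {K}"

lemma set_decode_marker [simp]: "set_decode (marker K) = {K}"
  unfolding marker_def by (simp add: set_encode_inverse del: set_encode_insert)

text \<open>\<open>Start\<close> and \<open>Mark\<close> put the marker on cell -1. In state
  \<open>At l\<close> an \<open>INC\<close> or \<open>DEC\<close> runs right over the cells that
  carry bit \<open>r\<close>; the index of the first cell without it is the value of the register.
  \<open>INC\<close> sets the bit there. \<open>DEC\<close> steps back once in state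
  \<open>Erase\<close> and clears the last bit, unless the step leads onto the marker, which means
  that the register was 0 already. \<open>JZ\<close> tests cell 0 alone. \<open>Return\<close> runs
  left to the marker and then enters cell 0.\<close>

fun tdelta :: "(nat \<times> instr) list \<Rightarrow> nat \<Rightarrow> tstate \<Rightarrow> nat \<Rightarrow> (tstate \<times> nat \<times> direction) option" where
  "tdelta P K Start a = Some (Mark, a, Left)"
| "tdelta P K Mark a = Some (At 0, marker K, Right)"
| "tdelta P K (Return l) a =
     Some (if K \<in> set_decode a then (At l, a, Right) else (Return l, a, Left))"
| "tdelta P K (At l) a =
     (case map_of P l of
        None \<Rightarrow> None
      | Some (INC r l') \<Rightarrow>
          Some (if r \<in> set_decode a then (At l, a, Right) else (Return l', set_bit r a, Left))
      | Some (DEC r l') \<Rightarrow>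
          Some (if r \<in> set_decode a then (At l, a, Right) else (Erase l, a, Left))
      | Some (JZ r l1 l2) \<Rightarrow> Some (Return (if r \<in> set_decode a then l2 else l1), a, Left))"
| "tdelta P K (Erase l) a =
     (case map_of P l of
        Some (DEC r l') \<Rightarrow>
          Some (if K \<in> set_decode a then (At l', a, Right) else (Return l', clear_bit r a, Left))
      | _ \<Rightarrow> None)"

text \<open>Only finitely many instructions can be listed, so the transition function is restricted
  to the states that \<open>P\<close> mentions. An exit label may have a \<open>Return\<close>
  state, being a target, but has an \<open>At\<close> state only if it labels an instruction;
  otherwise the machine stops there.\<close>

definition tstates :: "(nat \<times> instr) list \<Rightarrow> tstate set" where
  "tstates P =
     {Start, Mark} \<union> (\<Union>(l, i)\<in>set P. {At l, Erase l} \<union> Return ` targets i)"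

definition tsymbols :: "nat \<Rightarrow> nat set" where
  "tsymbols K = set_encode ` Pow {..K}"

definition next_code :: "tstate \<times> nat \<times> direction \<Rightarrow> nat \<times> nat \<times> direction" where
  "next_code = (\<lambda>(q, b, d). (state_code q, b, d))"

lemma ex_map_of: "finite (dom m) \<Longrightarrow> \<exists>xs. map_of xs = m"
proof -
  assume "finite (dom m)"
  from finite_list[OF this] obtain ks where ks: "set ks = dom m" ..
  have "map_of (map (\<lambda>k. (k, the (m k))) ks) k = m k" for k
    unfolding map_of_map_restrict ks by (cases "m k") (simp_all add: restrict_map_def domIff)
  then show ?thesis
    by blast
qed

lemma ex_machine:
  "\<exists>M. \<forall>q a. map_of M (state_code q, a) =
     (if q \<in> tstates P \<and> a \<in> tsymbols K then map_option next_code (tdelta P K q a) else None)"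
proof -
  define m where "m = (\<lambda>(x, a). if x \<in> state_code ` tstates P \<and> a \<in> tsymbols K
     then map_option next_code (tdelta P K (inv state_code x) a) else None)"
  have "finite (tstates P)"
    by (auto simp: tstates_def finite_targets)
  moreover have "finite (tsymbols K)"
    by (simp add: tsymbols_def)
  moreover have "dom m \<subseteq> state_code ` tstates P \<times> tsymbols K"
    by (auto simp: m_def split: if_splits)
  ultimately have "finite (dom m)"
    using finite_subset[of "dom m" "state_code ` tstates P \<times> tsymbols K"] by simp
  from ex_map_of[OF this] obtain M where M: "map_of M = m" ..
  have "map_of M (state_code q, a) =
     (if q \<in> tstates P \<and> a \<in> tsymbols K then map_option next_code (tdelta P K q a) else None)" for q a
    by (simp add: M m_def inj_image_mem_iff[OF inj_state_code] inv_f_f[OF inj_state_code])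
  then show ?thesis
    by blast
qed

definition tm_rel :: "tm \<Rightarrow> (tm_config \<times> tm_config) set" where
  "tm_rel M = {(c, c'). tm_step M c = Some c'}"

section \<open>Simulation of single counter instructions\<close>

locale counter_machine =
  fixes P :: "(nat \<times> instr) list" and K :: nat and M :: tm
  assumes distinct: "distinct (map fst P)"
    and reg_less: "(l, i) \<in> set P \<Longrightarrow> reg i < K"
    and K_pos: "0 < K"
    and map_of_M: "map_of M (state_code q, a) =
      (if q \<in> tstates P \<and> a \<in> tsymbols K then map_option next_code (tdelta P K q a) else None)"
begin

definition cell :: "(nat \<Rightarrow> nat) \<Rightarrow> nat \<Rightarrow> nat" where
  "cell s j = set_encode {r. r < K \<and> j < s r}"

definition tape :: "(nat \<Rightarrow> nat) \<Rightarrow> int \<Rightarrow> nat" where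
  "tape s i = (if i \<ge> 0 then cell s (nat i) else if i = -1 then marker K else 0)"

definition conf :: "nat \<Rightarrow> (nat \<Rightarrow> nat) \<Rightarrow> tm_config" where
  "conf l s = (state_code (At l), 0, tape s)"

lemma set_decode_cell [simp]: "set_decode (cell s j) = {r. r < K \<and> j < s r}"
  by (simp add: cell_def set_encode_inverse)

lemma tape_nat [simp]: "tape s (int j) = cell s j" "tape s 0 = cell s 0"
  by (simp_all add: tape_def)

lemma tape_marker [simp]: "tape s (- 1) = marker K"
  by (simp add: tape_def)

lemma tape_upd: "(tape s)(int j := cell t j) = tape t" if "\<And>i. i \<noteq> j \<Longrightarrow> cell t i = cell s i"
  using that by (auto simp: tape_def fun_eq_iff)

lemma cell_in_tsymbols [simp]: "cell s j \<in> tsymbols K"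
  by (auto simp: cell_def tsymbols_def)

lemma marker_in_tsymbols [simp]: "marker K \<in> tsymbols K"
  unfolding tsymbols_def marker_def by (rule imageI) auto

lemma step:
  assumes "q \<in> tstates P" "t p \<in> tsymbols K" "tdelta P K q (t p) = Some (q', b, d)"
  shows "((state_code q, p, t), (state_code q', move d p, t(p := b))) \<in> tm_rel M"
  using assms by (simp add: map_of_M next_code_def tm_rel_def)

lemma step_keep:
  assumes "q \<in> tstates P" "t p \<in> tsymbols K" "tdelta P K q (t p) = Some (q', t p, d)"
  shows "((state_code q, p, t), (state_code q', move d p, t)) \<in> tm_rel M"
  using step[of q t p q' "t p" d] assms by simp

lemma map_of_P: "(l, i) \<in> set P \<Longrightarrow> map_of P l = Some i"
  using distinct by (rule map_of_is_SomeI)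

lemma tstates_intros:
  assumes "(l, i) \<in> set P"
  shows "At l \<in> tstates P" "Erase l \<in> tstates P" "l' \<in> targets i \<Longrightarrow> Return l' \<in> tstates P"
  using assms by (auto simp: tstates_def)

text \<open>The action at cell \<open>j\<close> has already moved left, hence the position
  \<open>j - 1\<close>; for \<open>j = 0\<close> this is the marker itself.\<close>

lemma return_home:
  assumes "(l, i) \<in> set P" "l' \<in> targets i"
  shows "((state_code (Return l'), int j - 1, tape s), conf l' s) \<in> (tm_rel M)\<^sup>*"
proof (induction j)
  case 0
  have "((state_code (Return l'), -1, tape s), (state_code (At l'), move Right (-1), tape s))
      \<in> tm_rel M"
    by (rule step_keep) (use tstates_intros[OF assms(1)] assms(2) in \<open>auto simp: set_encode_inverse\<close>)
  then show ?case
    by (auto simp: conf_def)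
next
  case (Suc j)
  have "((state_code (Return l'), int j, tape s), (state_code (Return l'), move Left (int j), tape s))
      \<in> tm_rel M"
    by (rule step_keep) (use tstates_intros[OF assms(1)] assms(2) in \<open>auto\<close>)
  with Suc show ?case
    by (auto intro: converse_rtrancl_into_rtrancl)
qed

lemma scan:
  assumes "(l, i) \<in> set P" "i = INC r l' \<or> i = DEC r l'" "j \<le> s r"
  shows "(conf l s, (state_code (At l), int j, tape s)) \<in> (tm_rel M)\<^sup>*"
  using assms(3)
proof (induction j)
  case 0
  then show ?case
    by (simp add: conf_def)
next
  case (Suc j)
  have "((state_code (At l), int j, tape s), (state_code (At l), move Right (int j), tape s))
      \<in> tm_rel M"
    by (rule step_keep)
      (use tstates_intros[OF assms(1)] map_of_P[OF assms(1)] reg_less[OF assms(1)] assms(2) Suc.prems in auto)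
  with Suc show ?case
    by (auto intro: rtrancl_into_rtrancl simp: add.commute)
qed

text \<open>The scan ends on cell \<open>s r\<close>, the first without bit \<open>r\<close>; adding
  the bit there gives the tape of the updated registers. At least one move is recorded, because
  divergence is later inferred from strict progress.\<close>

lemma sim_INC:
  assumes "(l, INC r l') \<in> set P"
  shows "(conf l s, conf l' (s(r := Suc (s r)))) \<in> (tm_rel M)\<^sup>+"
proof -
  let ?t = "s(r := Suc (s r))"
  have r: "r < K"
    using reg_less[OF assms] by simp
  have "((state_code (At l), int (s r), tape s),
      (state_code (Return l'), move Left (int (s r)), (tape s)(int (s r) := set_bit r (tape s (int (s r))))))
      \<in> tm_rel M"
    by (rule step) (use tstates_intros[OF assms] map_of_P[OF assms] in auto)
  moreover have "set_bit r (cell s (s r)) = cell ?t (s r)"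
    unfolding set_bit_def set_decode_cell unfolding cell_def
    by (rule arg_cong[of _ _ set_encode]) (use r in auto)
  moreover have "(tape s)(int (s r) := cell ?t (s r)) = tape ?t"
    by (rule tape_upd) (auto simp: cell_def intro!: arg_cong[of _ _ set_encode])
  ultimately have "((state_code (At l), int (s r), tape s), (state_code (Return l'), int (s r) - 1, tape ?t)) \<in> tm_rel M"
    by simp
  from rtrancl_into_trancl1[OF scan[OF assms] this] return_home[OF assms, of l' "s r" ?t]
  show ?thesis
    by auto
qed

lemma sim_DEC:
  assumes "(l, DEC r l') \<in> set P"
  shows "(conf l s, conf l' (s(r := s r - 1))) \<in> (tm_rel M)\<^sup>+"
proof -
  let ?t = "s(r := s r - 1)"
  have r: "r < K"
    using reg_less[OF assms] by simp
  have "((state_code (At l), int (s r), tape s),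
      (state_code (Erase l), move Left (int (s r)), tape s))
      \<in> tm_rel M"
    by (rule step_keep) (use tstates_intros[OF assms] map_of_P[OF assms] in auto)
  then have *: "(conf l s, (state_code (Erase l), int (s r) - 1, tape s)) \<in> (tm_rel M)\<^sup>+"
    using rtrancl_into_trancl1[OF scan[OF assms], of r l' "s r" s] by auto
  show ?thesis
  proof (cases "s r")
    case 0
    have "((state_code (Erase l), -1, tape s), (state_code (At l'), move Right (-1), tape s))
        \<in> tm_rel M"
      by (rule step_keep) (use tstates_intros[OF assms] map_of_P[OF assms] in \<open>auto simp: set_encode_inverse\<close>)
    moreover have "?t = s"
      using 0 by auto
    ultimately show ?thesis
      using * 0 by (auto simp: conf_def intro: trancl_into_trancl)
  next
    case (Suc j)
    have "((state_code (Erase l), int j, tape s),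
        (state_code (Return l'), move Left (int j), (tape s)(int j := clear_bit r (tape s (int j)))))
        \<in> tm_rel M"
      by (rule step) (use tstates_intros[OF assms] map_of_P[OF assms] in auto)
    moreover have "clear_bit r (cell s j) = cell ?t j"
      unfolding clear_bit_def set_decode_cell unfolding cell_def
      by (rule arg_cong[of _ _ set_encode]) (use r Suc in auto)
    moreover have "(tape s)(int j := cell ?t j) = tape ?t"
      by (rule tape_upd) (use Suc in \<open>auto simp: cell_def intro!: arg_cong[of _ _ set_encode]\<close>)
    ultimately have "((state_code (Erase l), int j, tape s), (state_code (Return l'), int j - 1, tape ?t)) \<in> tm_rel M"
      by simp
    then show ?thesis
      using * Suc return_home[OF assms, of l' j ?t]
      by (auto intro: trancl_into_trancl trancl_rtrancl_trancl)
  qed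
qed

lemma sim_JZ:
  assumes "(l, JZ r l1 l2) \<in> set P"
  shows "(conf l s, conf (if s r = 0 then l1 else l2) s) \<in> (tm_rel M)\<^sup>+"
proof -
  let ?l = "if s r = 0 then l1 else l2"
  have "((state_code (At l), 0, tape s), (state_code (Return ?l), move Left 0, tape s)) \<in> tm_rel M"
    by (rule step_keep) (use tstates_intros[OF assms] map_of_P[OF assms] reg_less[OF assms] in auto)
  then show ?thesis
    using return_home[OF assms, of ?l 0 s] by (auto simp: conf_def intro: rtrancl_into_trancl2)
qed

lemma sim_exec:
  assumes "exec c s t" "set (code c l) \<subseteq> set P"
  shows "(conf l s, conf (l + clen c) t) \<in> (tm_rel M)\<^sup>*"
  using assms
proof (induction arbitrary: l rule: exec.induct)
  case (exec_Inc r s)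
  then show ?case
    using trancl_into_rtrancl[OF sim_INC[of l r "l + 1" s]] by (simp add: fun_upd_def)
next
  case (exec_Dec r s)
  then show ?case
    using trancl_into_rtrancl[OF sim_DEC[of l r "l + 1" s]] by (simp add: fun_upd_def)
next
  case (exec_Seq c s t d u)
  then have "(conf l s, conf (l + clen c) t) \<in> (tm_rel M)\<^sup>*"
    "(conf (l + clen c) t, conf (l + clen c + clen d) u) \<in> (tm_rel M)\<^sup>*"
    by auto
  then show ?case
    by (simp add: add.assoc)
next
  case (exec_While_0 s r c)
  then show ?case
    using sim_JZ[of l r "l + clen c + 2" "l + 1" s] by (auto intro: trancl_into_rtrancl)
next
  case (exec_While s r c t u)
  have a: "(conf l s, conf (l + 1) s) \<in> (tm_rel M)\<^sup>*"
    using sim_JZ[of l r "l + clen c + 2" "l + 1" s] exec_While.hyps exec_While.prems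
    by (auto intro: trancl_into_rtrancl)
  have b: "(conf (l + 1) s, conf (l + 1 + clen c) t) \<in> (tm_rel M)\<^sup>*"
    using exec_While.IH(1)[of "l + 1"] exec_While.prems by auto
  have c: "(conf (l + 1 + clen c) t, conf l t) \<in> (tm_rel M)\<^sup>*"
    using sim_JZ[of "l + 1 + clen c" r l l t] exec_While.prems by (auto intro: trancl_into_rtrancl)
  have d: "(conf l t, conf (l + clen (While r c)) u) \<in> (tm_rel M)\<^sup>*"
    using exec_While.IH(2)[OF exec_While.prems] .
  from a b c d show ?case
    by (meson rtrancl_trans)
qed

lemma sim_wp:
  assumes "wp c Q s" "set (code c l) \<subseteq> set P"
  obtains t where "Q t" "(conf l s, conf (l + clen c) t) \<in> (tm_rel M)\<^sup>*"
  using assms sim_exec unfolding wp_def by blast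

text \<open>The input letter 0 is written as the symbol 1, the code of the set whose only member is
  0. A word of \<open>x\<close> zeros is therefore register 0 with value \<open>x\<close>, and the
  two initial moves only supply the marker.\<close>

lemma sim_init: "(tm_init (replicate x 0), conf 0 (\<lambda>r. if r = 0 then x else 0)) \<in> (tm_rel M)\<^sup>*"
proof -
  let ?s = "\<lambda>r. if r = 0 then x else 0"
  define t where "t = (tape ?s)(- 1 := 0)"
  have "cell ?s j = (if j < x then 1 else 0)" for j
  proof -
    have "{r. r < K \<and> j < ?s r} = (if j < x then {0} else {})"
      using K_pos by auto
    then show ?thesis
      by (simp add: cell_def)
  qed
  then have init: "tm_init (replicate x 0) = (state_code Start, 0, t)"
    by (auto simp: tm_init_def state_code.simps t_def tape_def fun_eq_iff)
  have "0 \<in> tsymbols K"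
    unfolding tsymbols_def by (rule image_eqI[of _ _ "{}"]) auto
  then have "((state_code Mark, -1, t), (state_code (At 0), move Right (-1), t(-1 := marker K))) \<in> tm_rel M"
    by (intro step) (auto simp: t_def tstates_def)
  moreover have "((state_code Start, 0, t), (state_code Mark, move Left 0, t)) \<in> tm_rel M"
    by (rule step_keep) (auto simp: t_def tstates_def)
  moreover have "t(-1 := marker K) = tape ?s"
    by (auto simp: t_def tape_def)
  ultimately show ?thesis
    by (auto simp: init conf_def)
qed

lemma step_conf_None: "map_of P l = None \<Longrightarrow> tm_step M (conf l s) = None"
  using map_of_M[of "At l" "tape s 0"] by (simp add: conf_def del: map_of_eq_None_iff)

end

section \<open>A machine for unbounded search\<close>

lemma tm_halts_iff:
  "tm_halts M w \<longleftrightarrow> (\<exists>c. (tm_init w, c) \<in> (tm_rel M)\<^sup>* \<and> tm_step M c = None)"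
  by (simp add: tm_halts_def tm_rel_def)

text \<open>By determinism every reachable configuration lies on the path through configurations
  satisfying \<Phi>. Another of them is strictly ahead, so no reachable configuration is
  stuck.\<close>

lemma not_tm_halts:
  assumes init: "(tm_init w, c) \<in> (tm_rel M)\<^sup>*" "\<Phi> c"
    and progress: "\<And>c. \<Phi> c \<Longrightarrow> \<exists>c'. \<Phi> c' \<and> (c, c') \<in> (tm_rel M)\<^sup>+"
  shows "\<not> tm_halts M w"
proof -
  have "\<exists>c'. \<Phi> c' \<and> (d, c') \<in> (tm_rel M)\<^sup>+" if "(tm_init w, d) \<in> (tm_rel M)\<^sup>*" for d
    using that
  proof induction
    case base
    then show ?case
      using init progress by (meson rtrancl_trancl_trancl)
  next
    case (step d e)
    then obtain c' d' where c': "\<Phi> c'" and d': "(d, d') \<in> tm_rel M" "(d', c') \<in> (tm_rel M)\<^sup>*"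
      by (meson tranclD)
    have "d' = e"
      using d'(1) step.hyps(2) by (simp add: tm_rel_def)
    then show ?case
      using d'(2) c' progress by (meson rtrancl_trancl_trancl)
  qed
  then show ?thesis
    unfolding tm_halts_iff by (fastforce simp: tm_rel_def dest: tranclD)
qed

text \<open>Register 0 keeps the input, register 1 the candidate and register 2 the value of
  \<open>f\<close>; the loop runs while register 2 is nonzero. Each evaluation of \<open>f\<close>
  terminates, so only the loop can diverge.\<close>

lemma ex_tm_search:
  assumes "computable 2 f"
  shows "\<exists>M. \<forall>x. tm_halts M (replicate x 0) \<longleftrightarrow> (\<exists>n. f [n, x] = 0)"
proof -
  obtain r where "\<And>xs. length xs = 2 \<Longrightarrow> computes r xs (f xs)"
    using assms by (auto simp: computable_def)
  then have r: "computes r [n, x] (f [n, x])" for n x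
    by simp
  \<comment> \<open>The argument list is \<open>[n, x]\<close>, hence the registers
    \<open>[1, 0]\<close>; the result goes to register 2, and everything above is scratch
    space.\<close>
  define F where "F = compile r [1, 0] 2"
  have F: "wp F (\<lambda>t. t 0 = s 0 \<and> t 1 = s 1 \<and> t 2 = f [s 1, s 0]) s" for s
    unfolding F_def
    by (rule implementsD[OF implements_compile[OF r[of "s 1" "s 0"]]]) auto
  define A where "A = clear 1 ;; F"
  define B where "B = Inc 1 ;; F"
  define main where "main = A ;; While 2 B"
  define P where "P = code main 0"
  define K where "K = Suc (Max (insert 0 (regs main)))"
  obtain M where M: "\<forall>q a. map_of M (state_code q, a) =
      (if q \<in> tstates P \<and> a \<in> tsymbols K then map_option next_code (tdelta P K q a) else None)"
    using ex_machine by blast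
  interpret counter_machine P K M
  proof
    show "distinct (map fst P)"
      by (simp add: P_def map_fst_code)
    show "reg i < K" if "(l, i) \<in> set P" for l i
      using reg_code[of l i main 0] that finite_regs[of main]
      by (auto simp: P_def K_def less_Suc_eq_le intro: Max_ge)
  qed (use M in \<open>auto simp: K_def\<close>)
  define h where "h = clen A"
  define J where "J x n s \<longleftrightarrow> s 0 = x \<and> s 1 = n \<and> s 2 = f [n, x]" for x n :: nat and s :: "nat \<Rightarrow> nat"
  have P: "set (code A 0) \<subseteq> set P" "set (code B (h + 1)) \<subseteq> set P"
    "(h, JZ 2 (h + clen B + 2) (h + 1)) \<in> set P" "(h + 1 + clen B, JZ 2 h h) \<in> set P"
    by (auto simp: P_def main_def h_def)
  have start: "\<exists>s. J x 0 s \<and> (tm_init (replicate x 0), conf h s) \<in> (tm_rel M)\<^sup>*" for x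
  proof -
    have "wp A (J x 0) (\<lambda>r. if r = 0 then x else 0)"
      unfolding A_def wp_Seq_eq by (rule wp_clear, rule wp_mono[OF F]) (simp add: J_def)
    then obtain s where "J x 0 s" "(conf 0 (\<lambda>r. if r = 0 then x else 0), conf (0 + clen A) s) \<in> (tm_rel M)\<^sup>*"
      by (rule sim_wp[OF _ P(1)])
    then show ?thesis
      using sim_init[of x] by (auto simp: h_def intro: rtrancl_trans)
  qed
  have loop: "\<exists>t. J x (Suc n) t \<and> (conf h s, conf h t) \<in> (tm_rel M)\<^sup>+"
    if J: "J x n s" and f: "f [n, x] \<noteq> 0" for x n s
  proof -
    have "(conf h s, conf (h + 1) s) \<in> (tm_rel M)\<^sup>+"
      using sim_JZ[OF P(3), of s] J f by (simp add: J_def)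
    moreover have "wp B (J x (Suc n)) s"
      unfolding B_def wp_Seq_eq by (rule wp_Inc, rule wp_mono[OF F]) (use J in \<open>simp add: J_def\<close>)
    then obtain t where "J x (Suc n) t" "(conf (h + 1) s, conf (h + 1 + clen B) t) \<in> (tm_rel M)\<^sup>*"
      by (rule sim_wp[OF _ P(2)])
    moreover have "(conf (h + 1 + clen B) t, conf h t) \<in> (tm_rel M)\<^sup>+"
      using sim_JZ[OF P(4), of t] by simp
    ultimately show ?thesis
      by (meson trancl_rtrancl_trancl trancl_trans)
  qed
  have "tm_halts M (replicate x 0) \<longleftrightarrow> (\<exists>n. f [n, x] = 0)" for x
  proof (cases "\<exists>n. f [n, x] = 0")
    case True
    define n where "n = (LEAST n. f [n, x] = 0)"
    have fn: "f [n, x] = 0"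
      using True unfolding n_def by (rule LeastI_ex)
    have "\<exists>s. J x k s \<and> (tm_init (replicate x 0), conf h s) \<in> (tm_rel M)\<^sup>*" if "k \<le> n" for k
      using that
    proof (induction k)
      case (Suc k)
      then obtain s where s: "J x k s" "(tm_init (replicate x 0), conf h s) \<in> (tm_rel M)\<^sup>*"
        by auto
      moreover have "f [k, x] \<noteq> 0"
        using Suc.prems not_less_Least[of k "\<lambda>n. f [n, x] = 0"] by (simp add: n_def)
      ultimately show ?case
        using loop[OF s(1)] by (meson rtrancl_trans trancl_into_rtrancl)
    qed (rule start)
    then obtain s where s: "J x n s" "(tm_init (replicate x 0), conf h s) \<in> (tm_rel M)\<^sup>*"
      by auto
    have "(conf h s, conf (h + clen B + 2) s) \<in> (tm_rel M)\<^sup>+"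
      using sim_JZ[OF P(3), of s] s(1) fn by (simp add: J_def)
    then have "(tm_init (replicate x 0), conf (h + clen B + 2) s) \<in> (tm_rel M)\<^sup>*"
      using s(2) by (meson rtrancl_trans trancl_into_rtrancl)
    \<comment> \<open>This exit label is the total length of the code, one past its last
      label.\<close>
    moreover have "map_of P (h + clen B + 2) = None"
      unfolding map_of_eq_None_iff set_map[symmetric] P_def map_fst_code
      by (simp add: main_def h_def)
    ultimately show ?thesis
      using step_conf_None True unfolding tm_halts_iff by blast
  next
    case False
    from start[of x] obtain s
      where s: "J x 0 s" "(tm_init (replicate x 0), conf h s) \<in> (tm_rel M)\<^sup>*"
      by (elim exE conjE)
    have "\<not> tm_halts M (replicate x 0)"
    proof (rule not_tm_halts[OF s(2), where \<Phi> = "\<lambda>c. \<exists>n s. J x n s \<and> c = conf h s"])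
      show "\<exists>c'. (\<exists>n s. J x n s \<and> c' = conf h s) \<and> (c, c') \<in> (tm_rel M)\<^sup>+"
        if "\<exists>n s. J x n s \<and> c = conf h s" for c
      proof -
        from that obtain n s where s: "J x n s" "c = conf h s"
          by (elim exE conjE)
        from False have "f [n, x] \<noteq> 0"
          by auto
        from loop[OF s(1) this] show ?thesis
          unfolding s(2) by (elim exE conjE) (intro exI conjI, assumption, rule refl)
      qed
    qed (use s(1) in auto)
    with False show ?thesis
      by blast
  qed
  then show ?thesis
    by blast
qed

section \<open>Simulation of Turing machines\<close>

primrec direction_code :: "direction \<Rightarrow> nat" where
  "direction_code Left = 0" | "direction_code Right = 1"

text \<open>The value part of an instruction code. Splitting it off exhibits the code of a machine
  as an association list keyed by coded pairs of state and symbol, so \<open>lookup\<close> finds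
  the same instruction as \<open>map_of\<close>.\<close>

definition action_code :: "nat \<times> nat \<times> direction \<Rightarrow> nat" where
  "action_code = (\<lambda>(q, b, d). prod_encode (q, 2 * b + direction_code d))"

lemma instr_encode_eq:
  "instr_encode x = prod_encode (prod_encode (fst x), action_code (snd x))"
  by (cases x rule: instr_encode.cases) (auto simp: action_code_def split: direction.split)

lemma bij_action_code: "bij action_code"
proof (rule bijI)
  show "inj action_code"
  proof (rule injI)
    fix x y
    assume "action_code x = action_code y"
    moreover obtain q b d q' b' d' where "x = (q, b, d)" "y = (q', b', d')"
      by (cases x; cases y) auto
    ultimately show "x = y"
      by (cases d; cases d') (auto simp: action_code_def, presburger+)
  qed
  show "surj action_code"
  proof (rule surjI)
    fix c
    show "action_code (pfst c, psnd c div 2, if even (psnd c) then Left else Right) = c"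
      by (auto simp: action_code_def)
  qed
qed

lemma bij_instr_encode: "bij instr_encode"
proof -
  have "instr_encode = prod_encode \<circ> map_prod prod_encode action_code"
    by (auto simp: fun_eq_iff instr_encode_eq map_prod_def split: prod.split)
  moreover have "bij (map_prod prod_encode action_code)"
    using bij_betw_map_prod[OF bij_prod_encode bij_action_code] by simp
  ultimately show ?thesis
    using bij_comp[OF _ bij_prod_encode] by metis
qed

lemma tm_encode_inject: "tm_encode M = tm_encode M' \<longleftrightarrow> M = M'"
  unfolding tm_encode_def list_encode_eq
  using bij_instr_encode by (auto simp: inj_map_eq_map bij_def)

text \<open>Surjectivity lets membership in the halting problem be tested for every number, without
  a syntax check.\<close>

lemma ex_tm_encode: "\<exists>M. tm_encode M = c"
proof -
  have "map instr_encode (map (inv instr_encode) (list_decode c)) = list_decode c"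
    using bij_instr_encode by (simp add: comp_def surj_f_inv_f bij_def)
  then show ?thesis
    unfolding tm_encode_def by (metis list_decode_inverse)
qed

lemma in_halting_problem_iff:
  "prod_encode (tm_encode M, list_encode w) \<in> halting_problem \<longleftrightarrow> tm_halts M w"
  by (auto simp: halting_problem_def tm_encode_inject list_encode_eq)

lemma lookup_tm_encode:
  "lookup (tm_encode M) (prod_encode (q, a)) =
     (case map_of M (q, a) of None \<Rightarrow> 0 | Some x \<Rightarrow> Suc (action_code x))"
proof -
  have "tm_encode M = map_encode (map (\<lambda>x. (prod_encode (fst x), action_code (snd x))) M)"
    by (simp add: tm_encode_def map_encode_def comp_def instr_encode_eq[abs_def])
  moreover have "map_of (map (\<lambda>x. (prod_encode (fst x), action_code (snd x))) M) (prod_encode (q, a)) =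
      map_option action_code (map_of M (q, a))"
    by (induction M) auto
  ultimately show ?thesis
    by (auto simp: lookup_map_encode split: option.split)
qed

text \<open>
  A configuration is simulated as \<open>(q, (p, log))\<close> with an integer head position coded by
  \<^const>\<open>int_encode\<close> and the list of all writes so far, the latest one first.
\<close>

definition read_code :: "nat \<Rightarrow> nat \<Rightarrow> nat \<Rightarrow> nat" where
  "read_code w p log =
     (if lookup log p = 0 then if even p then code_nth w (p div 2) else 0 else lookup log p - 1)"

text \<open>\<open>int_encode\<close> sends a nonnegative \<open>i\<close> to \<open>2 * i\<close>
  and the numbers -1, -2, ... to 1, 3, ...; a step to the left thus lowers even codes, raises odd
  ones and crosses from 0 to 1.\<close>

definition move_left_code :: "nat \<Rightarrow> nat" where
  "move_left_code p = (if even p then if p = 0 then 1 else p - 2 else p + 2)"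

definition move_right_code :: "nat \<Rightarrow> nat" where
  "move_right_code p = (if even p then p + 2 else if p = 1 then 0 else p - 2)"

definition next_action :: "nat \<Rightarrow> nat \<Rightarrow> nat \<Rightarrow> nat" where
  "next_action M w c = lookup M (prod_encode (pfst c, read_code w (pfst (psnd c)) (psnd (psnd c))))"

text \<open>\<open>Suc (prod_encode (_, log))\<close> is the list code of the log with one more
  entry. The second component of the action packs the written symbol and the direction, hence the
  halving and the parity test.\<close>

definition next_conf :: "nat \<Rightarrow> nat \<Rightarrow> nat \<Rightarrow> nat" where
  "next_conf a p log =
     prod_encode (pfst a,
       prod_encode (if even (psnd a) then move_left_code p else move_right_code p,
         Suc (prod_encode (prod_encode (p, psnd a div 2), log))))"

text \<open>A halted configuration is repeated forever. This makes \<open>sim\<close> total, and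
  halting shows as \<open>next_action\<close> being 0 at some time.\<close>

definition sim_step :: "nat \<Rightarrow> nat \<Rightarrow> nat \<Rightarrow> nat" where
  "sim_step M w c =
     (if next_action M w c = 0 then c
      else next_conf (next_action M w c - 1) (pfst (psnd c)) (psnd (psnd c)))"

definition sim :: "nat \<Rightarrow> nat \<Rightarrow> nat \<Rightarrow> nat" where
  "sim M w t = rec_nat (prod_encode (0, prod_encode (0, 0))) (\<lambda>_ c. sim_step M w c) t"

lemma computable_sim:
  "computable_pred 2 (\<lambda>ys. next_action (pfst (hd (tl ys))) (psnd (hd (tl ys)))
     (sim (pfst (hd (tl ys))) (psnd (hd (tl ys))) (hd ys)) = 0)"
  unfolding numeral_2_eq_2
  unfolding sim_def sim_step_def next_conf_def next_action_def read_code_def move_left_code_def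
    move_right_code_def
  by (intro computable_intros computable_rec computable_lookup computable_code_nth
      computable_div2 computable_pred_even)

definition represents :: "nat list \<Rightarrow> nat \<Rightarrow> tm_config \<Rightarrow> bool" where
  "represents w c = (\<lambda>(q, p, t). \<exists>log.
     c = prod_encode (q, prod_encode (int_encode p, map_encode log)) \<and>
     (\<forall>i. t i = (case map_of log (int_encode i) of
        None \<Rightarrow> (if 0 \<le> i \<and> i < int (length w) then Suc (w ! nat i) else 0)
      | Some b \<Rightarrow> b)))"

lemma int_encode_cases: "int_encode i = (if 0 \<le> i then 2 * nat i else Suc (2 * nat (- i - 1)))"
  by (simp add: int_encode_def sum_encode_def)

lemma move_left_code: "move_left_code (int_encode p) = int_encode (p - 1)"
  unfolding move_left_code_def int_encode_cases by (auto simp: nat_diff_distrib)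

lemma move_right_code: "move_right_code (int_encode p) = int_encode (p + 1)"
  unfolding move_right_code_def int_encode_cases by (auto simp: nat_add_distrib)

text \<open>Where nothing has been written, the input word decides. Nonnegative positions have even
  codes, so \<open>p div 2\<close> indexes the word; \<open>code_nth\<close> returns
  \<open>Suc\<close> of the letter inside the word and the blank 0 outside, as
  \<open>tm_init\<close> does.\<close>

lemma represents_read:
  assumes "represents w c (q, p, t)"
  shows "pfst c = q" "pfst (psnd c) = int_encode p"
    "read_code (list_encode w) (pfst (psnd c)) (psnd (psnd c)) = t p"
proof -
  obtain log where c: "c = prod_encode (q, prod_encode (int_encode p, map_encode log))"
    and t: "t p = (case map_of log (int_encode p) of
        None \<Rightarrow> (if 0 \<le> p \<and> p < int (length w) then Suc (w ! nat p) else 0)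
      | Some b \<Rightarrow> b)"
    using assms by (auto simp: represents_def)
  show "pfst c = q" "pfst (psnd c) = int_encode p"
    by (simp_all add: c)
  show "read_code (list_encode w) (pfst (psnd c)) (psnd (psnd c)) = t p"
    by (auto simp: c t read_code_def lookup_map_encode int_encode_cases code_nth_list_encode
        split: option.split)
qed

lemma represents_next_action:
  assumes "represents w c (q, p, t)"
  shows "next_action (tm_encode M) (list_encode w) c =
    (case map_of M (q, t p) of None \<Rightarrow> 0 | Some x \<Rightarrow> Suc (action_code x))"
  using represents_read[OF assms] by (simp add: next_action_def lookup_tm_encode)

lemma represents_next_action_eq_0:
  "represents w c d \<Longrightarrow> next_action (tm_encode M) (list_encode w) c = 0 \<longleftrightarrow> tm_step M d = None"
  by (cases d) (auto simp: represents_next_action split: option.splits)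

lemma represents_step:
  assumes r: "represents w c d" and s: "tm_step M d = Some d'"
  shows "represents w (sim_step (tm_encode M) (list_encode w) c) d'"
proof -
  obtain q p t where d: "d = (q, p, t)"
    by (cases d) auto
  obtain q' b e where m: "map_of M (q, t p) = Some (q', b, e)" and d': "d' = (q', move e p, t(p := b))"
    using s by (auto simp: d split: option.splits)
  obtain log where c: "c = prod_encode (q, prod_encode (int_encode p, map_encode log))"
    and t: "\<forall>i. t i = (case map_of log (int_encode i) of
        None \<Rightarrow> (if 0 \<le> i \<and> i < int (length w) then Suc (w ! nat i) else 0)
      | Some b \<Rightarrow> b)"
    using r by (auto simp: represents_def d)
  have "sim_step (tm_encode M) (list_encode w) c =
      prod_encode (q', prod_encode (int_encode (move e p), map_encode ((int_encode p, b) # log)))"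
    unfolding sim_step_def represents_next_action[OF r[unfolded d]] m
    by (cases e) (simp_all add: next_conf_def action_code_def c move_left_code move_right_code map_encode_def)
  moreover have "(t(p := b)) i = (case map_of ((int_encode p, b) # log) (int_encode i) of
        None \<Rightarrow> (if 0 \<le> i \<and> i < int (length w) then Suc (w ! nat i) else 0)
      | Some b \<Rightarrow> b)" for i
    using t by (auto simp: int_encode_eq)
  ultimately show ?thesis
    unfolding represents_def d' by blast
qed

lemma represents_init: "represents w (prod_encode (0, prod_encode (0, 0))) (tm_init w)"
  unfolding represents_def tm_init_def
  by (auto intro!: exI[of _ "[]"] simp: map_encode_def int_encode_cases)

lemma tm_halts_iff_sim:
  "tm_halts M w \<longleftrightarrow> (\<exists>t. next_action (tm_encode M) (list_encode w) (sim (tm_encode M) (list_encode w) t) = 0)"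
proof -
  let ?sim = "sim (tm_encode M) (list_encode w)"
  have sim_Suc: "?sim (Suc t) = sim_step (tm_encode M) (list_encode w) (?sim t)" for t
    by (simp add: sim_def)
  have init: "represents w (?sim 0) (tm_init w)"
    using represents_init by (simp add: sim_def)
  have "\<exists>t. represents w (?sim t) d" if "(tm_init w, d) \<in> (tm_rel M)\<^sup>*" for d
    using that
  proof induction
    case (step d e)
    from step.IH obtain t where t: "represents w (?sim t) d" ..
    have "tm_step M d = Some e"
      using step.hyps(2) by (simp add: tm_rel_def)
    from represents_step[OF t this] show ?case
      unfolding sim_Suc[symmetric] ..
  qed (rule exI, rule init)
  moreover have "\<exists>d. (tm_init w, d) \<in> (tm_rel M)\<^sup>* \<and> represents w (?sim t) d" for t
  proof (induction t)
    case (Suc t)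
    then obtain d where d: "(tm_init w, d) \<in> (tm_rel M)\<^sup>*" "represents w (?sim t) d"
      by blast
    show ?case
    proof (cases "tm_step M d")
      case None
      then have "?sim (Suc t) = ?sim t"
        using represents_next_action_eq_0[OF d(2)] by (simp add: sim_Suc sim_step_def)
      then show ?thesis
        using d by (intro exI[of _ d]) simp
    next
      case (Some d')
      then have "(tm_init w, d') \<in> (tm_rel M)\<^sup>*"
        using d(1) by (auto simp: tm_rel_def intro: rtrancl_into_rtrancl)
      then show ?thesis
        using represents_step[OF d(2) Some] unfolding sim_Suc by (intro exI conjI)
    qed
  qed (intro exI conjI, rule rtrancl_refl, rule init)
  ultimately show ?thesis
    unfolding tm_halts_iff by (meson represents_next_action_eq_0)
qed

lemma halting_problem_iff:
  "x \<in> halting_problem \<longleftrightarrow>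
     (\<exists>t. next_action (pfst x) (psnd x) (sim (pfst x) (psnd x) t) = 0)"
proof -
  obtain M where M: "tm_encode M = pfst x"
    using ex_tm_encode by blast
  have x: "x = prod_encode (tm_encode M, list_encode (list_decode (psnd x)))"
    by (simp add: M)
  show ?thesis
    unfolding M[symmetric] using tm_halts_iff_sim[of M "list_decode (psnd x)"]
      in_halting_problem_iff[of M "list_decode (psnd x)"] x by simp
qed

lemma re_pred_halting_problem: "re_pred 1 (\<lambda>xs. hd xs \<in> halting_problem)"
  unfolding re_pred_def halting_problem_iff
  using computable_sim
  by (intro exI[of _ "\<lambda>ys. next_action (pfst (hd (tl ys))) (psnd (hd (tl ys)))
     (sim (pfst (hd (tl ys))) (psnd (hd (tl ys))) (hd ys)) = 0"]) (auto simp: numeral_2_eq_2)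

section \<open>Certificates for crosswords\<close>

text \<open>The constructors of the numbering as operations on codes. Distinctness and injectivity
  make them free for the simplifier, and certificates can quantify over codes of subexpressions
  instead of decoding them.\<close>

definition lit_code :: "nat \<Rightarrow> nat" where "lit_code a = Suc (4 * a)"
definition union_code :: "nat \<Rightarrow> nat \<Rightarrow> nat" where
  "union_code p q = Suc (4 * prod_encode (p, q) + 1)"
definition concat_code :: "nat \<Rightarrow> nat \<Rightarrow> nat" where
  "concat_code p q = Suc (4 * prod_encode (p, q) + 2)"
definition star_code :: "nat \<Rightarrow> nat" where "star_code p = Suc (4 * p + 3)"

lemmas rexp_code_defs = lit_code_def union_code_def concat_code_def star_code_def

lemma rexp_encode_code:
  "rexp_encode (Letter a) = lit_code a"
  "rexp_encode (Union r s) = union_code (rexp_encode r) (rexp_encode s)"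
  "rexp_encode (Concat r s) = concat_code (rexp_encode r) (rexp_encode s)"
  "rexp_encode (Star r) = star_code (rexp_encode r)"
  by (simp_all add: rexp_code_defs)

declare rexp_encode.simps(2-5) [simp del] rexp_encode_code [simp]

lemma code_less:
  "a < lit_code a" "p < union_code p q" "q < union_code p q" "p < concat_code p q"
  "q < concat_code p q" "p < star_code p"
  using le_prod_encode_1[of p q] le_prod_encode_2[of q p] by (simp_all add: rexp_code_defs)

lemma code_inject [simp]:
  "lit_code a = lit_code b \<longleftrightarrow> a = b"
  "union_code p q = union_code p' q' \<longleftrightarrow> p = p' \<and> q = q'"
  "concat_code p q = concat_code p' q' \<longleftrightarrow> p = p' \<and> q = q'"
  "star_code p = star_code p' \<longleftrightarrow> p = p'"
  by (auto simp: rexp_code_defs)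

lemma code_distinct:
  "lit_code a \<noteq> 0" "union_code p q \<noteq> 0" "concat_code p q \<noteq> 0" "star_code p \<noteq> 0"
  "lit_code a \<noteq> union_code p q" "lit_code a \<noteq> concat_code p q" "lit_code a \<noteq> star_code p'"
  "union_code p q \<noteq> concat_code p' q'" "union_code p q \<noteq> star_code p'"
  "concat_code p q \<noteq> star_code p'"
  unfolding rexp_code_defs by presburger+

declare code_distinct [simp] code_distinct [symmetric, simp]

lemma rexp_encode_inject: "rexp_encode r = rexp_encode s \<longleftrightarrow> r = s"
proof (induction r arbitrary: s)
  case Eps
  then show ?case by (cases s) auto
next
  case (Letter a)
  then show ?case by (cases s) auto
next
  case (Union r1 r2)
  then show ?case by (cases s) auto
next
  case (Concat r1 r2)
  then show ?case by (cases s) auto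
next
  case (Star r)
  then show ?case by (cases s) auto
qed

text \<open>For positive \<open>c\<close> the residue of \<open>c - 1\<close> modulo 4 determines
  the constructor, and the arguments have smaller codes.\<close>

lemma ex_rexp_encode: "\<exists>r. rexp_encode r = c"
proof (induction c rule: less_induct)
  case (less c)
  have "c = 0 \<or> (\<exists>d. c = lit_code d \<or> c = union_code (pfst d) (psnd d) \<or>
      c = concat_code (pfst d) (psnd d) \<or> c = star_code d)"
    unfolding rexp_code_defs prod_encode_pfst_psnd by presburger
  then show ?case
  proof (elim disjE exE)
    fix d
    assume c: "c = union_code (pfst d) (psnd d)"
    then obtain r s where "rexp_encode r = pfst d" "rexp_encode s = psnd d"
      using less code_less by metis
    then show ?thesis
      using c by (intro exI[of _ "Union r s"]) simp
  next
    fix d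
    assume c: "c = concat_code (pfst d) (psnd d)"
    then obtain r s where "rexp_encode r = pfst d" "rexp_encode s = psnd d"
      using less code_less by metis
    then show ?thesis
      using c by (intro exI[of _ "Concat r s"]) simp
  next
    fix d
    assume c: "c = star_code d"
    then obtain r where "rexp_encode r = d"
      using less code_less by metis
    then show ?thesis
      using c by (intro exI[of _ "Star r"]) simp
  next
    fix d
    assume "c = lit_code d"
    then show ?thesis
      by (intro exI[of _ "Letter d"]) simp
  qed (auto intro: exI[of _ Eps])
qed

lemma computable_codes:
  "computable k f \<Longrightarrow> computable k (\<lambda>xs. lit_code (f xs))"
  "computable k f \<Longrightarrow> computable k g \<Longrightarrow> computable k (\<lambda>xs. union_code (f xs) (g xs))"
  "computable k f \<Longrightarrow> computable k g \<Longrightarrow> computable k (\<lambda>xs. concat_code (f xs) (g xs))"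
  "computable k f \<Longrightarrow> computable k (\<lambda>xs. star_code (f xs))"
  unfolding rexp_code_defs by (intro computable_intros; assumption)+

lemma finite_letters: "finite (letters r)"
  by (induction r) auto

lemma lang_letters: "w \<in> lang r \<Longrightarrow> set w \<subseteq> letters r"
proof (induction r arbitrary: w)
  case (Star r)
  then obtain us where "w = concat us" "set us \<subseteq> lang r"
    by auto
  then show ?case
    using Star.IH by fastforce
qed fastforce+

text \<open>The letter in a cell occurs in a row that matches \<open>E\<close>, so
  \<open>letters E\<close> is an admissible alphabet and the quantifier over \<Sigma>
  disappears.\<close>

lemma crossword_problem_iff:
  "rexp_encode E \<in> crossword_problem \<longleftrightarrow>
     positive E \<and> (\<exists>m n X. 1 \<le> m \<and> 1 \<le> n \<and> (\<forall>i<m. row n X i \<in> lang E) \<and> (\<forall>j<n. column m X j \<in> lang E))"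
proof -
  have "crossword (letters E) m n X"
    if "1 \<le> m" "1 \<le> n" "\<forall>i<m. row n X i \<in> lang E" for m n X
    unfolding crossword_def
  proof (intro conjI allI impI)
    fix i j
    assume "i < m" "j < n"
    then have "X i j \<in> set (row n X i)"
      by (auto simp: row_def)
    then show "X i j \<in> letters E"
      using that(3) \<open>i < m\<close> lang_letters by fastforce
  qed (use that in auto)
  then have "RC_crossword (letters E) E E m n X"
    if "1 \<le> m" "1 \<le> n" "\<forall>i<m. row n X i \<in> lang E" "\<forall>j<n. column m X j \<in> lang E" for m n X
    using that by (simp add: RC_crossword_def)
  note RC = this
  show ?thesis
  proof
    assume "rexp_encode E \<in> crossword_problem"
    then obtain E' \<Sigma> m n X where E': "rexp_encode E = rexp_encode E'" "positive E'"
      "RC_crossword \<Sigma> E' E' m n X"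
      unfolding crossword_problem_def by blast
    from E'(1) have "E' = E"
      by (simp only: rexp_encode_inject)
    with E'(2,3) show "positive E \<and> (\<exists>m n X. 1 \<le> m \<and> 1 \<le> n \<and> (\<forall>i<m. row n X i \<in> lang E) \<and>
        (\<forall>j<n. column m X j \<in> lang E))"
      unfolding RC_crossword_def crossword_def by blast
  next
    assume "positive E \<and> (\<exists>m n X. 1 \<le> m \<and> 1 \<le> n \<and> (\<forall>i<m. row n X i \<in> lang E) \<and>
        (\<forall>j<n. column m X j \<in> lang E))"
    then obtain m n X where E: "positive E" "1 \<le> m" "1 \<le> n" "\<forall>i<m. row n X i \<in> lang E"
      "\<forall>j<n. column m X j \<in> lang E"
      by blast
    show "rexp_encode E \<in> crossword_problem"
      unfolding crossword_problem_def
      by (intro CollectI exI conjI, rule refl, rule finite_letters, rule subset_refl, rule E(1),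
          rule RC[OF E(2-5)])
  qed
qed

section \<open>Finite tables certifying positivity and matching\<close>

lemma ex_lookup:
  assumes "finite (dom m)"
  shows "\<exists>c. \<forall>a. lookup c a = (case m a of None \<Rightarrow> 0 | Some v \<Rightarrow> Suc v)"
proof -
  from ex_map_of[OF assms] obtain ps where "map_of ps = m" ..
  then show ?thesis
    using lookup_map_encode by metis
qed

lemma ex_lookup_set:
  assumes "finite S"
  shows "\<exists>c. \<forall>a. lookup c a \<noteq> 0 \<longleftrightarrow> a \<in> S"
proof -
  have "finite (dom (\<lambda>a. if a \<in> S then Some 0 else None))"
    by (rule finite_subset[OF _ assms]) (auto split: if_splits)
  from ex_lookup[OF this] obtain c
    where c: "\<forall>a. lookup c a = (case if a \<in> S then Some 0 else None of None \<Rightarrow> 0 | Some v \<Rightarrow> Suc v)" ..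
  have "lookup c a \<noteq> 0 \<longleftrightarrow> a \<in> S" for a
    using c by simp
  then show ?thesis
    by blast
qed

text \<open>\<open>N\<close> is meant as a set of codes of expressions that reject the empty word.
  \<open>Eps\<close> and \<open>Star\<close> always accept it, so they have no clause. A certificate
  avoids course-of-values recursion over codes.\<close>

definition nn_justified :: "nat \<Rightarrow> nat \<Rightarrow> bool" where
  "nn_justified N r \<longleftrightarrow>
     (\<exists>a<r. r = lit_code a) \<or>
     (\<exists>p<r. \<exists>q<r. r = union_code p q \<and> lookup N p \<noteq> 0 \<and> lookup N q \<noteq> 0) \<or>
     (\<exists>p<r. \<exists>q<r. r = concat_code p q \<and> (lookup N p \<noteq> 0 \<or> lookup N q \<noteq> 0))"

text \<open>Only codes up to that of \<open>E\<close> have to be justified, since subexpressions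
  have smaller codes. The intended \<open>N\<close> collects all positive expressions in this range;
  conversely, structural induction shows that a justified set contains only positive ones.\<close>

lemma positive_iff:
  "positive E \<longleftrightarrow>
     (\<exists>N. (\<forall>r<Suc (rexp_encode E). lookup N r \<noteq> 0 \<longrightarrow> nn_justified N r) \<and> lookup N (rexp_encode E) \<noteq> 0)"
proof
  assume E: "positive E"
  define S where "S = {c. c \<le> rexp_encode E \<and> (\<exists>r. rexp_encode r = c \<and> positive r)}"
  have "finite S"
    by (simp add: S_def)
  from ex_lookup_set[OF this] obtain N where N: "\<forall>a. lookup N a \<noteq> 0 \<longleftrightarrow> a \<in> S" ..
  have mem: "lookup N (rexp_encode r) \<noteq> 0 \<longleftrightarrow> rexp_encode r \<le> rexp_encode E \<and> positive r" for r
    using N by (auto simp: S_def rexp_encode_inject)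
  have "nn_justified N (rexp_encode r)" if "rexp_encode r \<le> rexp_encode E" "positive r" for r
  proof (cases r)
    case (Union s t)
    then have "positive s" "positive t" "rexp_encode s < rexp_encode r" "rexp_encode t < rexp_encode r"
      using that(2) code_less by (auto simp: positive_def)
    then show ?thesis
      using that(1) mem[of s] mem[of t] Union unfolding nn_justified_def by auto
  next
    case (Concat s t)
    then have "positive s \<or> positive t" "rexp_encode s < rexp_encode r" "rexp_encode t < rexp_encode r"
      using that(2) code_less by (auto simp: positive_def)
    then show ?thesis
      using that(1) mem[of s] mem[of t] Concat unfolding nn_justified_def by auto
  next
    case (Star s)
    have "[] \<in> lang (Star s)"
      by (auto intro: exI[of _ "[]"])
    then show ?thesis
      using that(2) Star by (simp add: positive_def)
  qed (use that(2) code_less in \<open>auto simp: positive_def nn_justified_def\<close>)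
  then have "\<forall>r<Suc (rexp_encode E). lookup N r \<noteq> 0 \<longrightarrow> nn_justified N r"
    using ex_rexp_encode mem by (metis less_Suc_eq_le)
  then show "\<exists>N. (\<forall>r<Suc (rexp_encode E). lookup N r \<noteq> 0 \<longrightarrow> nn_justified N r) \<and> lookup N (rexp_encode E) \<noteq> 0"
    using mem E by blast
next
  assume "\<exists>N. (\<forall>r<Suc (rexp_encode E). lookup N r \<noteq> 0 \<longrightarrow> nn_justified N r) \<and> lookup N (rexp_encode E) \<noteq> 0"
  then obtain N where N: "\<forall>r<Suc (rexp_encode E). lookup N r \<noteq> 0 \<longrightarrow> nn_justified N r"
    "lookup N (rexp_encode E) \<noteq> 0"
    by blast
  have "positive r" if "rexp_encode r \<le> rexp_encode E" "lookup N (rexp_encode r) \<noteq> 0" for r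
    using that
  proof (induction r)
    case Eps
    then show ?case
      using N(1) by (force simp: nn_justified_def)
  next
    case (Star r)
    have "nn_justified N (rexp_encode (Star r))"
      using N(1) Star.prems unfolding less_Suc_eq_le by blast
    then show ?case
      by (simp add: nn_justified_def)
  next
    case (Union r s)
    have "nn_justified N (rexp_encode (Union r s))"
      using N(1) Union.prems unfolding less_Suc_eq_le by blast
    then have "lookup N (rexp_encode r) \<noteq> 0" "lookup N (rexp_encode s) \<noteq> 0"
      by (auto simp: nn_justified_def)
    then show ?case
      using Union code_less(2)[of "rexp_encode r" "rexp_encode s"]
        code_less(3)[of "rexp_encode s" "rexp_encode r"] by (simp add: positive_def)
  next
    case (Concat r s)
    have "nn_justified N (rexp_encode (Concat r s))"
      using N(1) Concat.prems unfolding less_Suc_eq_le by blast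
    then have "lookup N (rexp_encode r) \<noteq> 0 \<or> lookup N (rexp_encode s) \<noteq> 0"
      by (auto simp: nn_justified_def)
    then show ?case
      using Concat code_less(4)[of "rexp_encode r" "rexp_encode s"]
        code_less(5)[of "rexp_encode s" "rexp_encode r"] by (auto simp: positive_def)
  qed (simp add: positive_def)
  with N(2) show "positive E"
    by blast
qed

text \<open>
  A table \<open>T\<close> certifies that a word matches an expression: it lists triples \<open>(j, k, r)\<close>
  asserting that the segment from position \<open>j\<close> to position \<open>k\<close> matches \<open>r\<close>. The letter at
  position \<open>j\<close> is \<open>a j - 1\<close>.
\<close>

definition seg :: "nat \<Rightarrow> nat \<Rightarrow> nat \<Rightarrow> nat \<Rightarrow> bool" where
  "seg T j k r \<longleftrightarrow> lookup T (prod_encode (j, prod_encode (k, r))) \<noteq> 0"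

text \<open>The star clause splits off a nonempty first factor, \<open>j < l\<close>, so the rest is
  a shorter segment and no entry can support itself. A cell value 0 stands for a missing letter and
  matches no \<open>Letter\<close>.\<close>

definition seg_justified :: "(nat \<Rightarrow> nat) \<Rightarrow> nat \<Rightarrow> nat \<Rightarrow> nat \<Rightarrow> nat \<Rightarrow> bool" where
  "seg_justified a T j k r \<longleftrightarrow>
     (r = 0 \<and> j = k) \<or>
     (\<exists>b<r. r = lit_code b \<and> k = Suc j \<and> a j = Suc b) \<or>
     (\<exists>p<r. \<exists>q<r. r = union_code p q \<and> (seg T j k p \<or> seg T j k q)) \<or>
     (\<exists>p<r. \<exists>q<r. \<exists>l<Suc k. r = concat_code p q \<and> seg T j l p \<and> seg T l k q) \<or>
     (\<exists>p<r. r = star_code p \<and> (j = k \<or> (\<exists>l<Suc k. j < l \<and> seg T j l p \<and> seg T l k r)))"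

definition match_table :: "(nat \<Rightarrow> nat) \<Rightarrow> nat \<Rightarrow> nat \<Rightarrow> nat \<Rightarrow> bool" where
  "match_table a n r T \<longleftrightarrow>
     (\<forall>j<Suc n. \<forall>k<Suc n. \<forall>s<Suc r. seg T j k s \<longrightarrow> seg_justified a T j k s) \<and> seg T 0 n r"

lemma map_upt_append: "j \<le> l \<Longrightarrow> l \<le> k \<Longrightarrow> map f [j..<l] @ map f [l..<k] = map f [j..<k]"
  by (metis le_Suc_ex map_append upt_add_eq_append)

lemma map_upt_eq_append:
  assumes "map f [j..<k] = u @ v" "j \<le> k"
  obtains l where "j \<le> l" "l \<le> k" "u = map f [j..<l]" "v = map f [l..<k]" "length u = l - j"
proof
  have len: "length u + length v = k - j"
    using assms(1) by (metis length_append length_map length_upt)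
  show "j \<le> j + length u" "j + length u \<le> k" "length u = j + length u - j"
    using len assms(2) by auto
  have "u = take (length u) (map f [j..<k])" "v = drop (length u) (map f [j..<k])"
    by (simp_all add: assms(1))
  then show "u = map f [j..<j + length u]" "v = map f [j + length u..<k]"
    using len assms(2) by (simp_all add: take_map drop_map add.commute)
qed

lemma lang_Star_Nil: "[] \<in> lang (Star r)"
  by (auto intro: exI[of _ "[]"])

lemma lang_Star_append: "u \<in> lang r \<Longrightarrow> v \<in> lang (Star r) \<Longrightarrow> u @ v \<in> lang (Star r)"
  by (auto, metis concat.simps(2) insert_subset list.simps(15))

text \<open>Empty factors in front are skipped; this supplies the condition \<open>j < l\<close> of
  the star clause.\<close>

lemma lang_StarE:
  assumes "w \<in> lang (Star r)" "w \<noteq> []"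
  obtains u v where "w = u @ v" "u \<noteq> []" "u \<in> lang r" "v \<in> lang (Star r)"
proof -
  obtain us where "w = concat us" "set us \<subseteq> lang r"
    using assms(1) by auto
  then have "\<exists>u v. w = u @ v \<and> u \<noteq> [] \<and> u \<in> lang r \<and> v \<in> lang (Star r)"
    using assms(2)
  proof (induction us arbitrary: w)
    case (Cons u us)
    show ?case
    proof (cases "u = []")
      case False
      then show ?thesis
        using Cons.prems by (intro exI[of _ u] exI[of _ "concat us"]) auto
    qed (use Cons in auto)
  qed simp
  then show thesis
    using that by blast
qed

lemma match_table_sound:
  assumes "match_table a n (rexp_encode E) T"
  shows "map (\<lambda>j. a j - 1) [0..<n] \<in> lang E"
proof -
  let ?w = "\<lambda>j k. map (\<lambda>j. a j - 1) [j..<k]"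
  have just: "seg_justified a T j k (rexp_encode r)"
    if "seg T j k (rexp_encode r)" "rexp_encode r \<le> rexp_encode E" "j \<le> n" "k \<le> n" for j k r
    using assms that by (simp add: match_table_def less_Suc_eq_le)
  \<comment> \<open>The inequality belongs to the claim, because a table may list arbitrary
    triples.\<close>
  have "j \<le> k \<and> ?w j k \<in> lang r"
    if "seg T j k (rexp_encode r)" "rexp_encode r \<le> rexp_encode E" "j \<le> n" "k \<le> n" for j k r
    using that
  proof (induction r arbitrary: j k)
    case Eps
    then show ?case
      using just[OF Eps] by (simp add: seg_justified_def)
  next
    case (Letter b)
    then show ?case
      using just[OF Letter] by (auto simp: seg_justified_def)
  next
    case (Union r s)
    have "rexp_encode r \<le> rexp_encode E" "rexp_encode s \<le> rexp_encode E"
      using Union.prems(2) code_less(2)[of "rexp_encode r" "rexp_encode s"]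
        code_less(3)[of "rexp_encode s" "rexp_encode r"] by auto
    moreover have "seg T j k (rexp_encode r) \<or> seg T j k (rexp_encode s)"
      using just[OF Union.prems] by (auto simp: seg_justified_def)
    ultimately show ?case
      using Union.IH Union.prems(3,4) by auto
  next
    case (Concat r s)
    have "rexp_encode r \<le> rexp_encode E" "rexp_encode s \<le> rexp_encode E"
      using Concat.prems(2) code_less(4)[of "rexp_encode r" "rexp_encode s"]
        code_less(5)[of "rexp_encode s" "rexp_encode r"] by auto
    moreover obtain l where "l \<le> k" "seg T j l (rexp_encode r)" "seg T l k (rexp_encode s)"
      using just[OF Concat.prems] by (auto simp: seg_justified_def less_Suc_eq_le)
    ultimately have l: "j \<le> l" "l \<le> k" "?w j l \<in> lang r" "?w l k \<in> lang s"
      using Concat.IH(1)[of j l] Concat.IH(2)[of l k] Concat.prems(3,4) by auto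
    then show ?case
      using map_upt_append[OF l(1,2), symmetric] by auto
  next
    case (Star r)
    have r: "rexp_encode r \<le> rexp_encode E"
      using Star.prems(2) code_less(6)[of "rexp_encode r"] by auto
    show ?case
      using Star.prems
    \<comment> \<open>The tail of a star is an entry for the same star, so the segment shrinks
      instead of the expression.\<close>
    proof (induction "k - j" arbitrary: j rule: less_induct)
      case less
      consider "j = k" | l where "l \<le> k" "j < l" "seg T j l (rexp_encode r)"
          "seg T l k (rexp_encode (Star r))"
        using just[OF less.prems] by (auto simp: seg_justified_def less_Suc_eq_le)
      then show ?case
      proof cases
        case 1
        then show ?thesis
          using lang_Star_Nil by auto
      next
        case (2 l)
        have "?w j l \<in> lang r"
          using Star.IH[OF 2(3) r] 2(1) less.prems by simp
        moreover have "?w l k \<in> lang (Star r)"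
          using less.hyps[of l] 2 less.prems by simp
        ultimately have "?w j l @ ?w l k \<in> lang (Star r)"
          by (rule lang_Star_append)
        moreover have "?w j l @ ?w l k = ?w j k"
          using 2 by (intro map_upt_append) auto
        ultimately show ?thesis
          using 2 by auto
      qed
    qed
  qed
  from this[of 0 n E] show ?thesis
    using assms by (simp add: match_table_def)
qed

lemma match_table_complete:
  assumes X: "map X [0..<n] \<in> lang E" and a: "\<And>j. j < n \<Longrightarrow> a j = Suc (X j)"
  shows "\<exists>T. match_table a n (rexp_encode E) T"
proof -
  define S where "S = (\<lambda>(j, k, r). prod_encode (j, prod_encode (k, r))) `
    {(j, k, c). j \<le> n \<and> k \<le> n \<and> c \<le> rexp_encode E \<and>
      j \<le> k \<and> (\<exists>r. rexp_encode r = c \<and> map X [j..<k] \<in> lang r)}"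
  have "finite S"
    unfolding S_def
    by (rule finite_imageI, rule finite_subset[of _ "{..n} \<times> {..n} \<times> {..rexp_encode E}"]) auto
  from ex_lookup_set[OF this] obtain T where T: "\<forall>a. lookup T a \<noteq> 0 \<longleftrightarrow> a \<in> S" ..
  have seg: "seg T j k (rexp_encode r) \<longleftrightarrow>
      j \<le> n \<and> k \<le> n \<and> rexp_encode r \<le> rexp_encode E \<and> j \<le> k \<and> map X [j..<k] \<in> lang r" for j k r
    unfolding seg_def T[rule_format] by (auto simp: S_def image_iff rexp_encode_inject)
  have "seg_justified a T j k (rexp_encode r)" if s: "seg T j k (rexp_encode r)" for j k r
  proof -
    have le: "j \<le> n" "k \<le> n" "rexp_encode r \<le> rexp_encode E" "j \<le> k" and w: "map X [j..<k] \<in> lang r"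
      using s seg by auto
    show ?thesis
    proof (cases r)
      case Eps
      then show ?thesis
        using le w by (auto simp: seg_justified_def)
    next
      case (Letter b)
      have eq: "map X [j..<k] = [b]"
        using w Letter by simp
      have "k = Suc j"
        using arg_cong[OF eq, of length] le(4) by simp
      moreover from this have "b = X j"
        using eq by simp
      ultimately show ?thesis
        using Letter a le code_less(1)[of b] by (auto simp: seg_justified_def)
    next
      case (Union s t)
      have "rexp_encode s < rexp_encode r" "rexp_encode t < rexp_encode r"
        using Union code_less(2,3) by auto
      moreover from this have "seg T j k (rexp_encode s) \<or> seg T j k (rexp_encode t)"
        using le w Union by (auto simp: seg)
      ultimately show ?thesis
        using Union unfolding seg_justified_def by auto
    next
      case (Concat s t)
      have less: "rexp_encode s < rexp_encode r" "rexp_encode t < rexp_encode r"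
        using Concat code_less(4,5) by auto
      obtain u v where uv: "map X [j..<k] = u @ v" "u \<in> lang s" "v \<in> lang t"
        using w Concat by auto
      obtain l where l: "j \<le> l" "l \<le> k" "u = map X [j..<l]" "v = map X [l..<k]"
        using uv(1) le(4) by (rule map_upt_eq_append)
      have "seg T j l (rexp_encode s)" "seg T l k (rexp_encode t)"
        using less le l uv by (auto simp: seg)
      moreover have "l < Suc k"
        using l by simp
      ultimately show ?thesis
        using less Concat unfolding seg_justified_def by auto
    next
      case (Star s)
      have less: "rexp_encode s < rexp_encode r"
        using Star code_less(6) by auto
      show ?thesis
      proof (cases "j = k")
        case True
        then show ?thesis
          using Star less by (auto simp: seg_justified_def)
      next
        case False
        then have "map X [j..<k] \<noteq> []"
          using le(4) by simp
        then obtain u v where uv: "map X [j..<k] = u @ v" "u \<noteq> []" "u \<in> lang s" "v \<in> lang r"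
          using w Star lang_StarE by metis
        obtain l where l: "j \<le> l" "l \<le> k" "u = map X [j..<l]" "v = map X [l..<k]"
          using uv(1) le(4) by (rule map_upt_eq_append)
        have "seg T j l (rexp_encode s)" "seg T l k (rexp_encode r)"
          using less le l uv by (auto simp: seg)
        moreover have "l < Suc k" "j < l"
          using l uv(2) by auto
        ultimately show ?thesis
          using less Star unfolding seg_justified_def by auto
      qed
    qed
  qed
  then have "\<forall>j<Suc n. \<forall>k<Suc n. \<forall>s<Suc (rexp_encode E). seg T j k s \<longrightarrow> seg_justified a T j k s"
    using ex_rexp_encode by metis
  moreover have "seg T 0 n (rexp_encode E)"
    using X by (simp add: seg)
  ultimately show ?thesis
    by (auto simp: match_table_def)
qed

text \<open>Each row and each column has its own table. A bounded universal quantifier over an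
  enumerable predicate stays enumerable, so the family of tables never has to be coded as one
  number.\<close>

lemma crossword_problem_iff_tables:
  "x \<in> crossword_problem \<longleftrightarrow>
     (\<exists>N. (\<forall>r<Suc x. lookup N r \<noteq> 0 \<longrightarrow> nn_justified N r) \<and> lookup N x \<noteq> 0) \<and>
     (\<exists>m n D. 1 \<le> m \<and> 1 \<le> n \<and>
        (\<forall>i<m. \<exists>T. match_table (\<lambda>j. lookup D (prod_encode (i, j))) n x T) \<and>
        (\<forall>j<n. \<exists>T. match_table (\<lambda>i. lookup D (prod_encode (i, j))) m x T))"
  (is "_ \<longleftrightarrow> _ \<and> ?R")
proof -
  obtain E where x: "x = rexp_encode E"
    using ex_rexp_encode by metis
  have "?R \<longleftrightarrow> (\<exists>m n X. 1 \<le> m \<and> 1 \<le> n \<and> (\<forall>i<m. row n X i \<in> lang E) \<and> (\<forall>j<n. column m X j \<in> lang E))"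
    (is "_ \<longleftrightarrow> ?X")
  proof
    assume ?R
    then obtain m n D where "1 \<le> m" "1 \<le> n"
      "\<forall>i<m. \<exists>T. match_table (\<lambda>j. lookup D (prod_encode (i, j))) n x T"
      "\<forall>j<n. \<exists>T. match_table (\<lambda>i. lookup D (prod_encode (i, j))) m x T"
      by blast
    then show ?X
      unfolding x row_def column_def using match_table_sound
      by (intro exI[of _ m] exI[of _ n] exI[of _ "\<lambda>i j. lookup D (prod_encode (i, j)) - 1"]) blast
  next
    assume ?X
    then obtain m n X where X: "1 \<le> m" "1 \<le> n" "\<forall>i<m. row n X i \<in> lang E"
      "\<forall>j<n. column m X j \<in> lang E"
      by blast
    define f where "f c = (if pfst c < m \<and> psnd c < n then Some (X (pfst c) (psnd c)) else None)" for c
    have "dom f \<subseteq> prod_encode ` ({..<m} \<times> {..<n})"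
    proof
      fix c
      assume "c \<in> dom f"
      then show "c \<in> prod_encode ` ({..<m} \<times> {..<n})"
        by (intro image_eqI[of _ _ "(pfst c, psnd c)"]) (auto simp: f_def split: if_splits)
    qed
    then have "finite (dom f)"
      by (rule finite_subset) auto
    from ex_lookup[OF this] obtain D where D: "\<forall>a. lookup D a = (case f a of None \<Rightarrow> 0 | Some v \<Rightarrow> Suc v)" ..
    have D: "lookup D (prod_encode (i, j)) = Suc (X i j)" if "i < m" "j < n" for i j
      using D that by (simp add: f_def)
    have "\<exists>T. match_table (\<lambda>j. lookup D (prod_encode (i, j))) n x T" if "i < m" for i
      unfolding x by (rule match_table_complete[of "X i"]) (use X D that in \<open>auto simp: row_def\<close>)
    moreover have "\<exists>T. match_table (\<lambda>i. lookup D (prod_encode (i, j))) m x T" if "j < n" for j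
      unfolding x
      by (rule match_table_complete[of "\<lambda>i. X i j"]) (use X D that in \<open>auto simp: column_def\<close>)
    ultimately show ?R
      using X(1,2) by blast
  qed
  then show ?thesis
    unfolding x crossword_problem_iff positive_iff by blast
qed

lemma re_pred_crossword_problem: "re_pred 1 (\<lambda>xs. hd xs \<in> crossword_problem)"
  unfolding crossword_problem_iff_tables match_table_def seg_justified_def seg_def nn_justified_def
    One_nat_def
  by (intro re_pred_conj re_pred_ex re_pred_ball; (rule re_predI)?)
    (intro computable_intros computable_lookup computable_codes
      computable_var[THEN computable_tl] computable_var[THEN computable_tl, THEN computable_tl])+

section \<open>From two languages to one\<close>

definition has_crossword :: "'a rexp \<Rightarrow> 'a rexp \<Rightarrow> bool" where
  "has_crossword R C \<longleftrightarrow>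
     (\<exists>m n X. 1 \<le> m \<and> 1 \<le> n \<and> (\<forall>i<m. row n X i \<in> lang R) \<and> (\<forall>j<n. column m X j \<in> lang C))"

lemma lang_map_rexp: "lang (map_rexp f r) = map f ` lang r"
proof (induction r)
  case (Concat r s)
  show ?case
    by (auto simp: Concat image_iff) (metis map_append)+
next
  case (Star r)
  show ?case
  proof (intro equalityI subsetI)
    fix w
    assume "w \<in> lang (map_rexp f (Star r))"
    then obtain us where us: "w = concat us" "set us \<subseteq> map f ` lang r"
      by (auto simp: Star)
    then have "us \<in> map (map f) ` lists (lang r)"
      by (auto simp: lists_image[symmetric])
    then obtain vs where "us = map (map f) vs" "set vs \<subseteq> lang r"
      by auto
    then show "w \<in> map f ` lang (Star r)"
      using us(1) by (intro image_eqI[of _ _ "concat vs"]) (auto simp: map_concat)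
  next
    fix w
    assume "w \<in> map f ` lang (Star r)"
    then obtain us where us: "w = map f (concat us)" "set us \<subseteq> lang r"
      by auto
    then have "w = concat (map (map f) us)" "set (map (map f) us) \<subseteq> map f ` lang r"
      by (auto simp: map_concat)
    then show "w \<in> lang (map_rexp f (Star r))"
      by (auto simp: Star intro!: exI[of _ "map (map f) us"])
  qed
qed auto

lemma positive_map_rexp: "positive (map_rexp f r) \<longleftrightarrow> positive r"
  by (auto simp: positive_def lang_map_rexp)

lemma has_crossword_map_rexp:
  assumes "inj f"
  shows "has_crossword (map_rexp f R) (map_rexp f C) \<longleftrightarrow> has_crossword R C"
proof
  assume "has_crossword (map_rexp f R) (map_rexp f C)"
  then obtain m n X where X: "1 \<le> m" "1 \<le> n" "\<forall>i<m. row n X i \<in> map f ` lang R"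
    "\<forall>j<n. column m X j \<in> map f ` lang C"
    unfolding has_crossword_def lang_map_rexp by blast
  have inv: "map (inv f) w \<in> L" if "w \<in> map f ` L" for w L
    using that assms by (auto simp: comp_def)
  have "row n (\<lambda>i j. inv f (X i j)) i \<in> lang R" if "i < m" for i
    using inv[of "row n X i"] X(3) that by (auto simp: row_def comp_def)
  moreover have "column m (\<lambda>i j. inv f (X i j)) j \<in> lang C" if "j < n" for j
    using inv[of "column m X j"] X(4) that by (auto simp: column_def comp_def)
  ultimately show "has_crossword R C"
    unfolding has_crossword_def using X(1,2) by blast
next
  assume "has_crossword R C"
  then obtain m n X where X: "1 \<le> m" "1 \<le> n" "\<forall>i<m. row n X i \<in> lang R"
    "\<forall>j<n. column m X j \<in> lang C"
    unfolding has_crossword_def by blast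
  have "row n (\<lambda>i j. f (X i j)) i = map f (row n X i)" for i
    by (simp add: row_def)
  moreover have "column m (\<lambda>i j. f (X i j)) j = map f (column m X j)" for j
    by (simp add: column_def)
  ultimately show "has_crossword (map_rexp f R) (map_rexp f C)"
    unfolding has_crossword_def lang_map_rexp using X by (metis imageI)
qed

section \<open>Framed arrays\<close>

datatype 'a framed = TopLeft | Top | TopRight | LeftEdge | Inner 'a | RightEdge
  | BottomLeft | Bottom | BottomRight

text \<open>The inner block is nonempty, in accordance with arrays that have at least one row and
  one column. Together with positivity of \<open>R\<close> and \<open>C\<close> this gives every
  line of a framed array length at least 3.\<close>

definition border :: "'a \<Rightarrow> 'a \<Rightarrow> 'a \<Rightarrow> 'a rexp" where
  "border a b c = Concat (Letter a) (Concat (Concat (Letter b) (Star (Letter b))) (Letter c))"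

text \<open>
  The languages of the rows and of the columns of a framed array are merged into one. Which
  lines are rows is forced by the corners: if the first row and the first column were both
  top edges (or both left edges), then the last cell of the second line would have to be both
  \<open>Bottom\<close> and \<open>RightEdge\<close>. Hence a solution is a framed array or its transpose.
\<close>

definition frame :: "'a rexp \<Rightarrow> 'a rexp \<Rightarrow> 'a framed rexp" where
  "frame R C =
     Union (Union (border TopLeft Top TopRight) (border BottomLeft Bottom BottomRight))
    (Union (Union (border TopLeft LeftEdge BottomLeft) (border TopRight RightEdge BottomRight))
    (Union (Concat (Letter LeftEdge) (Concat (map_rexp Inner R) (Letter RightEdge)))
      (Concat (Letter Top) (Concat (map_rexp Inner C) (Letter Bottom)))))"

lemma lang_Star_Letter: "lang (Star (Letter a)) = {replicate k a | k. True}"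
proof (intro equalityI subsetI)
  fix w
  assume "w \<in> lang (Star (Letter a))"
  then obtain us where "w = concat us" "set us \<subseteq> {[a]}"
    by auto
  then have "w = replicate (length us) a"
    by (induction us arbitrary: w) auto
  then show "w \<in> {replicate k a | k. True}"
    by blast
next
  fix w
  assume "w \<in> {replicate k a | k. True}"
  then obtain k where "w = replicate k a"
    by blast
  then have "w = concat (replicate k [a])" "set (replicate k [a]) \<subseteq> {[a]}"
    by (induction k arbitrary: w) auto
  then show "w \<in> lang (Star (Letter a))"
    by (auto intro!: exI[of _ "replicate k [a]"])
qed

lemma lang_border: "lang (border a b c) = {a # replicate (Suc k) b @ [c] | k. True}"
proof -
  have "lang (border a b c) = {[a] @ ([b] @ v) @ [c] | v. v \<in> lang (Star (Letter b))}"
    unfolding border_def by (auto simp del: lang.simps(5))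
  then show ?thesis
    unfolding lang_Star_Letter by auto
qed

lemma map_upt_add_2: "map f [0..<n + 2] = f 0 # map (\<lambda>k. f (Suc k)) [0..<n] @ [f (Suc n)]"
proof (induction n)
  case 0
  show ?case
    by (simp add: numeral_2_eq_2)
next
  case (Suc n)
  have "map f [0..<Suc n + 2] = map f [0..<n + 2] @ [f (Suc (Suc n))]"
    by simp
  also have "\<dots> = f 0 # map (\<lambda>k. f (Suc k)) [0..<Suc n] @ [f (Suc (Suc n))]"
    unfolding Suc.IH by simp
  finally show ?case .
qed

lemma map_upt_eq_Cons_snoc:
  "map f [0..<n] = a # v @ [b] \<longleftrightarrow>
     n = length v + 2 \<and> f 0 = a \<and> f (Suc (length v)) = b \<and> (\<forall>k<length v. f (Suc k) = v ! k)"
proof (cases "n = length v + 2")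
  case True
  have "map (\<lambda>k. f (Suc k)) [0..<length v] = v \<longleftrightarrow> (\<forall>k<length v. f (Suc k) = v ! k)"
    by (subst list_eq_iff_nth_eq) simp
  then show ?thesis
    unfolding True map_upt_add_2 list.inject append1_eq_conv by blast
next
  case False
  have "map f [0..<n] \<noteq> a # v @ [b]"
  proof
    assume "map f [0..<n] = a # v @ [b]"
    from arg_cong[OF this, of length] False show False
      by simp
  qed
  with False show ?thesis
    by blast
qed

lemma map_upt_in_border:
  "map f [0..<n] \<in> lang (border a b c) \<longleftrightarrow>
     3 \<le> n \<and> f 0 = a \<and> f (n - 1) = c \<and> (\<forall>k. 0 < k \<and> k < n - 1 \<longrightarrow> f k = b)"
proof -
  have "map f [0..<n] \<in> lang (border a b c) \<longleftrightarrow>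
      (\<exists>k. n = k + 3 \<and> f 0 = a \<and> f (Suc (Suc k)) = c \<and> (\<forall>i<Suc k. f (Suc i) = b))"
    unfolding lang_border using map_upt_eq_Cons_snoc[of f n a "replicate (Suc k) b" c for k]
    by (auto simp del: replicate_Suc simp: numeral_3_eq_3)
  also have "\<dots> \<longleftrightarrow> 3 \<le> n \<and> f 0 = a \<and> f (n - 1) = c \<and> (\<forall>k. 0 < k \<and> k < n - 1 \<longrightarrow> f k = b)"
  proof (cases "3 \<le> n")
    case True
    then obtain k where n: "n = k + 3"
      using le_Suc_ex by (metis add.commute)
    have "(\<forall>i<Suc k. f (Suc i) = b) \<longleftrightarrow> (\<forall>i. 0 < i \<and> i < n - 1 \<longrightarrow> f i = b)"
      unfolding n by (auto simp: gr0_conv_Suc)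
    then show ?thesis
      by (auto simp: n numeral_3_eq_3)
  qed auto
  finally show ?thesis .
qed

lemma map_upt_in_framed:
  assumes "[] \<notin> lang R"
  shows "map f [0..<n] \<in> lang (Concat (Letter a) (Concat (map_rexp Inner R) (Letter b))) \<longleftrightarrow>
     3 \<le> n \<and> f 0 = a \<and> f (n - 1) = b \<and>
     (\<exists>u\<in>lang R. length u = n - 2 \<and> (\<forall>k<n - 2. f (Suc k) = Inner (u ! k)))"
proof -
  have "map f [0..<n] \<in> lang (Concat (Letter a) (Concat (map_rexp Inner R) (Letter b))) \<longleftrightarrow>
      (\<exists>u\<in>lang R. map f [0..<n] = a # map Inner u @ [b])"
    by (auto simp: lang_map_rexp)
  also have "\<dots> \<longleftrightarrow> 3 \<le> n \<and> f 0 = a \<and> f (n - 1) = b \<and>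
     (\<exists>u\<in>lang R. length u = n - 2 \<and> (\<forall>k<n - 2. f (Suc k) = Inner (u ! k)))"
  proof -
    have "map f [0..<n] = a # map Inner u @ [b] \<longleftrightarrow> 3 \<le> n \<and> f 0 = a \<and> f (n - 1) = b \<and>
        length u = n - 2 \<and> (\<forall>k<n - 2. f (Suc k) = Inner (u ! k))" if "u \<in> lang R" for u
    proof -
      have pos: "0 < length u"
        using that assms by (cases u) simp_all
      show ?thesis
      proof (cases "n = length u + 2")
        case True
        then have n: "3 \<le> n" "n - 1 = Suc (length u)" "n - 2 = length u"
          using pos by arith+
        have "(\<forall>k<length u. f (Suc k) = map Inner u ! k) \<longleftrightarrow> (\<forall>k<length u. f (Suc k) = Inner (u ! k))"
          by (metis nth_map)
        with True n(1) show ?thesis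
          unfolding map_upt_eq_Cons_snoc length_map n(2,3) by blast
      next
        case False
        then have "\<not> (3 \<le> n \<and> length u = n - 2)"
          by linarith
        with False show ?thesis
          unfolding map_upt_eq_Cons_snoc length_map by blast
      qed
    qed
    then have "(\<exists>u\<in>lang R. map f [0..<n] = a # map Inner u @ [b]) \<longleftrightarrow>
        (\<exists>u\<in>lang R. 3 \<le> n \<and> f 0 = a \<and> f (n - 1) = b \<and>
          (length u = n - 2 \<and> (\<forall>k<n - 2. f (Suc k) = Inner (u ! k))))"
      by (rule bex_cong[OF refl])
    then show ?thesis
      unfolding bex_simps(2) by blast
  qed
  finally show ?thesis .
qed

lemma map_upt_in_frame:
  assumes "[] \<notin> lang R" "[] \<notin> lang C"
  shows "map f [0..<n] \<in> lang (frame R C) \<longleftrightarrow> 3 \<le> n \<and>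
    (f 0 = TopLeft \<and> f (n - 1) = TopRight \<and> (\<forall>k. 0 < k \<and> k < n - 1 \<longrightarrow> f k = Top) \<or>
     f 0 = BottomLeft \<and> f (n - 1) = BottomRight \<and> (\<forall>k. 0 < k \<and> k < n - 1 \<longrightarrow> f k = Bottom) \<or>
     f 0 = TopLeft \<and> f (n - 1) = BottomLeft \<and> (\<forall>k. 0 < k \<and> k < n - 1 \<longrightarrow> f k = LeftEdge) \<or>
     f 0 = TopRight \<and> f (n - 1) = BottomRight \<and> (\<forall>k. 0 < k \<and> k < n - 1 \<longrightarrow> f k = RightEdge) \<or>
     f 0 = LeftEdge \<and> f (n - 1) = RightEdge \<and>
       (\<exists>u\<in>lang R. length u = n - 2 \<and> (\<forall>k<n - 2. f (Suc k) = Inner (u ! k))) \<or>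
     f 0 = Top \<and> f (n - 1) = Bottom \<and>
       (\<exists>u\<in>lang C. length u = n - 2 \<and> (\<forall>k<n - 2. f (Suc k) = Inner (u ! k))))"
  unfolding frame_def lang.simps(3) Un_iff map_upt_in_border map_upt_in_framed[OF assms(1)]
    map_upt_in_framed[OF assms(2)]
  by blast

lemma positive_frame: "positive (frame R C)"
  unfolding positive_def frame_def by (simp add: lang_border del: lang.simps(5))

lemma frame_crossword:
  assumes pos: "[] \<notin> lang R" "[] \<notin> lang C" and "has_crossword R C"
  shows "has_crossword (frame R C) (frame R C)"
proof -
  obtain m n X where X: "1 \<le> m" "1 \<le> n" "\<forall>i<m. row n X i \<in> lang R"
    "\<forall>j<n. column m X j \<in> lang C"
    using assms(3) unfolding has_crossword_def by blast
  define Y where "Y i j =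
    (if i = 0 then if j = 0 then TopLeft else if j = n + 1 then TopRight else Top
     else if i = m + 1 then if j = 0 then BottomLeft else if j = n + 1 then BottomRight else Bottom
     else if j = 0 then LeftEdge else if j = n + 1 then RightEdge else Inner (X (i - 1) (j - 1)))"
    for i j
  have "row (n + 2) Y i \<in> lang (frame R C)" if im: "i < m + 2" for i
  proof -
    consider "i = 0" | "i = m + 1" | k where "i = Suc k" "k < m"
      using im by (cases i; cases "i = m + 1") auto
    then show ?thesis
    proof cases
      case (3 k)
      then have "\<exists>u\<in>lang R. length u = n \<and> (\<forall>j<n. Y i (Suc j) = Inner (u ! j))"
        using X(3) by (intro bexI[of _ "row n X k"]) (auto simp: Y_def row_def)
      then show ?thesis
        unfolding row_def map_upt_in_frame[OF pos] using X(2) 3 by (auto simp: Y_def)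
    qed (use X(1,2) in \<open>unfold row_def map_upt_in_frame[OF pos], auto simp: Y_def\<close>)
  qed
  moreover have "column (m + 2) Y j \<in> lang (frame R C)" if jn: "j < n + 2" for j
  proof -
    consider "j = 0" | "j = n + 1" | k where "j = Suc k" "k < n"
      using jn by (cases j; cases "j = n + 1") auto
    then show ?thesis
    proof cases
      case (3 k)
      then have "\<exists>u\<in>lang C. length u = m \<and> (\<forall>i<m. Y (Suc i) j = Inner (u ! i))"
        using X(4) by (intro bexI[of _ "column m X k"]) (auto simp: Y_def column_def)
      then show ?thesis
        unfolding column_def map_upt_in_frame[OF pos] using X(1) 3 by (auto simp: Y_def)
    qed (use X(1,2) in \<open>unfold column_def map_upt_in_frame[OF pos], auto simp: Y_def\<close>)
  qed
  ultimately show ?thesis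
    unfolding has_crossword_def by (intro exI[of _ "m + 2"] exI[of _ "n + 2"] exI[of _ Y]) auto
qed

text \<open>An inner row starts with \<open>LeftEdge\<close> and an inner column with
  \<open>Top\<close>, and each of these symbols opens a single alternative of \<open>frame\<close>,
  the one built from \<open>R\<close> or from \<open>C\<close>. The partial \<open>case\<close> is
  read only at inner cells, all of which have the form \<open>Inner\<close>.\<close>

lemma framed_array_crossword:
  assumes pos: "[] \<notin> lang R" "[] \<notin> lang C"
    and mn: "3 \<le> m" "3 \<le> n"
    and rows: "\<And>i. i < m \<Longrightarrow> map (X i) [0..<n] \<in> lang (frame R C)"
    and cols: "\<And>j. j < n \<Longrightarrow> map (\<lambda>i. X i j) [0..<m] \<in> lang (frame R C)"
    and top: "\<And>j. 0 < j \<Longrightarrow> j < n - 1 \<Longrightarrow> X 0 j = Top"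
    and left: "\<And>i. 0 < i \<Longrightarrow> i < m - 1 \<Longrightarrow> X i 0 = LeftEdge"
  shows "has_crossword R C"
proof -
  define Y where "Y i j = (case X (Suc i) (Suc j) of Inner a \<Rightarrow> a)" for i j
  have "row (n - 2) Y i \<in> lang R" if "i < m - 2" for i
  proof -
    have "X (Suc i) 0 = LeftEdge" "map (X (Suc i)) [0..<n] \<in> lang (frame R C)"
      using left[of "Suc i"] rows[of "Suc i"] that by auto
    then obtain u where u: "u \<in> lang R" "length u = n - 2" "\<forall>k<n - 2. X (Suc i) (Suc k) = Inner (u ! k)"
      unfolding map_upt_in_frame[OF pos] by auto
    then have "row (n - 2) Y i = u"
      by (intro nth_equalityI) (auto simp: row_def Y_def)
    with u(1) show ?thesis
      by simp
  qed
  moreover have "column (m - 2) Y j \<in> lang C" if "j < n - 2" for j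
  proof -
    have "X 0 (Suc j) = Top" "map (\<lambda>i. X i (Suc j)) [0..<m] \<in> lang (frame R C)"
      using top[of "Suc j"] cols[of "Suc j"] that by auto
    then obtain u where u: "u \<in> lang C" "length u = m - 2" "\<forall>k<m - 2. X (Suc k) (Suc j) = Inner (u ! k)"
      unfolding map_upt_in_frame[OF pos] by auto
    then have "column (m - 2) Y j = u"
      by (intro nth_equalityI) (auto simp: column_def Y_def)
    with u(1) show ?thesis
      by simp
  qed
  ultimately show ?thesis
    unfolding has_crossword_def using mn
    by (intro exI[of _ "m - 2"] exI[of _ "n - 2"] exI[of _ Y]) auto
qed

lemma has_crossword_frame:
  assumes pos: "[] \<notin> lang R" "[] \<notin> lang C"
  shows "has_crossword (frame R C) (frame R C) \<longleftrightarrow> has_crossword R C"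
proof
  assume "has_crossword (frame R C) (frame R C)"
  then obtain m n X where X: "1 \<le> m" "1 \<le> n"
    and rows: "\<And>i. i < m \<Longrightarrow> map (X i) [0..<n] \<in> lang (frame R C)"
    and cols: "\<And>j. j < n \<Longrightarrow> map (\<lambda>i. X i j) [0..<m] \<in> lang (frame R C)"
    unfolding has_crossword_def row_def column_def by auto
  note frame = map_upt_in_frame[OF pos]
  have mn: "3 \<le> m" "3 \<le> n"
    using rows[of 0] cols[of 0] X unfolding frame by auto
  have first: "Y 0 \<in> {TopLeft, BottomLeft, TopRight, LeftEdge, Top}"
    if "map Y [0..<k] \<in> lang (frame R C)" for Y k
    using that unfolding frame by auto
  \<comment> \<open>Only the two borders that begin with \<open>TopLeft\<close> continue with a
    symbol that can also begin a word.\<close>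
  have second: "Y 1 \<in> {Bottom, RightEdge} \<union> range Inner"
    if "map Y [0..<k] \<in> lang (frame R C)" "Y 0 \<noteq> TopLeft" for Y k
    using that unfolding frame by (auto simp: numeral_3_eq_3)
  \<comment> \<open>\<open>X 0 1\<close> is the second cell of the first row and the first cell of
    the second column; without \<open>TopLeft\<close> in the corner, the two sets of possible values
    are disjoint.\<close>
  have corner: "X 0 0 = TopLeft"
  proof (rule ccontr)
    assume "X 0 0 \<noteq> TopLeft"
    then have "X 0 1 \<in> {Bottom, RightEdge} \<union> range Inner"
      using second[OF rows[of 0]] mn by simp
    moreover have "X 0 1 \<in> {TopLeft, BottomLeft, TopRight, LeftEdge, Top}"
      using first[OF cols[of 1]] mn by simp
    ultimately show False
      by auto
  qed
  have edge: "Y (k - 1) = TopRight \<and> (\<forall>i. 0 < i \<and> i < k - 1 \<longrightarrow> Y i = Top) \<or>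
      Y (k - 1) = BottomLeft \<and> (\<forall>i. 0 < i \<and> i < k - 1 \<longrightarrow> Y i = LeftEdge)"
    if "map Y [0..<k] \<in> lang (frame R C)" "Y 0 = TopLeft" for Y k
    using that unfolding frame by auto
  have last: "Y 0 = Top \<Longrightarrow> Y (k - 1) = Bottom" "Y 0 = LeftEdge \<Longrightarrow> Y (k - 1) = RightEdge"
    "Y 0 = TopRight \<Longrightarrow> Y 1 = RightEdge" "Y 0 = BottomLeft \<Longrightarrow> Y 1 = Bottom"
    if "map Y [0..<k] \<in> lang (frame R C)" for Y k
    using that unfolding frame by (auto simp: numeral_3_eq_3)
  have one: "1 < m" "0 < m - 1" "1 < m - 1" "n - 1 < n" "1 < n - 1" "0 < n" "0 < m"
    using mn by auto
  \<comment> \<open>The first two cases are a framed array and its transpose. In the other two the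
    first row and the first column carry the same border, which is contradictory.\<close>
  consider "\<forall>j. 0 < j \<and> j < n - 1 \<longrightarrow> X 0 j = Top" "\<forall>i. 0 < i \<and> i < m - 1 \<longrightarrow> X i 0 = LeftEdge"
    | "\<forall>j. 0 < j \<and> j < n - 1 \<longrightarrow> X 0 j = LeftEdge" "\<forall>i. 0 < i \<and> i < m - 1 \<longrightarrow> X i 0 = Top"
    | "X 0 (n - 1) = TopRight" "X 1 0 = Top"
    | "X 0 (n - 1) = BottomLeft" "X 1 0 = LeftEdge"
    using edge[OF rows[OF one(7)] corner] edge[OF cols[OF one(6)] corner] one by auto
  then show "has_crossword R C"
  proof cases
    case 1
    show ?thesis
      by (rule framed_array_crossword[OF pos mn rows cols]) (use 1 in auto)
  next
    case 2
    show ?thesis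
      by (rule framed_array_crossword[OF pos mn(2,1), of "\<lambda>i j. X j i"]) (use 2 rows cols in auto)
  next
    case 3
    \<comment> \<open>This cell ends a row that begins with \<open>Top\<close> and is second in a
      column that begins with \<open>TopRight\<close>.\<close>
    have "X 1 (n - 1) = RightEdge" "X 1 (n - 1) = Bottom"
      using last(3)[OF cols[OF one(4)]] last(1)[OF rows[OF one(1)]] 3 by auto
    then show ?thesis
      by simp
  next
    case 4
    have "X 1 (n - 1) = Bottom" "X 1 (n - 1) = RightEdge"
      using last(4)[OF cols[OF one(4)]] last(2)[OF rows[OF one(1)]] 4 by auto
    then show ?thesis
      by simp
  qed
qed (rule frame_crossword[OF pos])

section \<open>Chains of matching pairs as a regular language\<close>

fun walk :: "'v \<Rightarrow> 'v list \<Rightarrow> 'v \<Rightarrow> ('v \<times> 'v) list" where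
  "walk i [] j = [(i, j)]"
| "walk i (k # ks) j = (i, k) # walk k ks j"

lemma walk_append: "walk i (ks @ k # ls) j = walk i ks k @ walk k ls j"
  by (induction ks arbitrary: i) auto

text \<open>Kleene's construction for the complete graph on the vertices \<open>vs\<close>.\<close>

primrec walks :: "'v list \<Rightarrow> 'v \<Rightarrow> 'v \<Rightarrow> ('v \<times> 'v) rexp" where
  "walks [] i j = Letter (i, j)"
| "walks (v # vs) i j =
     Union (walks vs i j) (Concat (walks vs i v) (Concat (Star (walks vs v v)) (walks vs v j)))"

text \<open>A path through \<open>v\<close> is cut at its visits to \<open>v\<close>: an initial
  piece, loops at \<open>v\<close> and a final piece, none passing through \<open>v\<close> inside.
  \<open>loops\<close> glues such pieces, \<open>split\<close> cuts them.\<close>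

lemma lang_walks: "lang (walks vs i j) = {walk i ks j | ks. set ks \<subseteq> set vs}"
proof (induction vs arbitrary: i j)
  case Nil
  then show ?case
    by auto
next
  case (Cons v vs)
  let ?W = "\<lambda>i j. {walk i ks j | ks. set ks \<subseteq> set vs}"
  have loops: "\<exists>ks. set ks \<subseteq> insert v (set vs) \<and> concat us @ walk v ls j = walk v ks j"
    if "set us \<subseteq> ?W v v" "set ls \<subseteq> set vs" for us ls
    using that(1)
  proof (induction us)
    case Nil
    then show ?case
      using that(2) by auto
  next
    case (Cons u us)
    then obtain ks where "set ks \<subseteq> insert v (set vs)" "concat us @ walk v ls j = walk v ks j"
      by auto
    moreover obtain ks' where "set ks' \<subseteq> set vs" "u = walk v ks' v"
      using Cons.prems by auto
    ultimately show ?case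
      by (intro exI[of _ "ks' @ v # ks"]) (auto simp: walk_append)
  qed
  \<comment> \<open>Cutting at the first visit leaves a shorter path that starts in \<open>v\<close>
    again.\<close>
  have split: "\<exists>us ls. set us \<subseteq> ?W v v \<and> set ls \<subseteq> set vs \<and> walk v ks j = concat us @ walk v ls j"
    if "set ks \<subseteq> insert v (set vs)" for ks
    using that
  proof (induction "length ks" arbitrary: ks rule: less_induct)
    case less
    show ?case
    proof (cases "v \<in> set ks")
      case True
      then obtain as bs where ks: "ks = as @ v # bs" "v \<notin> set as"
        using split_list_first by fast
      then obtain us ls where "set us \<subseteq> ?W v v" "set ls \<subseteq> set vs" "walk v bs j = concat us @ walk v ls j"
        using less.hyps[of bs] less.prems by auto
      moreover have "walk v as v \<in> ?W v v"
        using ks less.prems by auto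
      ultimately show ?thesis
        using ks(1) by (intro exI[of _ "walk v as v # us"] exI[of _ ls]) (auto simp: walk_append)
    next
      case False
      then show ?thesis
        using less.prems by (intro exI[of _ "[]"] exI[of _ ks]) auto
    qed
  qed
  show ?case
  proof (intro equalityI subsetI)
    fix w
    assume "w \<in> lang (walks (v # vs) i j)"
    then consider "w \<in> ?W i j"
      | ks us ls where "w = walk i ks v @ concat us @ walk v ls j" "set ks \<subseteq> set vs"
          "set us \<subseteq> ?W v v" "set ls \<subseteq> set vs"
      by (auto simp: Cons.IH)
    then show "w \<in> {walk i ks j | ks. set ks \<subseteq> set (v # vs)}"
    proof cases
      case (2 ks us ls)
      then obtain ks' where "set ks' \<subseteq> insert v (set vs)" "concat us @ walk v ls j = walk v ks' j"
        using loops by blast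
      with 2 show ?thesis
        by (intro CollectI exI[of _ "ks @ v # ks'"]) (auto simp: walk_append)
    qed auto
  next
    fix w
    assume "w \<in> {walk i ks j | ks. set ks \<subseteq> set (v # vs)}"
    then obtain ks where ks: "w = walk i ks j" "set ks \<subseteq> insert v (set vs)"
      by auto
    show "w \<in> lang (walks (v # vs) i j)"
    proof (cases "v \<in> set ks")
      case True
      then obtain as bs where as: "ks = as @ v # bs" "v \<notin> set as"
        using split_list_first by fast
      then obtain us ls where us: "set us \<subseteq> ?W v v" "set ls \<subseteq> set vs" "walk v bs j = concat us @ walk v ls j"
        using split[of bs] ks by auto
      have "walk i as v \<in> ?W i v" "walk v ls j \<in> ?W v j"
        using as ks us by auto
      moreover have "w = walk i as v @ concat us @ walk v ls j"
        by (simp add: ks(1) as(1) walk_append us(3))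
      ultimately show ?thesis
        using us(1) unfolding walks.simps lang.simps Cons.IH by blast
    next
      case False
      then show ?thesis
        using ks by (auto simp: Cons.IH)
    qed
  qed
qed

lemma map_upt_eq_walk:
  "(\<exists>ks. set ks \<subseteq> V \<and> map f [0..<m] = walk i ks j) \<longleftrightarrow>
     1 \<le> m \<and> fst (f 0) = i \<and> snd (f (m - 1)) = j \<and>
     (\<forall>l. Suc l < m \<longrightarrow> snd (f l) \<in> V \<and> fst (f (Suc l)) = snd (f l))"
proof -
  have len: "length (walk i ks j) = Suc (length ks)" for ks i
    by (induction ks arbitrary: i) auto
  have nth: "l \<le> length ks \<Longrightarrow> walk i ks j ! l = ((i # ks) ! l, (ks @ [j]) ! l)" for ks i l
    by (induction ks arbitrary: i l) (auto simp: nth_Cons split: nat.split)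
  have eq: "map f [0..<m] = walk i ks j \<longleftrightarrow>
      m = Suc (length ks) \<and> (\<forall>l<m. f l = ((i # ks) ! l, (ks @ [j]) ! l))" for ks
    by (auto simp: list_eq_iff_nth_eq len nth simp del: upt_Suc)
  show ?thesis
  proof
    assume "\<exists>ks. set ks \<subseteq> V \<and> map f [0..<m] = walk i ks j"
    then obtain ks where ks: "set ks \<subseteq> V" "m = Suc (length ks)"
      "\<forall>l<m. f l = ((i # ks) ! l, (ks @ [j]) ! l)"
      unfolding eq by blast
    then show "1 \<le> m \<and> fst (f 0) = i \<and> snd (f (m - 1)) = j \<and>
        (\<forall>l. Suc l < m \<longrightarrow> snd (f l) \<in> V \<and> fst (f (Suc l)) = snd (f l))"
      by (auto simp: nth_append intro: nth_mem)
  next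
    assume f: "1 \<le> m \<and> fst (f 0) = i \<and> snd (f (m - 1)) = j \<and>
        (\<forall>l. Suc l < m \<longrightarrow> snd (f l) \<in> V \<and> fst (f (Suc l)) = snd (f l))"
    define ks where "ks = map (\<lambda>l. snd (f l)) [0..<m - 1]"
    have "f l = ((i # ks) ! l, (ks @ [j]) ! l)" if "l < m" for l
    proof -
      have "fst (f l) = (i # ks) ! l"
        using f that by (cases l) (auto simp: ks_def)
      moreover have "snd (f l) = (ks @ [j]) ! l"
        using f that by (cases "l = m - 1") (auto simp: ks_def nth_append)
      ultimately show ?thesis
        by (simp add: prod_eq_iff)
    qed
    moreover have "set ks \<subseteq> V" "m = Suc (length ks)"
      using f by (auto simp: ks_def)
    ultimately show "\<exists>ks. set ks \<subseteq> V \<and> map f [0..<m] = walk i ks j"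
      unfolding eq by blast
  qed
qed

lemma map_upt_in_walks:
  "map f [0..<m] \<in> lang (walks vs i j) \<longleftrightarrow>
     1 \<le> m \<and> fst (f 0) = i \<and> snd (f (m - 1)) = j \<and>
     (\<forall>l. Suc l < m \<longrightarrow> snd (f l) \<in> set vs \<and> fst (f (Suc l)) = snd (f l))"
  unfolding lang_walks map_upt_eq_walk[symmetric] by auto

section \<open>Computations as crosswords\<close>

primrec word_rexp :: "'a list \<Rightarrow> 'a rexp" where
  "word_rexp [] = Eps"
| "word_rexp (a # w) = Concat (Letter a) (word_rexp w)"

lemma lang_word_rexp [simp]: "lang (word_rexp w) = {w}"
  by (induction w) auto

text \<open>No expression denotes the empty language, so a finite union needs a first member. At
  each use it repeats a member of the list.\<close>

primrec alternatives :: "'a rexp \<Rightarrow> 'a rexp list \<Rightarrow> 'a rexp" where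
  "alternatives r [] = r"
| "alternatives r (s # ss) = Union s (alternatives r ss)"

lemma lang_alternatives: "lang (alternatives r ss) = (\<Union>s\<in>insert r (set ss). lang s)"
  by (induction ss) auto

definition any_word :: "'a list \<Rightarrow> 'a rexp" where
  "any_word as = Star (alternatives (Letter (hd as)) (map Letter as))"

lemma lang_any_word:
  assumes "as \<noteq> []"
  shows "lang (any_word as) = lists (set as)"
proof -
  have "lang (alternatives (Letter (hd as)) (map Letter as)) = (\<lambda>a. [a]) ` set as"
    using assms by (auto simp: lang_alternatives)
  then have *: "lang (any_word as) = {concat us | us. set us \<subseteq> (\<lambda>a. [a]) ` set as}"
    by (simp add: any_word_def)
  show ?thesis
  proof (intro equalityI subsetI)
    fix w
    assume "w \<in> lang (any_word as)"
    then obtain us where "w = concat us" "set us \<subseteq> (\<lambda>a. [a]) ` set as"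
      unfolding * by blast
    then show "w \<in> lists (set as)"
      by fastforce
  next
    fix w
    assume "w \<in> lists (set as)"
    then have "w = concat (map (\<lambda>a. [a]) w)" "set (map (\<lambda>a. [a]) w) \<subseteq> (\<lambda>a. [a]) ` set as"
      by auto
    then show "w \<in> lang (any_word as)"
      unfolding * by blast
  qed
qed

section \<open>Configurations as words, moves as rewriting\<close>

datatype sym = Sym nat | State nat

text \<open>0 is the blank and 1 the tape symbol of the input letter 0; any further symbol has been
  written by an instruction.\<close>

definition tm_symbols :: "tm \<Rightarrow> nat list" where
  "tm_symbols M = 0 # 1 # map (\<lambda>(_, _, b, _). b) M"

definition tm_states :: "tm \<Rightarrow> nat list" where
  "tm_states M = 0 # map (\<lambda>(_, q, _, _). q) M"

definition tm_syms :: "tm \<Rightarrow> sym list" where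
  "tm_syms M = map Sym (tm_symbols M) @ map State (tm_states M)"

text \<open>The test with \<open>map_of\<close> drops shadowed instructions, so the rules respect
  determinism. A move to the left displaces the symbol before the state and takes one rule for each
  such symbol.\<close>

definition instr_rules :: "tm \<Rightarrow> (nat \<times> nat) \<times> (nat \<times> nat \<times> direction) \<Rightarrow> (sym list \<times> sym list) list" where
  "instr_rules M = (\<lambda>((q, a), (q', b, d)).
     if map_of M (q, a) = Some (q', b, d) then
       (case d of
          Right \<Rightarrow> [([State q, Sym a], [Sym b, State q'])]
        | Left \<Rightarrow> map (\<lambda>c. ([Sym c, State q, Sym a], [State q', Sym c, Sym b])) (tm_symbols M))
     else [])"

text \<open>
  A configuration is a word over symbols and states in which the state stands to the left of
  the scanned symbol. One move rewrites such a word without changing its length. The first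
  rule is the identity, present only to make the list of rules nonempty.
\<close>

definition rules :: "tm \<Rightarrow> (sym list \<times> sym list) list" where
  "rules M = ([Sym 0], [Sym 0]) # concat (map (instr_rules M) M)"

lemma rules_iff:
  "(l, r) \<in> set (rules M) \<longleftrightarrow> (l = [Sym 0] \<and> r = [Sym 0]) \<or>
     (\<exists>q a q' b. map_of M (q, a) = Some (q', b, Right) \<and> l = [State q, Sym a] \<and> r = [Sym b, State q']) \<or>
     (\<exists>q a q' b c. map_of M (q, a) = Some (q', b, Left) \<and> c \<in> set (tm_symbols M) \<and>
        l = [Sym c, State q, Sym a] \<and> r = [State q', Sym c, Sym b])"
  (is "_ \<longleftrightarrow> ?A \<or> ?B \<or> ?C")
proof
  assume "(l, r) \<in> set (rules M)"
  then consider "?A" | q a q' b d where "(l, r) \<in> set (instr_rules M ((q, a), (q', b, d)))"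
    by (auto simp: rules_def)
  then show "?A \<or> ?B \<or> ?C"
  proof cases
    case (2 q a q' b d)
    then show ?thesis
      by (cases d) (auto simp: instr_rules_def split: if_splits)
  qed blast
next
  have mem: "(l, r) \<in> set (rules M)"
    if "map_of M (q, a) = Some y" "(l, r) \<in> set (instr_rules M ((q, a), y))" for q a y
    using that map_of_SomeD[OF that(1)] by (force simp: rules_def)
  assume "?A \<or> ?B \<or> ?C"
  then show "(l, r) \<in> set (rules M)"
  proof (elim disjE exE conjE)
    fix q a q' b
    assume "map_of M (q, a) = Some (q', b, Right)" "l = [State q, Sym a]" "r = [Sym b, State q']"
    then show ?thesis
      by (intro mem) (auto simp: instr_rules_def)
  next
    fix q a q' b c
    assume "map_of M (q, a) = Some (q', b, Left)" "c \<in> set (tm_symbols M)"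
      "l = [Sym c, State q, Sym a]" "r = [State q', Sym c, Sym b]"
    then show ?thesis
      by (intro mem) (auto simp: instr_rules_def)
  qed (simp add: rules_def)
qed

lemma length_rules: "(l, r) \<in> set (rules M) \<Longrightarrow> length l = length r \<and> l \<noteq> []"
  unfolding rules_iff by auto

definition step_words :: "tm \<Rightarrow> sym list \<Rightarrow> sym list \<Rightarrow> bool" where
  "step_words M u v \<longleftrightarrow> (\<exists>\<alpha> l r \<beta>. (l, r) \<in> set (rules M) \<and> \<alpha> \<in> lists (set (tm_syms M)) \<and>
     \<beta> \<in> lists (set (tm_syms M)) \<and> u = \<alpha> @ l @ \<beta> \<and> v = \<alpha> @ r @ \<beta>)"

lemma step_wordsI:
  "(l, r) \<in> set (rules M) \<Longrightarrow> \<alpha> \<in> lists (set (tm_syms M)) \<Longrightarrow> \<beta> \<in> lists (set (tm_syms M)) \<Longrightarrow>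
     step_words M (\<alpha> @ l @ \<beta>) (\<alpha> @ r @ \<beta>)"
  unfolding step_words_def by blast

lemma length_step_words: "step_words M u v \<Longrightarrow> length u = length v \<and> u \<noteq> []"
  unfolding step_words_def using length_rules by fastforce

definition init_word :: "nat \<Rightarrow> nat \<Rightarrow> nat \<Rightarrow> sym list" where
  "init_word x a b = replicate a (Sym 0) @ State 0 # replicate x (Sym 1) @ replicate b (Sym 0)"

text \<open>A state in which no instruction applies; it keeps the list of halting pairs
  nonempty.\<close>

definition fresh_state :: "tm \<Rightarrow> nat" where
  "fresh_state M = Suc (sum_list (map (\<lambda>i. fst (fst i)) M))"

lemma map_of_fresh_state: "map_of M (fresh_state M, a) = None"
proof -
  have "fst (fst i) < fresh_state M" if "i \<in> set M" for i
    using that member_le_sum_list[of "fst (fst i)" "map (\<lambda>i. fst (fst i)) M"]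
    by (auto simp: fresh_state_def less_Suc_eq_le)
  then show ?thesis
    by (force simp: map_of_eq_None_iff)
qed

definition halting_pairs :: "tm \<Rightarrow> (nat \<times> nat) list" where
  "halting_pairs M =
     (fresh_state M, 0) # filter (\<lambda>p. map_of M p = None) (List.product (tm_states M) (tm_symbols M))"

definition final_word :: "tm \<Rightarrow> sym list \<Rightarrow> bool" where
  "final_word M u \<longleftrightarrow> (\<exists>\<alpha> q a \<beta>. (q, a) \<in> set (halting_pairs M) \<and> \<alpha> \<in> lists (set (tm_syms M)) \<and>
     \<beta> \<in> lists (set (tm_syms M)) \<and> u = \<alpha> @ [State q, Sym a] @ \<beta>)"

definition both :: "'a list \<Rightarrow> 'b list \<Rightarrow> ('a option \<times> 'b option) list" where
  "both u v = zip (map Some u) (map Some v)"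

abbreviation old :: "'a list \<Rightarrow> ('a option \<times> 'b option) list" where
  "old \<equiv> map (\<lambda>a. (Some a, None))"

abbreviation new :: "'b list \<Rightarrow> ('a option \<times> 'b option) list" where
  "new \<equiv> map (\<lambda>b. (None, Some b))"

text \<open>
  Each letter of the crossword is a pair of an old and a new symbol, and each row is one
  rewriting step. The columns make the new word of a row the old word of the next one; there
  is no old word in the first row and no new word in the last row.
\<close>

definition step_rexp :: "tm \<Rightarrow> (sym option \<times> sym option) rexp" where
  "step_rexp M =
     Concat (any_word (map (\<lambda>s. (Some s, Some s)) (tm_syms M)))
    (Concat (alternatives (word_rexp (both [Sym 0] [Sym 0])) (map (\<lambda>(l, r). word_rexp (both l r)) (rules M)))
      (any_word (map (\<lambda>s. (Some s, Some s)) (tm_syms M))))"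

text \<open>The \<open>x\<close>-fold iteration of \<open>Concat (Letter _)\<close> becomes a
  primitive recursion on codes. The outer stars guess the blank padding.\<close>

definition init_rexp :: "nat \<Rightarrow> (sym option \<times> sym option) rexp" where
  "init_rexp x =
     Concat (Star (Letter (None, Some (Sym 0)))) (Concat (Letter (None, Some (State 0)))
       ((Concat (Letter (None, Some (Sym 1))) ^^ x) (Star (Letter (None, Some (Sym 0))))))"

definition final_rexp :: "tm \<Rightarrow> (sym option \<times> sym option) rexp" where
  "final_rexp M =
     Concat (any_word (old (tm_syms M)))
    (Concat (alternatives (word_rexp (old [State (fresh_state M), Sym 0]))
        (map (\<lambda>(q, a). word_rexp (old [State q, Sym a])) (halting_pairs M)))
      (any_word (old (tm_syms M))))"

definition tm_rows :: "tm \<Rightarrow> nat \<Rightarrow> (sym option \<times> sym option) rexp" where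
  "tm_rows M x = Union (init_rexp x) (Union (final_rexp M) (step_rexp M))"

definition tm_columns :: "tm \<Rightarrow> (sym option \<times> sym option) rexp" where
  "tm_columns M = walks (map Some (tm_syms M)) None None"

section \<open>The languages of rows and columns\<close>

lemma tm_syms_nonempty: "tm_syms M \<noteq> []"
  by (simp add: tm_syms_def tm_symbols_def)

lemma both_append: "length u = length v \<Longrightarrow> both (u @ u') (v @ v') = both u v @ both u' v'"
  by (simp add: both_def)

lemma both_same: "map (\<lambda>s. (Some s, Some s)) u = both u u"
  by (induction u) (auto simp: both_def)

lemma map_fst_both: "length u = length v \<Longrightarrow> map (\<lambda>p. the (fst p)) (both u v) = u"
  by (induction u v rule: list_induct2) (auto simp: both_def)

lemma map_snd_both: "length u = length v \<Longrightarrow> map (\<lambda>p. the (snd p)) (both u v) = v"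
  by (induction u v rule: list_induct2) (auto simp: both_def)

lemma lists_set_map: "lists (set (map f xs)) = map f ` lists (set xs)"
  by (simp add: lists_image)

lemma lang_step_rexp: "lang (step_rexp M) = {both u v | u v. step_words M u v}"
proof -
  let ?A = "lists (set (tm_syms M))"
  have keep: "lang (any_word (map (\<lambda>s. (Some s, Some s)) (tm_syms M))) = {both \<alpha> \<alpha> | \<alpha>. \<alpha> \<in> ?A}"
  proof -
    have ne: "map (\<lambda>s. (Some s, Some s)) (tm_syms M) \<noteq> []"
      using tm_syms_nonempty[of M] by simp
    then show ?thesis
      unfolding lang_any_word[OF ne] lists_set_map by (auto simp: both_same)
  qed
  have "([Sym 0], [Sym 0]) \<in> set (rules M)"
    by (simp add: rules_def)
  then have rule: "lang (alternatives (word_rexp (both [Sym 0] [Sym 0]))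
      (map (\<lambda>(l, r). word_rexp (both l r)) (rules M))) = {both l r | l r. (l, r) \<in> set (rules M)}"
    by (force simp: lang_alternatives)
  have eq: "both \<alpha> \<alpha> @ both l r @ both \<beta> \<beta> = both (\<alpha> @ l @ \<beta>) (\<alpha> @ r @ \<beta>)"
    if "(l, r) \<in> set (rules M)" for \<alpha> l r \<beta>
    using length_rules[OF that] by (simp add: both_append)
  show ?thesis
  proof (intro equalityI subsetI)
    fix w
    assume "w \<in> lang (step_rexp M)"
    then obtain \<alpha> l r \<beta> where w: "w = both \<alpha> \<alpha> @ both l r @ both \<beta> \<beta>"
      "(l, r) \<in> set (rules M)" "\<alpha> \<in> ?A" "\<beta> \<in> ?A"
      unfolding step_rexp_def lang.simps(4) keep rule by blast
    show "w \<in> {both u v | u v. step_words M u v}"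
      using step_wordsI[OF w(2-4)] unfolding w(1) eq[OF w(2)] by blast
  next
    fix w
    assume "w \<in> {both u v | u v. step_words M u v}"
    then obtain \<alpha> l r \<beta> where w: "w = both (\<alpha> @ l @ \<beta>) (\<alpha> @ r @ \<beta>)"
      "(l, r) \<in> set (rules M)" "\<alpha> \<in> ?A" "\<beta> \<in> ?A"
      unfolding step_words_def by blast
    show "w \<in> lang (step_rexp M)"
      unfolding w(1) eq[OF w(2), symmetric] step_rexp_def lang.simps(4) keep rule
      using w(2-4) by blast
  qed
qed

lemma lang_init_rexp: "lang (init_rexp x) = {new (init_word x a b) | a b. True}"
proof -
  have "lang ((Concat (Letter (None, Some (Sym 1))) ^^ x) (Star (Letter (None, Some (Sym 0))))) =
      {new (replicate x (Sym 1) @ replicate b (Sym 0)) | b. True}"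
    by (induction x) (auto simp: lang_Star_Letter simp del: lang.simps(5))
  then have "lang (init_rexp x) = {u @ [(None, Some (State 0))] @ v | u v.
      u \<in> {replicate a (None, Some (Sym 0)) | a. True} \<and>
      v \<in> {new (replicate x (Sym 1) @ replicate b (Sym 0)) | b. True}}"
    unfolding init_rexp_def lang.simps(2,4) lang_Star_Letter by blast
  also have "\<dots> = {new (init_word x a b) | a b. True}"
    by (auto simp: init_word_def)
  finally show ?thesis .
qed

lemma lang_final_rexp: "lang (final_rexp M) = {old u | u. final_word M u}"
proof -
  let ?A = "lists (set (tm_syms M))"
  have any: "lang (any_word (old (tm_syms M))) = {old \<alpha> | \<alpha>. \<alpha> \<in> ?A}"
    using tm_syms_nonempty[of M] by (auto simp: lang_any_word lists_set_map simp del: set_map)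
  have pair: "lang (alternatives (word_rexp (old [State (fresh_state M), Sym 0]))
      (map (\<lambda>(q, a). word_rexp (old [State q, Sym a])) (halting_pairs M))) =
      {old [State q, Sym a] | q a. (q, a) \<in> set (halting_pairs M)}"
    by (auto simp: lang_alternatives halting_pairs_def)
  show ?thesis
  proof (intro equalityI subsetI)
    fix w
    assume "w \<in> lang (final_rexp M)"
    then obtain \<alpha> q a \<beta> where w: "w = old \<alpha> @ old [State q, Sym a] @ old \<beta>"
      "(q, a) \<in> set (halting_pairs M)" "\<alpha> \<in> ?A" "\<beta> \<in> ?A"
      unfolding final_rexp_def lang.simps(4) any pair by blast
    have "final_word M (\<alpha> @ [State q, Sym a] @ \<beta>)"
      using w(2-4) unfolding final_word_def by blast
    moreover have "w = old (\<alpha> @ [State q, Sym a] @ \<beta>)"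
      by (simp add: w(1))
    ultimately show "w \<in> {old u | u. final_word M u}"
      by blast
  next
    fix w :: "(sym option \<times> sym option) list"
    assume "w \<in> {old u | u. final_word M u}"
    then obtain \<alpha> q a \<beta> where w: "w = old (\<alpha> @ [State q, Sym a] @ \<beta>)"
      "(q, a) \<in> set (halting_pairs M)" "\<alpha> \<in> ?A" "\<beta> \<in> ?A"
      unfolding final_word_def by blast
    have "w = old \<alpha> @ old [State q, Sym a] @ old \<beta>"
      by (simp add: w(1))
    then show "w \<in> lang (final_rexp M)"
      unfolding final_rexp_def lang.simps(4) any pair using w(2-4) by blast
  qed
qed

lemma tm_rows_pos: "[] \<notin> lang (tm_rows M x)"
proof -
  have "[] \<noteq> both u v" if "step_words M u v" for u v
    using length_step_words[OF that] by (cases u; cases v) (auto simp: both_def)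
  then show ?thesis
    unfolding tm_rows_def lang.simps(3) lang_step_rexp lang_init_rexp lang_final_rexp
    by (auto simp: init_word_def final_word_def)
qed

lemma tm_columns_pos: "[] \<notin> lang (tm_columns M)"
  \<comment> \<open>The instance of length 0 is the empty word, while a chain has at least one
    pair.\<close>
  using map_upt_in_walks[of undefined 0] by (simp add: tm_columns_def)

text \<open>
  The tape is represented by the symbols \<open>ls\<close> to the left of the head, listed from right to
  left, and the symbols \<open>rs\<close> starting at the head.
\<close>

definition config_word :: "sym list \<Rightarrow> nat list \<Rightarrow> nat list \<Rightarrow> tm_config \<Rightarrow> bool" where
  "config_word u ls rs = (\<lambda>(q, p, t). u = map Sym (rev ls) @ State q # map Sym rs \<and>
     (\<forall>i<length ls. ls ! i = t (p - 1 - int i)) \<and> (\<forall>i<length rs. rs ! i = t (p + int i)))"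

section \<open>Rewriting simulates the machine\<close>

lemma config_word_init:
  "config_word (init_word x a b) (replicate a 0) (replicate x 1 @ replicate b 0) (tm_init (replicate x 0))"
  by (auto simp: config_word_def tm_init_def init_word_def nth_append)

lemma config_word_right:
  assumes "config_word u ls (a # rs) (q, p, t)"
  shows "t p = a"
    "config_word (map Sym (rev (b # ls)) @ State q' # map Sym rs) (b # ls) rs (q', p + 1, t(p := b))"
proof -
  have ls: "\<forall>i<length ls. ls ! i = t (p - 1 - int i)"
    and rs: "\<forall>i<Suc (length rs). (a # rs) ! i = t (p + int i)"
    using assms by (auto simp: config_word_def)
  show "t p = a"
    using rs[rule_format, of 0] by simp
  have "(b # ls) ! i = (t(p := b)) (p + 1 - 1 - int i)" if "i < length (b # ls)" for i
    using ls that by (cases i) (auto simp: algebra_simps)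
  moreover have "rs ! i = (t(p := b)) (p + 1 + int i)" if "i < length rs" for i
    using rs[rule_format, of "Suc i"] that by (simp add: algebra_simps)
  ultimately show "config_word (map Sym (rev (b # ls)) @ State q' # map Sym rs) (b # ls) rs (q', p + 1, t(p := b))"
    by (simp add: config_word_def)
qed

lemma config_word_left:
  assumes "config_word u (c # ls) (a # rs) (q, p, t)"
  shows "config_word (map Sym (rev ls) @ State q' # map Sym (c # b # rs)) ls (c # b # rs) (q', p - 1, t(p := b))"
proof -
  have ls: "\<forall>i<Suc (length ls). (c # ls) ! i = t (p - 1 - int i)"
    and rs: "\<forall>i<Suc (length rs). (a # rs) ! i = t (p + int i)"
    using assms by (auto simp: config_word_def)
  have "ls ! i = (t(p := b)) (p - 1 - 1 - int i)" if "i < length ls" for i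
    using ls[rule_format, of "Suc i"] that by (simp add: algebra_simps)
  moreover have "(c # b # rs) ! i = (t(p := b)) (p - 1 + int i)" if "i < length (c # b # rs)" for i
  proof -
    consider "i = 0" | "i = 1" | j where "i = Suc (Suc j)"
      by (metis One_nat_def not0_implies_Suc)
    then show ?thesis
    proof cases
      case 1
      then show ?thesis
        using ls[rule_format, of 0] by simp
    next
      case (3 j)
      then show ?thesis
        using rs[rule_format, of "Suc j"] that by (simp add: algebra_simps)
    qed simp
  qed
  ultimately show ?thesis
    by (simp add: config_word_def)
qed

text \<open>A configuration word contains exactly one state, so an occurrence of a state fixes the
  whole decomposition. This pins the left side of a move rule to the head.\<close>

lemma map_Sym_State_eq:
  "map Sym xs @ State q # map Sym ys = \<alpha> @ State q' # \<beta> \<longleftrightarrow>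
     q = q' \<and> \<alpha> = map Sym xs \<and> \<beta> = map Sym ys"
proof (induction xs arbitrary: \<alpha>)
  case Nil
  show ?case
    by (cases \<alpha>) (auto simp: map_eq_append_conv map_eq_Cons_conv)
next
  case (Cons x xs)
  then show ?case
    by (cases \<alpha>) auto
qed

text \<open>Since the state occurs once, a rule that mentions a state must be the move of the
  machine itself; the identity rule corresponds to no move, hence the reflexive closure.\<close>

lemma step_words_sound:
  assumes c: "config_word u ls rs c" and "step_words M u v"
  shows "\<exists>c' ls' rs'. (c, c') \<in> (tm_rel M)\<^sup>* \<and> config_word v ls' rs' c'"
proof -
  obtain q p t where cq: "c = (q, p, t)"
    by (cases c) auto
  have u: "u = map Sym (rev ls) @ State q # map Sym rs"
    using c by (simp add: config_word_def cq)
  obtain \<alpha> l r \<beta> where lr: "(l, r) \<in> set (rules M)" "u = \<alpha> @ l @ \<beta>" "v = \<alpha> @ r @ \<beta>"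
    using assms(2) by (auto simp: step_words_def)
  from lr(1) consider "l = [Sym 0]" "r = [Sym 0]"
    | q0 a q' b where "map_of M (q0, a) = Some (q', b, Right)" "l = [State q0, Sym a]" "r = [Sym b, State q']"
    | q0 a q' b d where "map_of M (q0, a) = Some (q', b, Left)" "l = [Sym d, State q0, Sym a]" "r = [State q', Sym d, Sym b]"
    unfolding rules_iff by blast
  then show ?thesis
  proof cases
    case 1
    then show ?thesis
      using c lr by blast
  next
    case (2 q0 a q' b)
    have "map Sym (rev ls) @ State q # map Sym rs = \<alpha> @ State q0 # Sym a # \<beta>"
      using u lr(2) 2(2) by simp
    then have "q0 = q" "\<alpha> = map Sym (rev ls)" "Sym a # \<beta> = map Sym rs"
      unfolding map_Sym_State_eq by auto
    moreover from this(3) obtain rs' where "rs = a # rs'" "\<beta> = map Sym rs'"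
      by (cases rs) auto
    ultimately show ?thesis
      using config_word_right(1)[of u ls a rs' q p t] config_word_right(2)[of u ls a rs' q p t b q'] c 2 lr(3) cq
      by (intro exI[of _ "(q', p + 1, t(p := b))"] exI[of _ "b # ls"] exI[of _ rs'])
        (auto simp: tm_rel_def)
  next
    case (3 q0 a q' b d)
    have "map Sym (rev ls) @ State q # map Sym rs = (\<alpha> @ [Sym d]) @ State q0 # Sym a # \<beta>"
      using u lr(2) 3(2) by simp
    then have "q0 = q" "\<alpha> @ [Sym d] = map Sym (rev ls)" "Sym a # \<beta> = map Sym rs"
      unfolding map_Sym_State_eq by auto
    moreover from this(2) obtain ls' where "ls = d # ls'" "\<alpha> = map Sym (rev ls')"
      by (cases ls) auto
    moreover from \<open>Sym a # \<beta> = map Sym rs\<close> obtain rs' where "rs = a # rs'" "\<beta> = map Sym rs'"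
      by (cases rs) auto
    ultimately show ?thesis
      using config_word_left[of u d ls' a rs' q p t q' b] config_word_right(1)[of u ls a rs' q p t] c 3 lr(3) cq
      by (intro exI[of _ "(q', p - 1, t(p := b))"] exI[of _ ls'] exI[of _ "d # b # rs'"])
        (auto simp: tm_rel_def)
  qed
qed

lemma final_word_sound:
  assumes c: "config_word u ls rs c" and "final_word M u"
  shows "tm_step M c = None"
proof -
  obtain q p t where cq: "c = (q, p, t)"
    by (cases c) auto
  have u: "u = map Sym (rev ls) @ State q # map Sym rs"
    using c by (simp add: config_word_def cq)
  obtain \<alpha> q0 a \<beta> where h: "(q0, a) \<in> set (halting_pairs M)" "u = \<alpha> @ State q0 # Sym a # \<beta>"
    using assms(2) by (auto simp: final_word_def)
  have "map_of M (q0, a) = None"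
    using h(1) map_of_fresh_state by (auto simp: halting_pairs_def simp del: map_of_eq_None_iff)
  moreover have "q0 = q" "Sym a # \<beta> = map Sym rs"
    using h(2) unfolding u map_Sym_State_eq by auto
  moreover from this(2) obtain rs' where "rs = a # rs'"
    by (cases rs) auto
  ultimately show ?thesis
    using config_word_right(1)[of u ls a rs' q p t] c cq by (simp del: map_of_eq_None_iff)
qed

text \<open>The index \<open>k\<close> is the number of moves for which the represented part of the tape suffices.\<close>

definition config_word_for :: "tm \<Rightarrow> nat \<Rightarrow> sym list \<Rightarrow> tm_config \<Rightarrow> bool" where
  "config_word_for M k u c \<longleftrightarrow> (\<exists>ls rs. config_word u ls rs c \<and> k \<le> length ls \<and> k < length rs \<and>
     set ls \<subseteq> set (tm_symbols M) \<and> set rs \<subseteq> set (tm_symbols M) \<and> fst c \<in> set (tm_states M))"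

lemma config_word_for_syms: "config_word_for M k u c \<Longrightarrow> u \<in> lists (set (tm_syms M))"
  by (cases c) (fastforce simp: config_word_for_def config_word_def tm_syms_def)

text \<open>The scanned cell belongs to the right part, hence one blank more on that side.\<close>

lemma config_word_for_init:
  "config_word_for M k (init_word x k (Suc k)) (tm_init (replicate x 0))"
  unfolding config_word_for_def
  by (intro exI conjI, rule config_word_init) (auto simp: tm_symbols_def tm_states_def tm_init_def)

text \<open>The head shifts by one cell, so a move uses up at most one symbol of the reserve on
  either side.\<close>

lemma step_words_complete:
  assumes c: "config_word_for M (Suc k) u c" and s: "tm_step M c = Some c'"
  shows "\<exists>v. step_words M u v \<and> config_word_for M k v c'"
proof -
  obtain ls rs where lr: "config_word u ls rs c" "Suc k \<le> length ls" "Suc k < length rs"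
    "set ls \<subseteq> set (tm_symbols M)" "set rs \<subseteq> set (tm_symbols M)"
    using c by (auto simp: config_word_for_def)
  obtain q p t where cq: "c = (q, p, t)"
    by (cases c) auto
  obtain d ls' where ls: "ls = d # ls'"
    using lr(2) by (cases ls) auto
  obtain a rs' where rs: "rs = a # rs'"
    using lr(3) by (cases rs) auto
  have u: "u = map Sym (rev ls) @ State q # map Sym rs"
    using lr(1) by (simp add: config_word_def cq)
  have a: "t p = a"
    using config_word_right(1) lr(1) unfolding cq rs by blast
  obtain q' b e where m: "map_of M (q, a) = Some (q', b, e)" and c': "c' = (q', move e p, t(p := b))"
    using s a by (auto simp: cq split: option.splits)
  have mem: "((q, a), (q', b, e)) \<in> set M"
    using m by (rule map_of_SomeD)
  then have "b \<in> (\<lambda>(_, _, b, _). b) ` set M" "q' \<in> (\<lambda>(_, q, _, _). q) ` set M"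
    by (auto intro!: image_eqI[OF _ mem])
  then have bq: "b \<in> set (tm_symbols M)" "q' \<in> set (tm_states M)"
    by (auto simp: tm_symbols_def tm_states_def)
  have A: "map Sym xs \<in> lists (set (tm_syms M))" if "set xs \<subseteq> set (tm_symbols M)" for xs
    using that by (fastforce simp: tm_syms_def)
  show ?thesis
  proof (cases e)
    case Right
    let ?v = "map Sym (rev (b # ls)) @ State q' # map Sym rs'"
    have "([State q, Sym a], [Sym b, State q']) \<in> set (rules M)"
      using m Right unfolding rules_iff by blast
    moreover have "map Sym (rev ls) \<in> lists (set (tm_syms M))" "map Sym rs' \<in> lists (set (tm_syms M))"
      using lr rs by (auto intro!: A)
    ultimately have "step_words M u ?v"
      using step_wordsI[of "[State q, Sym a]" "[Sym b, State q']" M "map Sym (rev ls)" "map Sym rs'"]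
      by (simp add: u rs)
    moreover have "config_word ?v (b # ls) rs' c'"
      using config_word_right(2) lr(1) unfolding cq rs c' Right move.simps by blast
    then have "config_word_for M k ?v c'"
      unfolding config_word_for_def
      by (intro exI[of _ "b # ls"] exI[of _ rs']) (use lr rs bq c' in auto)
    ultimately show ?thesis
      by blast
  next
    case Left
    let ?v = "map Sym (rev ls') @ State q' # map Sym (d # b # rs')"
    have "([Sym d, State q, Sym a], [State q', Sym d, Sym b]) \<in> set (rules M)"
      using m Left lr(4) ls unfolding rules_iff by auto
    moreover have "map Sym (rev ls') \<in> lists (set (tm_syms M))" "map Sym rs' \<in> lists (set (tm_syms M))"
      using lr rs ls by (auto intro!: A)
    ultimately have "step_words M u ?v"
      using step_wordsI[of "[Sym d, State q, Sym a]" "[State q', Sym d, Sym b]" M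
          "map Sym (rev ls')" "map Sym rs'"]
      by (simp add: u rs ls)
    moreover have "config_word ?v ls' (d # b # rs') c'"
      using config_word_left lr(1) unfolding cq rs ls c' Left move.simps by blast
    then have "config_word_for M k ?v c'"
      unfolding config_word_for_def
      by (intro exI[of _ ls'] exI[of _ "d # b # rs'"]) (use lr rs ls bq c' in auto)
    ultimately show ?thesis
      by blast
  qed
qed

lemma final_word_complete:
  assumes "config_word_for M k u c" "tm_step M c = None"
  shows "final_word M u"
proof -
  obtain ls rs where lr: "config_word u ls rs c" "k < length rs"
    "set ls \<subseteq> set (tm_symbols M)" "set rs \<subseteq> set (tm_symbols M)" "fst c \<in> set (tm_states M)"
    using assms(1) by (auto simp: config_word_for_def)
  obtain q p t where cq: "c = (q, p, t)"
    by (cases c) auto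
  obtain a rs' where rs: "rs = a # rs'"
    using lr(2) by (cases rs) auto
  have u: "u = map Sym (rev ls) @ State q # map Sym rs"
    using lr(1) by (simp add: config_word_def cq)
  have "t p = a"
    using config_word_right(1) lr(1) unfolding cq rs by blast
  then have "map_of M (q, a) = None"
    using assms(2) by (auto simp: cq simp del: map_of_eq_None_iff split: option.splits prod.splits)
  then have "(q, a) \<in> set (halting_pairs M)"
    using lr(4,5) by (simp add: halting_pairs_def cq rs del: map_of_eq_None_iff)
  moreover have "map Sym (rev ls) \<in> lists (set (tm_syms M))" "map Sym rs' \<in> lists (set (tm_syms M))"
    using lr rs by (fastforce simp: tm_syms_def)+
  moreover have "u = map Sym (rev ls) @ [State q, Sym a] @ map Sym rs'"
    using u rs by simp
  ultimately show ?thesis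
    unfolding final_word_def by blast
qed

text \<open>A run of \<open>T\<close> moves gives \<open>T + 2\<close> rows: the initial word,
  \<open>T\<close> rewritings and the final word. Reserving \<open>T\<close> cells on each side
  leaves \<open>T - j\<close> after \<open>j\<close> moves, so no word ever has to grow.\<close>

lemma tm_crossword_complete:
  assumes "tm_halts M (replicate x 0)"
  shows "has_crossword (tm_rows M x) (tm_columns M)"
proof -
  obtain c where c: "(tm_init (replicate x 0), c) \<in> (tm_rel M)\<^sup>*" "tm_step M c = None"
    using assms by (auto simp: tm_halts_iff)
  then obtain T where "(tm_init (replicate x 0), c) \<in> tm_rel M ^^ T"
    using rtrancl_imp_relpow by blast
  then obtain f where f: "f 0 = tm_init (replicate x 0)" "f T = c"
    "\<And>i. i < T \<Longrightarrow> tm_step M (f i) = Some (f (Suc i))"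
    unfolding relpow_fun_conv tm_rel_def by auto
  have "\<exists>us. us 0 = init_word x T (Suc T) \<and> (\<forall>j<i. step_words M (us j) (us (Suc j))) \<and>
      (\<forall>j\<le>i. config_word_for M (T - j) (us j) (f j))" if "i \<le> T" for i
    using that
  proof (induction i)
    case 0
    then show ?case
      using config_word_for_init[of M T x] f(1) by (intro exI[of _ "\<lambda>_. init_word x T (Suc T)"]) simp
  next
    case (Suc i)
    then obtain us where us: "us 0 = init_word x T (Suc T)" "\<forall>j<i. step_words M (us j) (us (Suc j))"
      "\<forall>j\<le>i. config_word_for M (T - j) (us j) (f j)"
      by auto
    have "config_word_for M (Suc (T - Suc i)) (us i) (f i)"
      using us(3) Suc.prems by (simp add: Suc_diff_Suc)
    then obtain v where v: "step_words M (us i) v" "config_word_for M (T - Suc i) v (f (Suc i))"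
      using step_words_complete f(3)[of i] Suc.prems by (meson Suc_le_lessD)
    show ?case
    proof (intro exI[of _ "us(Suc i := v)"] conjI allI impI)
      fix j
      assume "j < Suc i"
      then show "step_words M ((us(Suc i := v)) j) ((us(Suc i := v)) (Suc j))"
        using us(2) v(1) by (cases "j = i") auto
    next
      fix j
      assume "j \<le> Suc i"
      then show "config_word_for M (T - j) ((us(Suc i := v)) j) (f j)"
        using us(3) v(2) by (cases "j = Suc i") auto
    qed (use us(1) in simp)
  qed
  from this[of T] obtain us where us: "us 0 = init_word x T (Suc T)"
    "\<And>j. j < T \<Longrightarrow> step_words M (us j) (us (Suc j))"
    "\<And>j. j \<le> T \<Longrightarrow> config_word_for M (T - j) (us j) (f j)"
    by auto
  define n where "n = length (us 0)"
  have n: "length (us j) = n" if "j \<le> T" for j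
    using that by (induction j) (auto simp: n_def dest: length_step_words[OF us(2), OF Suc_le_lessD])
  have syms: "us i ! j \<in> set (tm_syms M)" if "i \<le> T" "j < n" for i j
    using config_word_for_syms[OF us(3)[OF that(1)]] n[OF that(1)] that(2) by auto
  \<comment> \<open>Row \<open>i\<close> carries word number \<open>i - 1\<close> as old and word
    number \<open>i\<close> as new; \<open>None\<close> closes the columns at both ends.\<close>
  define X where "X i j = (if i = 0 then None else Some (us (i - 1) ! j),
    if i = Suc T then None else Some (us i ! j))" for i j
  have map_nth_n: "map (\<lambda>j. g (us i ! j)) [0..<n] = map g (us i)" if "i \<le> T" for i and g :: "sym \<Rightarrow> 'b"
    using n[OF that] by (auto intro: nth_equalityI)
  have "row n X i \<in> lang (tm_rows M x)" if "i < T + 2" for i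
  proof -
    consider "i = 0" | "i = Suc T" | k where "i = Suc k" "k < T"
      using \<open>i < T + 2\<close> by (cases i; cases "i = Suc T") auto
    then show ?thesis
    proof cases
      case 1
      then have "row n X i = new (us 0)"
        using map_nth_n[of 0 "\<lambda>b. (None, Some b)"] by (simp add: row_def X_def)
      then show ?thesis
        unfolding tm_rows_def lang.simps(3) lang_init_rexp us(1) by blast
    next
      case 2
      then have "row n X i = old (us T)"
        using map_nth_n[of T "\<lambda>a. (Some a, None)"] by (simp add: row_def X_def)
      moreover have "final_word M (us T)"
        using final_word_complete[OF us(3)[OF order_refl]] c(2) f(2) by simp
      ultimately show ?thesis
        unfolding tm_rows_def lang.simps(3) lang_final_rexp by blast
    next
      case (3 k)
      have "row n X i = both (us k) (us (Suc k))"
        by (rule nth_equalityI) (use 3 n[of k] n[of "Suc k"] in \<open>auto simp: row_def both_def X_def\<close>)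
      moreover have "step_words M (us k) (us (Suc k))"
        using us(2) 3 by simp
      ultimately show ?thesis
        unfolding tm_rows_def lang.simps(3) lang_step_rexp by blast
    qed
  qed
  moreover have "column (T + 2) X j \<in> lang (tm_columns M)" if "j < n" for j
    unfolding tm_columns_def column_def map_upt_in_walks using syms that by (auto simp: X_def)
  moreover have "1 \<le> n"
    by (simp add: n_def us(1) init_word_def)
  ultimately show ?thesis
    unfolding has_crossword_def by (intro exI[of _ "T + 2"] exI[of _ n] exI[of _ X]) auto
qed

text \<open>The kind of a row shows in its first cell, by which components are \<open>None\<close>,
  and the columns dictate that pattern: the old part is missing in the first row only, the new part
  in the last row only. The array therefore reads as initial word, rewritings, final word.\<close>

lemma tm_crossword_sound:
  assumes "has_crossword (tm_rows M x) (tm_columns M)"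
  shows "tm_halts M (replicate x 0)"
proof -
  obtain m n X where mn: "1 \<le> m" "1 \<le> n" and rows: "\<And>i. i < m \<Longrightarrow> row n X i \<in> lang (tm_rows M x)"
    and cols: "\<And>j. j < n \<Longrightarrow> column m X j \<in> lang (tm_columns M)"
    using assms unfolding has_crossword_def by blast
  have col: "fst (X 0 j) = None" "snd (X (m - 1) j) = None"
    "Suc i < m \<Longrightarrow> snd (X i j) \<in> Some ` set (tm_syms M)"
    "Suc i < m \<Longrightarrow> fst (X (Suc i) j) = snd (X i j)" if "j < n" for i j
    using cols[OF that] unfolding tm_columns_def column_def map_upt_in_walks by auto
  have head: "X i 0 = hd (row n X i)" for i
    using mn(2) by (simp add: row_def hd_map)
  have row_cases: "(\<exists>a b. row n X i = new (init_word x a b)) \<and> fst (X i 0) = None \<and> snd (X i 0) \<noteq> None \<or>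
      (\<exists>u. row n X i = old u \<and> final_word M u) \<and> fst (X i 0) \<noteq> None \<and> snd (X i 0) = None \<or>
      (\<exists>u v. row n X i = both u v \<and> step_words M u v) \<and> fst (X i 0) \<noteq> None \<and> snd (X i 0) \<noteq> None"
    if im: "i < m" for i
  proof -
    consider a b where "row n X i = new (init_word x a b)"
      | u where "row n X i = old u" "final_word M u"
      | u v where "row n X i = both u v" "step_words M u v"
      using rows[OF im] unfolding tm_rows_def lang.simps(3) lang_step_rexp lang_init_rexp lang_final_rexp
      by blast
    then show ?thesis
    proof cases
      case (1 a b)
      then have "fst (X i 0) = None \<and> snd (X i 0) \<noteq> None"
        by (cases a) (auto simp: head init_word_def)
      then show ?thesis
        using 1 by blast
    next
      case (2 u)
      then have "u \<noteq> []"
        by (auto simp: final_word_def)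
      then have "fst (X i 0) \<noteq> None \<and> snd (X i 0) = None"
        using 2(1) by (cases u) (auto simp: head)
      then show ?thesis
        using 2 by blast
    next
      case (3 u v)
      then have "u \<noteq> []" "v \<noteq> []"
        using length_step_words by fastforce+
      then have "fst (X i 0) \<noteq> None \<and> snd (X i 0) \<noteq> None"
        using 3(1) by (cases u; cases v) (auto simp: head both_def)
      then show ?thesis
        using 3 by blast
    qed
  qed
  have "0 < n" "0 < m"
    using mn by auto
  define u where "u i = map (\<lambda>p. the (snd p)) (row n X i)" for i
  have u_Suc: "map (\<lambda>p. the (fst p)) (row n X (Suc i)) = u i" if "Suc i < m" for i
    using col(4)[OF _ that] by (auto simp: u_def row_def)
  have first: "\<exists>a b. row n X 0 = new (init_word x a b)" "snd (X 0 0) \<noteq> None"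
    using row_cases[OF \<open>0 < m\<close>] col(1)[OF \<open>0 < n\<close>] by auto
  \<comment> \<open>A single row would be first and last at once, but an initial row has a new
    part.\<close>
  have m2: "2 \<le> m"
  proof (rule ccontr)
    assume "\<not> 2 \<le> m"
    then have "m - 1 = 0"
      by simp
    then show False
      using first(2) col(2)[OF \<open>0 < n\<close>] by simp
  qed
  have "\<exists>c ls rs. (tm_init (replicate x 0), c) \<in> (tm_rel M)\<^sup>* \<and> config_word (u i) ls rs c"
    if "Suc i < m" for i
    using that
  proof (induction i)
    case 0
    obtain a b where "row n X 0 = new (init_word x a b)"
      using first(1) by blast
    then have "u 0 = init_word x a b"
      by (simp add: u_def comp_def)
    then show ?case
      using config_word_init[of x a b] by (metis rtrancl.rtrancl_refl)
  next
    case (Suc i)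
    then obtain c ls rs where c: "(tm_init (replicate x 0), c) \<in> (tm_rel M)\<^sup>*" "config_word (u i) ls rs c"
      using Suc_lessD by blast
    have "fst (X (Suc i) 0) \<noteq> None" "snd (X (Suc i) 0) \<noteq> None"
      using col(3,4)[OF \<open>0 < n\<close>, of i] col(3)[OF \<open>0 < n\<close>, of "Suc i"] Suc.prems by auto
    then obtain v w where vw: "row n X (Suc i) = both v w" "step_words M v w"
      using row_cases[of "Suc i"] Suc.prems by auto
    have "v = u i" "w = u (Suc i)"
      using u_Suc[of i] Suc.prems vw length_step_words[OF vw(2)]
      by (simp_all add: map_fst_both map_snd_both u_def)
    then obtain c' ls' rs' where "(c, c') \<in> (tm_rel M)\<^sup>*" "config_word (u (Suc i)) ls' rs' c'"
      using step_words_sound[OF c(2)] vw(2) by blast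
    then show ?case
      using c(1) by (meson rtrancl_trans)
  qed
  note reached = this
  have m1: "Suc (m - 2) = m - 1" "Suc (m - 2) < m"
    using m2 by arith+
  from reached[OF m1(2)] obtain c ls rs where
    c: "(tm_init (replicate x 0), c) \<in> (tm_rel M)\<^sup>*" "config_word (u (m - 2)) ls rs c"
    by (elim exE conjE)
  have "snd (X (m - 1) 0) = None" "fst (X (m - 1) 0) \<noteq> None"
    using col(2)[OF \<open>0 < n\<close>] col(3,4)[OF \<open>0 < n\<close> m1(2)] m1(1) by auto
  then obtain v where v: "row n X (m - 1) = old v" "final_word M v"
    using row_cases[of "m - 1"] \<open>0 < m\<close> by auto
  have "v = u (m - 2)"
    using u_Suc[OF m1(2)] unfolding m1(1) v(1) by (simp add: comp_def)
  then have "tm_step M c = None"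
    using final_word_sound[OF c(2)] v(2) by simp
  then show ?thesis
    unfolding tm_halts_iff using c(1) by blast
qed

section \<open>The equivalence\<close>

text \<open>The eight frame symbols take 0 to 7 and inner letters start at 8; within a pair, 0
  stands for \<open>None\<close>, odd numbers for symbols and positive even ones for states.\<close>

definition letter_code :: "(sym option \<times> sym option) framed \<Rightarrow> nat" where
  "letter_code =
     (let sym = (\<lambda>s. case s of None \<Rightarrow> 0 | Some (Sym a) \<Rightarrow> Suc (2 * a) | Some (State q) \<Rightarrow> Suc (Suc (2 * q)))
      in rec_framed 0 1 2 3 (\<lambda>(a, b). 8 + prod_encode (sym a, sym b)) 4 5 6 7)"

lemma inj_letter_code: "inj letter_code"
proof -
  define sym :: "sym option \<Rightarrow> nat" where
    "sym = (\<lambda>s. case s of None \<Rightarrow> 0 | Some (Sym a) \<Rightarrow> Suc (2 * a) | Some (State q) \<Rightarrow> Suc (Suc (2 * q)))"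
  have sym: "sym s = sym t \<longleftrightarrow> s = t" for s t
    unfolding sym_def by (auto split: option.split sym.split; presburger)
  show ?thesis
  proof (rule injI)
    fix x y
    assume "letter_code x = letter_code y"
    then show "x = y"
      unfolding letter_code_def Let_def sym_def[symmetric] by (cases x; cases y) (auto simp: sym)
  qed
qed

definition tm_crossword_rexp :: "tm \<Rightarrow> nat \<Rightarrow> nat rexp" where
  "tm_crossword_rexp M x = map_rexp letter_code (frame (tm_rows M x) (tm_columns M))"

lemma tm_crossword_rexp:
  "rexp_encode (tm_crossword_rexp M x) \<in> crossword_problem \<longleftrightarrow> tm_halts M (replicate x 0)"
proof -
  have "rexp_encode (tm_crossword_rexp M x) \<in> crossword_problem \<longleftrightarrow>
      has_crossword (frame (tm_rows M x) (tm_columns M)) (frame (tm_rows M x) (tm_columns M))"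
    unfolding crossword_problem_iff has_crossword_def[symmetric] tm_crossword_rexp_def
      positive_map_rexp has_crossword_map_rexp[OF inj_letter_code]
    by (simp add: positive_frame)
  also have "\<dots> \<longleftrightarrow> has_crossword (tm_rows M x) (tm_columns M)"
    by (rule has_crossword_frame[OF tm_rows_pos tm_columns_pos])
  also have "\<dots> \<longleftrightarrow> tm_halts M (replicate x 0)"
    using tm_crossword_complete tm_crossword_sound by blast
  finally show ?thesis .
qed

section \<open>Computability of the reductions\<close>

lemma computable_rexp_power:
  "computable 1 (\<lambda>xs. rexp_encode (map_rexp f ((Concat (Letter a) ^^ hd xs) r)))"
proof -
  have "rexp_encode (map_rexp f ((Concat (Letter a) ^^ n) r)) =
      rec_nat (rexp_encode (map_rexp f r)) (\<lambda>_ y. concat_code (lit_code (f a)) y) n" for n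
    by (induction n) auto
  then show ?thesis
    unfolding One_nat_def by (simp only:) (intro computable_rec computable_codes computable_intros)
qed

text \<open>The expression is unfolded only as far as the input occurs: the remaining subexpressions
  are fixed by \<open>M\<close> and enter as constant codes, and the power is a primitive
  recursion.\<close>

lemma computable_tm_crossword_rexp:
  "computable 1 (\<lambda>xs. rexp_encode (tm_crossword_rexp M (hd xs)))"
  unfolding tm_crossword_rexp_def frame_def tm_rows_def init_rexp_def rexp.map rexp.map_comp
    rexp_encode_code
  by (intro computable_codes computable_const computable_rexp_power)

lemma computable_replicate_code:
  "computable 1 (\<lambda>xs. prod_encode (c, list_encode (replicate (hd xs) 0)))"
  "computable 1 (\<lambda>xs. prod_encode (hd xs, list_encode (replicate (hd xs) 0)))"
proof -
  have "list_encode (replicate n 0) = rec_nat 0 (\<lambda>_ y. Suc (prod_encode (0, y))) n" for n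
    by (induction n) auto
  then show "computable 1 (\<lambda>xs. prod_encode (c, list_encode (replicate (hd xs) 0)))"
    "computable 1 (\<lambda>xs. prod_encode (hd xs, list_encode (replicate (hd xs) 0)))"
    unfolding One_nat_def by (simp_all only:) (intro computable_rec computable_intros)+
qed

text \<open>The same search machine serves both reductions: it is fixed by \<open>A\<close>, and
  only its unary input varies.\<close>

lemma re_reducible:
  assumes "re_pred 1 (\<lambda>xs. hd xs \<in> A)"
  shows "many_one_reducible A halting_problem" "many_one_reducible A crossword_problem"
proof -
  obtain Q where Q: "computable_pred 2 Q" "\<And>x. x \<in> A \<longleftrightarrow> (\<exists>n. Q [n, x])"
  proof -
    from assms obtain Q where "computable_pred (Suc 1) Q"
      "\<forall>xs. length xs = 1 \<longrightarrow> hd xs \<in> A \<longleftrightarrow> (\<exists>n. Q (n # xs))"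
      unfolding re_pred_def by blast
    then show thesis
      by (intro that[of Q]) (simp_all add: numeral_2_eq_2, metis One_nat_def length_Cons list.sel(1) list.size(3))
  qed
  have "computable 2 (\<lambda>ys. 1 - of_bool (Q ys))"
    using Q(1) unfolding computable_pred_def by (intro computable_diff computable_const)
  then obtain M where "\<forall>x. tm_halts M (replicate x 0) \<longleftrightarrow> (\<exists>n. 1 - of_bool (Q [n, x]) = (0 :: nat))"
    using ex_tm_search[of "\<lambda>ys. 1 - of_bool (Q ys)"] by blast
  then have M: "x \<in> A \<longleftrightarrow> tm_halts M (replicate x 0)" for x
    by (simp add: Q(2))
  show "many_one_reducible A halting_problem"
    unfolding many_one_reducible_def
  proof (intro exI conjI allI)
    show "total_computable (\<lambda>x. prod_encode (tm_encode M, list_encode (replicate x 0)))"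
      unfolding total_computable_iff by (rule computable_replicate_code)
  qed (simp only: M in_halting_problem_iff)
  show "many_one_reducible A crossword_problem"
    unfolding many_one_reducible_def
  proof (intro exI conjI allI)
    show "total_computable (\<lambda>x. rexp_encode (tm_crossword_rexp M x))"
      unfolding total_computable_iff by (rule computable_tm_crossword_rexp)
  qed (simp only: M tm_crossword_rexp)
qed

lemma decidable_reducible:
  assumes "many_one_reducible A B" "decidable B"
  shows "decidable A"
proof -
  obtain f where f: "total_computable f" "\<And>x. x \<in> A \<longleftrightarrow> f x \<in> B"
    using assms(1) by (auto simp: many_one_reducible_def)
  have "computable 1 (\<lambda>xs. if f (hd xs) \<in> B then 1 else 0)"
    by (rule computable_fun1[where F = "\<lambda>y. if y \<in> B then 1 else 0"])
      (use assms(2) f(1) in \<open>simp_all add: decidable_def total_computable_iff\<close>)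
  then show ?thesis
    by (simp add: decidable_def total_computable_iff f(2))
qed

text \<open>
  If halting were decidable, some machine would halt exactly on the codes of machines that do
  not halt on their own code.
\<close>

lemma undecidable_halting_problem: "\<not> decidable halting_problem"
proof
  assume "decidable halting_problem"
  then have "computable 1 (\<lambda>xs. if hd xs \<in> halting_problem then 1 else 0)"
    by (simp add: decidable_def total_computable_iff)
  then have "computable 1 (\<lambda>xs. if prod_encode (hd xs, list_encode (replicate (hd xs) 0)) \<in> halting_problem
      then 1 else 0)"
    by (rule computable_fun1[where F = "\<lambda>y. if y \<in> halting_problem then 1 else 0"])
      (rule computable_replicate_code)
  then have "computable (Suc 1) (\<lambda>ys. if prod_encode (hd (tl ys), list_encode (replicate (hd (tl ys)) 0))
      \<in> halting_problem then 1 else 0)"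
    by (rule computable_tl)
  from ex_tm_search[OF this[unfolded Suc_1]] obtain M where
    M: "\<forall>x. tm_halts M (replicate x 0) \<longleftrightarrow>
      (\<exists>n. (if prod_encode (hd (tl [n, x]), list_encode (replicate (hd (tl [n, x])) 0)) \<in> halting_problem
        then 1 else 0) = (0 :: nat))" ..
  \<comment> \<open>Diagonalization: the machine is run on its own code, written in unary.\<close>
  from M[rule_format, of "tm_encode M"] show False
    by (simp add: in_halting_problem_iff split: if_splits)
qed

theorem theorem3p5:
  "\<not> decidable crossword_problem \<and> m_equivalent crossword_problem halting_problem"
  using re_reducible[OF re_pred_halting_problem] re_reducible[OF re_pred_crossword_problem]
    decidable_reducible undecidable_halting_problem
  unfolding m_equivalent_def by blast

end
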